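(* Let $\omega_1,\dots,\omega_k,\theta\in\mathbb{R}^n$, $\Omega=\{\omega_1,\dots,\omega_k\}$, $q\in\mathbb{R}^k$ with all $q_i>0$, and $\delta\in(0,1)$. Assume the instance is well-conditioned, i.e. $\theta$ lies in the relative interior of $\operatorname{conv}\Omega$. Then there is an interior-point algorithm (the one described in the context) that, given $\omega_1,\dots,\omega_k$, $q$, $\theta$, $\delta$ as input, returns a point $x_\delta\in\mathbb{R}^n$ such that $$F_\theta(x_\delta)\le F_\theta^*+\delta$$ within $$36\sqrt{k}\,\log\!\left(1440\,k^2\,\frac{R_\theta}{r_\theta}\,\frac1\delta\,\log^2(5k\beta)\right)=O\!\left(\sqrt{k}\,\log\!\left(k\,\frac{R_\theta}{r_\theta}\,\frac1\delta\,\log(k\beta)\right)\right)$$ iterations. The starting point of the algorithm is determined explicitly by the input, and every iteration is a Newton step for a known function.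
   Context: Notation. $\log$ is the natural logarithm. $F_\theta(x)=\log\sum_{i=1}^k q_i e^{\langle \omega_i-\theta,x\rangle}$ for $x\in\mathbb{R}^n$, and $F_\theta^*=\inf_{x\in\mathbb{R}^n}F_\theta(x)$. $\Omega$ is assumed to consist of at least two points (so that the quantities below are well-defined). - $r_\theta=\max\{r\ge 0: B(\theta,r)\cap\operatorname{aff}\Omega\subseteq\operatorname{conv}\Omega\}$ is the Euclidean distance from $\theta$ to the relative boundary of $\operatorname{conv}\Omega$ ($B$ = closed Euclidean ball, $\operatorname{aff}$ = affine hull). - $R_\theta=\max_{i\in[k]}\|\omega_i-\theta\|_2$. - $\beta=\|q\|_1/\min_{i\in[k]}q_i$. The algorithm (exact real arithmetic). Let $W=\operatorname{span}\{\omega_1-\theta,\dots,\omega_k-\theta\}$, let $E=W\times\mathbb{R}^k\times\mathbb{R}$ with its Euclidean inner product, and let $$D_\theta=\Bigl\{(x,z,t)\in E:\ \textstyle\sum_{i} z_i\le 1,\ q_ie^{\langle\omega_i-\theta,x\rangle}\le z_ie^t\ \forall i,\ t\le\log(5k\|q\|_1)\Bigr\}.$$ On the interior of $D_\theta$ use the barrier $$\Psi(x,z,t)=-\sum_i\log z_i-\sum_i\log\bigl(\log z_i-\langle\omega_i-\theta,x\rangle+t-\log q_i\bigr)-\log\bigl(\log(5k\|q\|_1)-t\bigr)-\log\bigl(1-\textstyle\sum_iz_i\bigr),$$ with gradient $g$, Hessian $H$, local norm $\|v\|_{(p)}=\sqrt{\langle v,H(p)v\rangle}$, and parameter $\nu=2k+2$.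 Let $c=(0;0;1)\in E$ and starting point $p_0'=(0;\frac1{2k},\dots,\frac1{2k};\log(4k\|q\|_1))$. Preliminary stage: set $\mu_0=1$, $g_0=g(p_0')$, $i=0$. While $\|H(p_i')^{-1}g(p_i')\|_{(p_i')}>\frac16$: increase $i$ by one, set $\mu_i=(1-\frac{1}{8\sqrt\nu})\mu_{i-1}$ and $p_i'=p_{i-1}'-H(p_{i-1}')^{-1}(-\mu_ig_0+g(p_{i-1}'))$. After the loop set $\eta_0=(12\|H(p_i')^{-1}c\|_{(p_i')})^{-1}$ and $p_0=p_i'-H(p_i')^{-1}(\eta_0c+g(p_i'))$. Main stage: let $T$ be the smallest non-negative integer with $T\ge10\sqrt\nu\log\bigl(\frac65\frac{\nu}{\eta_0\delta}\bigr)$. For $i=1,\dots,T$ set $\eta_i=(1+\frac1{8\sqrt\nu})\eta_{i-1}$ and $p_i=p_{i-1}-H(p_{i-1})^{-1}(\eta_ic+g(p_{i-1}))$. Output the $x$-component $x_\delta$ of $p_T=(x,z,t)$. The number of iterations is the total number of Newton steps (updates of $p'$ and $p$) performed in the two stages. *)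

theory Defs
  imports "HOL-Analysis.Analysis" "HOL-Library.Landau_Symbols"
begin

section \<open>Gradients, Hessians and Newton steps on a linear subspace\<close>

text \<open>The subspace \<open>E\<close> carries the inner product of the ambient Euclidean space. Derivatives are
  taken within \<open>E\<close>, so only the values of \<open>f\<close> on \<open>E\<close> near \<open>p\<close> matter; a gradient is required to
  lie in \<open>E\<close>, which makes it unique.\<close>

definition grad_on :: "'a::euclidean_space set \<Rightarrow> ('a \<Rightarrow> real) \<Rightarrow> 'a \<Rightarrow> 'a" where
  "grad_on E f p = (THE g. g \<in> E \<and> (f has_derivative (\<lambda>v. g \<bullet> v)) (at p within E))"

text \<open>The Hessian as a linear operator on \<open>E\<close>; its values at \<open>v \<notin> E\<close> are meaningless and are
  never used.\<close>

definition hess_on :: "'a::euclidean_space set \<Rightarrow> ('a \<Rightarrow> real) \<Rightarrow> 'a \<Rightarrow> 'a \<Rightarrow> 'a" where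
  "hess_on E f p = frechet_derivative (grad_on E f) (at p within E)"

definition hess_inv_on :: "'a::euclidean_space set \<Rightarrow> ('a \<Rightarrow> real) \<Rightarrow> 'a \<Rightarrow> 'a \<Rightarrow> 'a" where
  "hess_inv_on E f p = inv_into E (hess_on E f p)"

definition local_norm :: "'a::euclidean_space set \<Rightarrow> ('a \<Rightarrow> real) \<Rightarrow> 'a \<Rightarrow> 'a \<Rightarrow> real" where
  "local_norm E f p v = sqrt (v \<bullet> hess_on E f p v)"

text \<open>\<open>p'\<close> is obtained from \<open>p\<close> by a Newton step for \<open>f\<close> on \<open>E\<close>. The regularity clauses make sure
  that the gradient and Hessian above exist at \<open>p\<close> and that the Hessian is invertible on \<open>E\<close>.\<close>

definition newton_step :: "'a::euclidean_space set \<Rightarrow> ('a \<Rightarrow> real) \<Rightarrow> 'a \<Rightarrow> 'a \<Rightarrow> bool" where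
  "newton_step E f p p' \<longleftrightarrow>
     p \<in> E \<and>
     (\<forall>\<^sub>F y in nhds p. y \<in> E \<longrightarrow> f differentiable (at y within E)) \<and>
     grad_on E f differentiable (at p within E) \<and>
     bij_betw (hess_on E f p) E E \<and>
     p' = p - hess_inv_on E f p (grad_on E f p)"


section \<open>The optimisation problem and its condition measures\<close>

text \<open>Points are indexed by a finite type \<open>'k\<close>, so \<open>k = CARD('k)\<close> and repetitions among the
  \<open>\<omega> i\<close> are allowed; \<open>\<Omega> = range \<omega>\<close>.\<close>

definition one_norm :: "real ^ 'k::finite \<Rightarrow> real" where
  "one_norm q = (\<Sum>i\<in>UNIV. \<bar>q $ i\<bar>)"

definition lse :: "('k::finite \<Rightarrow> real ^ 'n) \<Rightarrow> real ^ 'k \<Rightarrow> real ^ 'n \<Rightarrow> real ^ 'n \<Rightarrow> real" where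
  "lse \<omega> q \<theta> x = ln (\<Sum>i\<in>UNIV. q $ i * exp ((\<omega> i - \<theta>) \<bullet> x))"

text \<open>The maximum is attained as soon as \<open>\<theta>\<close> lies in the convex hull of \<open>\<omega>\<close> and \<open>\<omega>\<close> takes at least
  two values.\<close>

definition inner_radius :: "('k::finite \<Rightarrow> real ^ 'n) \<Rightarrow> real ^ 'n \<Rightarrow> real" where
  "inner_radius \<omega> \<theta> =
     (GREATEST r. 0 \<le> r \<and> cball \<theta> r \<inter> affine hull (range \<omega>) \<subseteq> convex hull (range \<omega>))"

definition outer_radius :: "('k::finite \<Rightarrow> real ^ 'n) \<Rightarrow> real ^ 'n \<Rightarrow> real" where
  "outer_radius \<omega> \<theta> = (MAX i\<in>UNIV. norm (\<omega> i - \<theta>))"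

definition weight_ratio :: "real ^ 'k::finite \<Rightarrow> real" where
  "weight_ratio q = one_norm q / (MIN i\<in>UNIV. q $ i)"


section \<open>Domain and barrier\<close>

type_synonym ('n, 'k) ipm_pt = "(real ^ 'n) \<times> (real ^ 'k) \<times> real"

definition ipm_space ::
  "('k::finite \<Rightarrow> real ^ 'n) \<Rightarrow> real ^ 'n \<Rightarrow> ('n, 'k) ipm_pt set" where
  "ipm_space \<omega> \<theta> = span (range (\<lambda>i. \<omega> i - \<theta>)) \<times> UNIV \<times> UNIV"

definition ipm_domain ::
  "('k::finite \<Rightarrow> real ^ 'n) \<Rightarrow> real ^ 'k \<Rightarrow> real ^ 'n \<Rightarrow> ('n, 'k) ipm_pt set" where
  "ipm_domain \<omega> q \<theta> = {(x, z, t) \<in> ipm_space \<omega> \<theta>.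
     (\<Sum>i\<in>UNIV. z $ i) \<le> 1 \<and>
     (\<forall>i. q $ i * exp ((\<omega> i - \<theta>) \<bullet> x) \<le> z $ i * exp t) \<and>
     t \<le> ln (5 * real CARD('k) * one_norm q)}"

definition ipm_interior ::
  "('k::finite \<Rightarrow> real ^ 'n) \<Rightarrow> real ^ 'k \<Rightarrow> real ^ 'n \<Rightarrow> ('n, 'k) ipm_pt set" where
  "ipm_interior \<omega> q \<theta> = (top_of_set (ipm_space \<omega> \<theta>)) interior_of (ipm_domain \<omega> q \<theta>)"

text \<open>Only the values on \<open>ipm_interior\<close> are relevant; there all arguments of the logarithms are
  positive.\<close>

definition barrier ::
  "('k::finite \<Rightarrow> real ^ 'n) \<Rightarrow> real ^ 'k \<Rightarrow> real ^ 'n \<Rightarrow> ('n, 'k) ipm_pt \<Rightarrow> real" where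
  "barrier \<omega> q \<theta> = (\<lambda>(x, z, t).
     - (\<Sum>i\<in>UNIV. ln (z $ i))
     - (\<Sum>i\<in>UNIV. ln (ln (z $ i) - (\<omega> i - \<theta>) \<bullet> x + t - ln (q $ i)))
     - ln (ln (5 * real CARD('k) * one_norm q) - t)
     - ln (1 - (\<Sum>i\<in>UNIV. z $ i)))"

definition bgrad ::
  "('k::finite \<Rightarrow> real ^ 'n) \<Rightarrow> real ^ 'k \<Rightarrow> real ^ 'n \<Rightarrow>
   ('n, 'k) ipm_pt \<Rightarrow> ('n, 'k) ipm_pt" where
  "bgrad \<omega> q \<theta> = grad_on (ipm_space \<omega> \<theta>) (barrier \<omega> q \<theta>)"

definition bhess_inv ::
  "('k::finite \<Rightarrow> real ^ 'n) \<Rightarrow> real ^ 'k \<Rightarrow> real ^ 'n \<Rightarrow> ('n, 'k) ipm_pt \<Rightarrow>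
   ('n, 'k) ipm_pt \<Rightarrow> ('n, 'k) ipm_pt" where
  "bhess_inv \<omega> q \<theta> = hess_inv_on (ipm_space \<omega> \<theta>) (barrier \<omega> q \<theta>)"

definition bnorm ::
  "('k::finite \<Rightarrow> real ^ 'n) \<Rightarrow> real ^ 'k \<Rightarrow> real ^ 'n \<Rightarrow> ('n, 'k) ipm_pt \<Rightarrow>
   ('n, 'k) ipm_pt \<Rightarrow> real" where
  "bnorm \<omega> q \<theta> = local_norm (ipm_space \<omega> \<theta>) (barrier \<omega> q \<theta>)"

definition bparam :: "'k::finite itself \<Rightarrow> real" where
  "bparam _ = 2 * real CARD('k) + 2"

definition cvec :: "('n::finite, 'k::finite) ipm_pt" where
  "cvec = (0, 0, 1)"


section \<open>Preliminary stage\<close>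

definition start_pt :: "real ^ 'k::finite \<Rightarrow> ('n::finite, 'k) ipm_pt" where
  "start_pt q = (0, (\<chi> i. 1 / (2 * real CARD('k))), ln (4 * real CARD('k) * one_norm q))"

primrec prelim_mu :: "'k::finite itself \<Rightarrow> nat \<Rightarrow> real" where
  "prelim_mu k 0 = 1"
| "prelim_mu k (Suc i) = (1 - 1 / (8 * sqrt (bparam k))) * prelim_mu k i"

primrec prelim_pt ::
  "('k::finite \<Rightarrow> real ^ 'n) \<Rightarrow> real ^ 'k \<Rightarrow> real ^ 'n \<Rightarrow> nat \<Rightarrow>
   ('n, 'k) ipm_pt" where
  "prelim_pt \<omega> q \<theta> 0 = start_pt q"
| "prelim_pt \<omega> q \<theta> (Suc i) = prelim_pt \<omega> q \<theta> i -
     bhess_inv \<omega> q \<theta> (prelim_pt \<omega> q \<theta> i)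
       (- (prelim_mu TYPE('k) (Suc i) *\<^sub>R bgrad \<omega> q \<theta> (start_pt q))
        + bgrad \<omega> q \<theta> (prelim_pt \<omega> q \<theta> i))"

definition prelim_continue ::
  "('k::finite \<Rightarrow> real ^ 'n) \<Rightarrow> real ^ 'k \<Rightarrow> real ^ 'n \<Rightarrow> nat \<Rightarrow> bool" where
  "prelim_continue \<omega> q \<theta> i \<longleftrightarrow>
     (let p = prelim_pt \<omega> q \<theta> i
      in bnorm \<omega> q \<theta> p (bhess_inv \<omega> q \<theta> p (bgrad \<omega> q \<theta> p)) > 1 / 6)"

text \<open>The number of passes through the while loop, provided that the loop terminates, i.e. that
  its guard fails for some index.\<close>

definition prelim_steps :: "('k::finite \<Rightarrow> real ^ 'n) \<Rightarrow> real ^ 'k \<Rightarrow> real ^ 'n \<Rightarrow> nat" where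
  "prelim_steps \<omega> q \<theta> = (LEAST i. \<not> prelim_continue \<omega> q \<theta> i)"

definition prelim_final ::
  "('k::finite \<Rightarrow> real ^ 'n) \<Rightarrow> real ^ 'k \<Rightarrow> real ^ 'n \<Rightarrow> ('n, 'k) ipm_pt" where
  "prelim_final \<omega> q \<theta> = prelim_pt \<omega> q \<theta> (prelim_steps \<omega> q \<theta>)"


section \<open>Main stage\<close>

primrec main_eta ::
  "('k::finite \<Rightarrow> real ^ 'n) \<Rightarrow> real ^ 'k \<Rightarrow> real ^ 'n \<Rightarrow> nat \<Rightarrow> real" where
  "main_eta \<omega> q \<theta> 0 =
     inverse (12 * bnorm \<omega> q \<theta> (prelim_final \<omega> q \<theta>)
                     (bhess_inv \<omega> q \<theta> (prelim_final \<omega> q \<theta>) cvec))"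
| "main_eta \<omega> q \<theta> (Suc i) = (1 + 1 / (8 * sqrt (bparam TYPE('k)))) * main_eta \<omega> q \<theta> i"

primrec main_pt ::
  "('k::finite \<Rightarrow> real ^ 'n) \<Rightarrow> real ^ 'k \<Rightarrow> real ^ 'n \<Rightarrow> nat \<Rightarrow>
   ('n, 'k) ipm_pt" where
  "main_pt \<omega> q \<theta> 0 = prelim_final \<omega> q \<theta> -
     bhess_inv \<omega> q \<theta> (prelim_final \<omega> q \<theta>)
       (main_eta \<omega> q \<theta> 0 *\<^sub>R cvec + bgrad \<omega> q \<theta> (prelim_final \<omega> q \<theta>))"
| "main_pt \<omega> q \<theta> (Suc i) = main_pt \<omega> q \<theta> i -
     bhess_inv \<omega> q \<theta> (main_pt \<omega> q \<theta> i)
       (main_eta \<omega> q \<theta> (Suc i) *\<^sub>R cvec + bgrad \<omega> q \<theta> (main_pt \<omega> q \<theta> i))"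

definition main_steps ::
  "('k::finite \<Rightarrow> real ^ 'n) \<Rightarrow> real ^ 'k \<Rightarrow> real ^ 'n \<Rightarrow> real \<Rightarrow> nat" where
  "main_steps \<omega> q \<theta> \<delta> =
     (LEAST T::nat. real T \<ge> 10 * sqrt (bparam TYPE('k)) *
        ln (6 / 5 * (bparam TYPE('k) / (main_eta \<omega> q \<theta> 0 * \<delta>))))"

definition ipm_output ::
  "('k::finite \<Rightarrow> real ^ 'n) \<Rightarrow> real ^ 'k \<Rightarrow> real ^ 'n \<Rightarrow> real \<Rightarrow> real ^ 'n" where
  "ipm_output \<omega> q \<theta> \<delta> = fst (main_pt \<omega> q \<theta> (main_steps \<omega> q \<theta> \<delta>))"

text \<open>The summand \<open>1\<close> accounts for the Newton step from the last preliminary point to the first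
  point of the main stage.\<close>

definition ipm_iterations ::
  "('k::finite \<Rightarrow> real ^ 'n) \<Rightarrow> real ^ 'k \<Rightarrow> real ^ 'n \<Rightarrow> real \<Rightarrow> nat" where
  "ipm_iterations \<omega> q \<theta> \<delta> = prelim_steps \<omega> q \<theta> + 1 + main_steps \<omega> q \<theta> \<delta>"

text \<open>Well-definedness of a run: the while loop terminates, all iterates stay in the interior of the
  domain (where the barrier lives), and the division defining the first \<open>\<eta>\<close> is not by zero. That the
  Hessians are invertible along the run is part of the predicate below.\<close>

definition ipm_run_ok ::
  "('k::finite \<Rightarrow> real ^ 'n) \<Rightarrow> real ^ 'k \<Rightarrow> real ^ 'n \<Rightarrow> real \<Rightarrow> bool" where
  "ipm_run_ok \<omega> q \<theta> \<delta> \<longleftrightarrow>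
     (\<exists>i. \<not> prelim_continue \<omega> q \<theta> i) \<and>
     (\<forall>i \<le> prelim_steps \<omega> q \<theta>. prelim_pt \<omega> q \<theta> i \<in> ipm_interior \<omega> q \<theta>) \<and>
     bnorm \<omega> q \<theta> (prelim_final \<omega> q \<theta>) (bhess_inv \<omega> q \<theta> (prelim_final \<omega> q \<theta>) cvec) > 0 \<and>
     (\<forall>i \<le> main_steps \<omega> q \<theta> \<delta>. main_pt \<omega> q \<theta> i \<in> ipm_interior \<omega> q \<theta>)"

text \<open>Every iteration is a Newton step: for the barrier plus a linear term that moves the iterate
  along the path through the starting point (preliminary stage) or along the central path of the
  linear objective \<open>t\<close> (main stage).\<close>

definition ipm_newton_steps ::
  "('k::finite \<Rightarrow> real ^ 'n) \<Rightarrow> real ^ 'k \<Rightarrow> real ^ 'n \<Rightarrow> real \<Rightarrow> bool" where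
  "ipm_newton_steps \<omega> q \<theta> \<delta> \<longleftrightarrow>
     (\<forall>i < prelim_steps \<omega> q \<theta>.
        newton_step (ipm_space \<omega> \<theta>)
          (\<lambda>p. - (prelim_mu TYPE('k) (Suc i) * (bgrad \<omega> q \<theta> (start_pt q) \<bullet> p)) + barrier \<omega> q \<theta> p)
          (prelim_pt \<omega> q \<theta> i) (prelim_pt \<omega> q \<theta> (Suc i))) \<and>
     newton_step (ipm_space \<omega> \<theta>)
       (\<lambda>p. main_eta \<omega> q \<theta> 0 * (cvec \<bullet> p) + barrier \<omega> q \<theta> p)
       (prelim_final \<omega> q \<theta>) (main_pt \<omega> q \<theta> 0) \<and>
     (\<forall>i < main_steps \<omega> q \<theta> \<delta>.
        newton_step (ipm_space \<omega> \<theta>)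
          (\<lambda>p. main_eta \<omega> q \<theta> (Suc i) * (cvec \<bullet> p) + barrier \<omega> q \<theta> p)
          (main_pt \<omega> q \<theta> i) (main_pt \<omega> q \<theta> (Suc i)))"


section \<open>Parameter range for the asymptotic form of the bound\<close>

text \<open>Tuples \<open>(k, R / r, \<delta>, \<beta>)\<close> satisfying the inequalities that hold for every admissible instance.
  With the filter \<open>principal S\<close>, the Landau symbol means a bound with one constant on all of \<open>S\<close>;
  the constant does not depend on the dimension, on \<open>k\<close> or on the instance.\<close>

definition instance_params :: "(nat \<times> real \<times> real \<times> real) set" where
  "instance_params = {(k, \<rho>, \<delta>, \<beta>). 2 \<le> k \<and> 1 \<le> \<rho> \<and> 0 < \<delta> \<and> \<delta> < 1 \<and> real k \<le> \<beta>}"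

end

theory Submission
  imports Defs
begin

text \<open>
  The barrier is a sum of negative logarithms of affine functions and of blocks
  \<open>- ln z - ln (ln z - y)\<close>. Each block is self-concordant in the strong form
  \<open>\<bar>D\<^sup>3[u, v, v]\<bar> \<le> 2 \<parallel>u\<parallel> \<parallel>v\<parallel>\<^sup>2\<close>, hence so is the sum; along a segment the local norms change by at most
  \<open>1 / (1 - s \<parallel>u\<parallel>)\<close>, and a Newton step maps the decrement \<open>n\<close> to at most \<open>(n / (1 - n))\<^sup>2\<close>. Both stages are
  the same path following: rescaling the linear term by \<open>1 \<plusminus> 1 / (8 \<surd>\<nu>)\<close> raises a decrement of at most 1/9
  to at most 1/4, and the Newton step brings it back to 1/9.

  The preliminary stage stops once \<open>\<mu>\<close> times the dual norm of the initial gradient is at most 1/18. Dual norms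
  are bounded by widths of the domain; the support function of \<open>conv \<Omega> - \<theta>\<close> being at least \<open>r \<parallel>x\<parallel>\<close> on \<open>W\<close>,
  the width in the direction of that gradient is at most of order \<open>k\<^sup>2 R / r log (5 k \<beta>)\<^sup>2\<close>, and the width in the direction
  of the objective is at most \<open>log (5 k \<beta>)\<close>. At the end the objective gap is at most \<open>6/5 \<nu> / \<eta>\<close>.
\<close>

section \<open>Calculus on a subspace\<close>

text \<open>On the ambient space the barrier is degenerate: it is constant along every
  \<open>x\<close> orthogonal to all \<open>\<omega> i - \<theta>\<close>. Derivatives are therefore
  computed as explicit multilinear forms on the ambient space and tested only against vectors of
  \<open>E\<close>, where the second one is an inner product. Gradient, inverse Hessian and local
  norm enter solely through their pairings with \<open>E\<close>. The cap on \<open>t\<close> makes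
  the domain bounded: it bounds every \<open>(\<omega> i - \<theta>) \<bullet> x\<close> from above,
  and the relative interior condition turns this into a bound on the norm of \<open>x\<close>. The
  resulting finite widths replace any estimate at a minimiser or at the analytic centre; neither
  point occurs. The preliminary path starts without error, since the starting point is stationary
  for the barrier minus the linear term given by its own gradient there. The factor 36 comes from
  the rates 1/8 and 1/10 of the two stages: 8 + 10 = 18 multiples of \<open>sqrt \<nu>\<close>, with
  \<open>sqrt \<nu> \<le> 7/4 * sqrt k\<close>, leave room for roundings and the intermediate
  step.\<close>

lemma subspace_orthonormal_expansion:
  fixes E :: "'a::euclidean_space set"
  assumes "subspace E"
  obtains B where "finite B" "B \<subseteq> E" "\<forall>x\<in>E. x = (\<Sum>b\<in>B. (x \<bullet> b) *\<^sub>R b)"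
proof -
  obtain B where B: "B \<subseteq> E" "pairwise orthogonal B" "\<And>x. x \<in> B \<Longrightarrow> norm x = 1"
    "independent B" "span B = E"
    using orthonormal_basis_subspace[OF assms] by metis
  have fin: "finite B" using B(4) independent_imp_finite by blast
  have "x = (\<Sum>b\<in>B. (x \<bullet> b) *\<^sub>R b)" if x: "x \<in> E" for x
  proof -
    let ?y = "x - (\<Sum>b\<in>B. (x \<bullet> b) *\<^sub>R b)"
    have orth: "?y \<bullet> c = 0" if c: "c \<in> B" for c
    proof -
      have "(\<Sum>b\<in>B. (x \<bullet> b) *\<^sub>R b) \<bullet> c = (\<Sum>b\<in>B. (x \<bullet> b) * (b \<bullet> c))"
        by (simp add: inner_sum_left)
      also have "\<dots> = (\<Sum>b\<in>B. if b = c then x \<bullet> c else 0)"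
      proof (rule sum.cong[OF refl])
        fix b assume b: "b \<in> B"
        show "(x \<bullet> b) * (b \<bullet> c) = (if b = c then x \<bullet> c else 0)"
          using B(2,3) b c by (auto simp: pairwise_def orthogonal_def dot_square_norm)
      qed
      also have "\<dots> = x \<bullet> c" using fin c by simp
      finally show ?thesis by (simp add: inner_diff_left)
    qed
    have yE: "?y \<in> E"
      using assms x B(1) by (intro subspace_diff subspace_sum subspace_scale) auto
    have "orthogonal ?y ?y"
      using orthogonal_to_span[of ?y B ?y] orth yE B(5) by (simp add: orthogonal_def)
    then show ?thesis by (simp add: orthogonal_self)
  qed
  with that fin B(1) show ?thesis by blast
qed

text \<open>A proper subspace has empty interior, so a derivative within \<open>E\<close> is
  determined only on \<open>E\<close>. Restriction to the line through \<open>p\<close> in direction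
  \<open>v\<close> reduces this to one real variable.\<close>

lemma has_derivative_within_subspace_unique:
  fixes f :: "'a::euclidean_space \<Rightarrow> 'b::real_normed_vector"
  assumes E: "subspace E" "p \<in> E" "v \<in> E"
    and D: "(f has_derivative D) (at p within E)" "(f has_derivative D') (at p within E)"
  shows "D v = D' v"
proof -
  have line: "((\<lambda>t::real. p + t *\<^sub>R v) has_derivative (\<lambda>t. t *\<^sub>R v)) (at 0)"
    by (auto intro!: derivative_eq_intros)
  have sub: "range (\<lambda>t::real. p + t *\<^sub>R v) \<subseteq> E"
    using E by (auto intro: subspace_add subspace_scale)
  have *: "((\<lambda>t::real. f (p + t *\<^sub>R v)) has_derivative (\<lambda>t. A (t *\<^sub>R v))) (at 0)"
    if "(f has_derivative A) (at p within E)" for A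
  proof (rule has_derivative_in_compose[OF line])
    show "(f has_derivative A) (at (p + 0 *\<^sub>R v) within range (\<lambda>t::real. p + t *\<^sub>R v))"
      using has_derivative_subset[OF that sub] by simp
  qed
  have "(\<lambda>t::real. D (t *\<^sub>R v)) = (\<lambda>t. D' (t *\<^sub>R v))"
    using has_derivative_unique[OF *[OF D(1)] *[OF D(2)]] .
  from fun_cong[OF this, of 1] show ?thesis by simp
qed

text \<open>Difference quotients within \<open>E\<close> see only increments in \<open>E\<close>.
  This lets an ambient derivative be replaced by the inner product with a representative in
  \<open>E\<close>, as \<open>grad_on\<close> demands.\<close>

lemma has_derivative_within_subspace_cong:
  fixes f :: "'a::euclidean_space \<Rightarrow> 'b::real_normed_vector"
  assumes E: "subspace E" "p \<in> E"
    and D: "(f has_derivative D) (at p within E)"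
    and D': "bounded_linear D'" "\<And>v. v \<in> E \<Longrightarrow> D' v = D v"
  shows "(f has_derivative D') (at p within E)"
proof -
  have "((\<lambda>y. (1 / norm (y - p)) *\<^sub>R (f y - (f p + D (y - p)))) \<longlongrightarrow> 0) (at p within E)"
    using D by (simp add: has_derivative_within)
  moreover have "\<forall>\<^sub>F y in at p within E. (1 / norm (y - p)) *\<^sub>R (f y - (f p + D (y - p)))
      = (1 / norm (y - p)) *\<^sub>R (f y - (f p + D' (y - p)))"
    unfolding eventually_at_filter
  proof (intro always_eventually allI impI)
    fix y assume "y \<in> E"
    then have "D' (y - p) = D (y - p)" using D'(2) subspace_diff[OF E(1)] E(2) by blast
    then show "(1 / norm (y - p)) *\<^sub>R (f y - (f p + D (y - p)))
      = (1 / norm (y - p)) *\<^sub>R (f y - (f p + D' (y - p)))" by simp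
  qed
  ultimately have "((\<lambda>y. (1 / norm (y - p)) *\<^sub>R (f y - (f p + D' (y - p)))) \<longlongrightarrow> 0) (at p within E)"
    by (rule Lim_transform_eventually)
  with D'(1) show ?thesis by (simp add: has_derivative_within)
qed

lemma grad_on_unique:
  fixes f :: "'a::euclidean_space \<Rightarrow> real"
  assumes E: "subspace E" "p \<in> E" "g \<in> E" and D: "(f has_derivative D) (at p within E)"
    and g: "\<And>v. v \<in> E \<Longrightarrow> g \<bullet> v = D v"
  shows "grad_on E f p = g"
  unfolding grad_on_def
proof (rule the_equality)
  show "g \<in> E \<and> (f has_derivative (\<lambda>v. g \<bullet> v)) (at p within E)"
    using has_derivative_within_subspace_cong[OF E(1,2) D bounded_linear_inner_right g] E(3) by simp
  fix h assume h: "h \<in> E \<and> (f has_derivative (\<lambda>v. h \<bullet> v)) (at p within E)"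
  have "h \<bullet> (h - g) = D (h - g)"
    using has_derivative_within_subspace_unique[OF E(1,2) _ conjunct2[OF h] D]
      subspace_diff[OF E(1) conjunct1[OF h] E(3)] by blast
  also have "\<dots> = g \<bullet> (h - g)" using g subspace_diff[OF E(1) conjunct1[OF h] E(3)] by simp
  finally have "(h - g) \<bullet> (h - g) = 0" by (simp add: inner_diff_left)
  then show "h = g" by simp
qed

lemma functional_on_subspace:
  fixes B :: "'a::euclidean_space set" and D :: "'a \<Rightarrow> real"
  assumes "finite B" "linear D" "v = (\<Sum>b\<in>B. (v \<bullet> b) *\<^sub>R b)"
  shows "(\<Sum>b\<in>B. D b *\<^sub>R b) \<bullet> v = D v"
proof -
  have "D v = D (\<Sum>b\<in>B. (v \<bullet> b) *\<^sub>R b)" using assms(3) by simp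
  also have "\<dots> = (\<Sum>b\<in>B. (v \<bullet> b) * D b)"
    using assms(2) by (simp add: linear_sum linear_cmul)
  also have "\<dots> = (\<Sum>b\<in>B. D b *\<^sub>R b) \<bullet> v"
    by (simp add: inner_sum_left inner_commute[of v] mult.commute)
  finally show ?thesis by simp
qed

text \<open>The derivatives are ambient ones on an open set, given as forms \<open>D1\<close> and
  \<open>D2\<close>, while gradient and Hessian live on \<open>E\<close>. Definiteness is asked on
  \<open>E\<close> alone, because the ambient Hessian may be singular.\<close>

locale twice_differentiable =
  fixes E S :: "'a::euclidean_space set" and f :: "'a \<Rightarrow> real"
    and D1 :: "'a \<Rightarrow> 'a \<Rightarrow> real" and D2 :: "'a \<Rightarrow> 'a \<Rightarrow> 'a \<Rightarrow> real"
  assumes subE: "subspace E" and openS: "open S"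
    and D1: "p \<in> S \<Longrightarrow> (f has_derivative D1 p) (at p)"
    and D2: "p \<in> S \<Longrightarrow> ((\<lambda>y. D1 y v) has_derivative (\<lambda>u. D2 p u v)) (at p)"
    and D2_sym: "p \<in> S \<Longrightarrow> D2 p u v = D2 p v u"
    and D2_pos: "p \<in> S \<Longrightarrow> v \<in> E \<Longrightarrow> v \<noteq> 0 \<Longrightarrow> 0 < D2 p v v"
begin

lemma linear_D1: "p \<in> S \<Longrightarrow> linear (D1 p)"
  using D1 has_derivative_linear by blast

lemma linear_D2_left: "p \<in> S \<Longrightarrow> linear (\<lambda>u. D2 p u v)"
  using D2 has_derivative_linear by blast

lemma linear_D2_right:
  assumes "p \<in> S"
  shows "linear (D2 p u)"
proof -
  have "D2 p u = (\<lambda>v. D2 p v u)" by (rule ext) (rule D2_sym[OF assms])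
  from ssubst[OF this, of linear, OF linear_D2_left[OF assms]] show ?thesis .
qed

lemma grad_on_expansion:
  assumes p: "p \<in> S" "p \<in> E"
    and B: "finite B" "B \<subseteq> E" "\<forall>x\<in>E. x = (\<Sum>b\<in>B. (x \<bullet> b) *\<^sub>R b)"
  shows "grad_on E f p = (\<Sum>b\<in>B. D1 p b *\<^sub>R b)"
proof (rule grad_on_unique[OF subE p(2) _ has_derivative_at_withinI[OF D1[OF p(1)]]])
  show "(\<Sum>b\<in>B. D1 p b *\<^sub>R b) \<in> E"
    using B(2) subE by (intro subspace_sum subspace_scale) auto
  show "(\<Sum>b\<in>B. D1 p b *\<^sub>R b) \<bullet> v = D1 p v" if "v \<in> E" for v
    using functional_on_subspace[OF B(1) linear_D1[OF p(1)] bspec[OF B(3) that]] .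
qed

lemma grad_on_inner:
  assumes p: "p \<in> S" "p \<in> E"
  shows "grad_on E f p \<in> E" and "v \<in> E \<Longrightarrow> grad_on E f p \<bullet> v = D1 p v"
proof -
  obtain B where B: "finite B" "B \<subseteq> E" "\<forall>x\<in>E. x = (\<Sum>b\<in>B. (x \<bullet> b) *\<^sub>R b)"
    using subspace_orthonormal_expansion[OF subE] by blast
  show "grad_on E f p \<in> E"
    unfolding grad_on_expansion[OF p B]
    using B(2) subE by (intro subspace_sum subspace_scale) auto
  show "grad_on E f p \<bullet> v = D1 p v" if "v \<in> E"
    unfolding grad_on_expansion[OF p B]
    using functional_on_subspace[OF B(1) linear_D1[OF p(1)] bspec[OF B(3) that]] .
qed

text \<open>The expansion of the gradient has scalar coefficients \<open>D1 y b\<close>, which are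
  differentiated termwise; openness of \<open>S\<close> makes the expansion valid at all points of
  \<open>E\<close> near \<open>p\<close>.\<close>

lemma grad_on_has_derivative:
  assumes p: "p \<in> S" "p \<in> E"
    and B: "finite B" "B \<subseteq> E" "\<forall>x\<in>E. x = (\<Sum>b\<in>B. (x \<bullet> b) *\<^sub>R b)"
  shows "(grad_on E f has_derivative (\<lambda>u. \<Sum>b\<in>B. D2 p u b *\<^sub>R b)) (at p within E)"
proof -
  obtain d where d: "0 < d" "ball p d \<subseteq> S" using openS p(1) open_contains_ball by blast
  have "((\<lambda>y. \<Sum>b\<in>B. D1 y b *\<^sub>R b) has_derivative (\<lambda>u. \<Sum>b\<in>B. D2 p u b *\<^sub>R b)) (at p within E)"
    by (rule has_derivative_sum) (rule has_derivative_scaleR_left[OF has_derivative_at_withinI[OF D2[OF p(1)]]])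
  then show ?thesis
  proof (rule has_derivative_transform_within[OF _ d(1) p(2)])
    fix y assume "y \<in> E" "dist y p < d"
    then show "(\<Sum>b\<in>B. D1 y b *\<^sub>R b) = grad_on E f y"
      using grad_on_expansion[OF _ _ B, of y] d(2) by (auto simp: dist_commute)
  qed
qed

lemma grad_on_differentiable:
  assumes p: "p \<in> S" "p \<in> E"
  shows "grad_on E f differentiable (at p within E)"
proof -
  obtain B where B: "finite B" "B \<subseteq> E" "\<forall>x\<in>E. x = (\<Sum>b\<in>B. (x \<bullet> b) *\<^sub>R b)"
    using subspace_orthonormal_expansion[OF subE] by blast
  show ?thesis by (rule differentiableI[OF grad_on_has_derivative[OF p B]])
qed

lemma hess_on_has_derivative:
  assumes p: "p \<in> S" "p \<in> E"
  shows "(grad_on E f has_derivative hess_on E f p) (at p within E)"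
  unfolding hess_on_def
  by (rule iffD1[OF frechet_derivative_works grad_on_differentiable[OF p]])

lemma hess_on_inner:
  assumes p: "p \<in> S" "p \<in> E" and u: "u \<in> E"
  shows "hess_on E f p u \<in> E" and "v \<in> E \<Longrightarrow> hess_on E f p u \<bullet> v = D2 p u v"
proof -
  obtain B where B: "finite B" "B \<subseteq> E" "\<forall>x\<in>E. x = (\<Sum>b\<in>B. (x \<bullet> b) *\<^sub>R b)"
    using subspace_orthonormal_expansion[OF subE] by blast
  note der = grad_on_has_derivative[OF p B]
  note fd = hess_on_has_derivative[OF p]
  have eq: "hess_on E f p u = (\<Sum>b\<in>B. D2 p u b *\<^sub>R b)"
    by (rule has_derivative_within_subspace_unique[OF subE p(2) u fd der])
  show "hess_on E f p u \<in> E"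
    unfolding eq using B(2) subE by (intro subspace_sum subspace_scale) auto
  show "v \<in> E \<Longrightarrow> hess_on E f p u \<bullet> v = D2 p u v"
    unfolding eq using functional_on_subspace[OF B(1) linear_D2_right[OF p(1)]] B(3) by blast
qed

text \<open>Definiteness of \<open>D2 p\<close> on \<open>E\<close> excludes a kernel; surjectivity
  follows by comparing dimensions.\<close>

lemma hess_on_bij:
  assumes p: "p \<in> S" "p \<in> E"
  shows "bij_betw (hess_on E f p) E E"
proof -
  have lin: "linear (hess_on E f p)"
    by (rule has_derivative_linear[OF hess_on_has_derivative[OF p]])
  have inj: "inj_on (hess_on E f p) E"
  proof (rule inj_onI)
    fix u v assume uv: "u \<in> E" "v \<in> E" "hess_on E f p u = hess_on E f p v"
    have w: "u - v \<in> E" using uv subE subspace_diff by blast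
    have "hess_on E f p (u - v) = 0" using uv lin by (simp add: linear_diff)
    then have "D2 p (u - v) (u - v) = 0"
      using hess_on_inner(2)[OF p w w] by simp
    then show "u = v" using D2_pos[OF p(1) w] by force
  qed
  have sub: "hess_on E f p ` E \<subseteq> E" using hess_on_inner(1)[OF p] by blast
  have "span E = E" using subE span_eq_iff by blast
  then have "dim (hess_on E f p ` E) = dim E"
    using dim_image_eq[OF lin, of E] inj by (simp only:)
  then have "hess_on E f p ` E = E"
    using subspace_dim_equal[OF linear_subspace_image[OF lin subE] subE sub] by simp
  with inj show ?thesis by (simp add: bij_betw_def)
qed

lemma hess_inv_on_inner:
  assumes p: "p \<in> S" "p \<in> E" and w: "w \<in> E"
  shows "hess_inv_on E f p w \<in> E" and "v \<in> E \<Longrightarrow> D2 p (hess_inv_on E f p w) v = w \<bullet> v"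
proof -
  note bij = hess_on_bij[OF p]
  show m: "hess_inv_on E f p w \<in> E"
    unfolding hess_inv_on_def by (metis bij bij_betw_def inv_into_into w)
  have "hess_on E f p (hess_inv_on E f p w) = w"
    unfolding hess_inv_on_def by (metis bij bij_betw_inv_into_right w)
  then show "v \<in> E \<Longrightarrow> D2 p (hess_inv_on E f p w) v = w \<bullet> v"
    using hess_on_inner(2)[OF p m] by metis
qed

lemma hess_inv_on_unique:
  assumes p: "p \<in> S" "p \<in> E" and w: "w \<in> E" and u: "u \<in> E" "\<And>v. v \<in> E \<Longrightarrow> D2 p u v = w \<bullet> v"
  shows "hess_inv_on E f p w = u"
proof (rule ccontr)
  let ?d = "hess_inv_on E f p w - u"
  assume "hess_inv_on E f p w \<noteq> u"
  then have "?d \<noteq> 0" by simp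
  moreover have d: "?d \<in> E" using subE hess_inv_on_inner(1)[OF p w] u(1) subspace_diff by blast
  ultimately have "0 < D2 p ?d ?d" using D2_pos p by blast
  moreover have "D2 p ?d ?d = D2 p (hess_inv_on E f p w) ?d - D2 p u ?d"
    by (rule linear_diff[OF linear_D2_left[OF p(1)]])
  ultimately show False using hess_inv_on_inner(2)[OF p w d] u(2)[OF d] by simp
qed

lemma local_norm_eq:
  assumes "p \<in> S" "p \<in> E" "v \<in> E"
  shows "local_norm E f p v = sqrt (D2 p v v)"
  using hess_on_inner(2)[OF assms assms(3)] by (simp add: local_norm_def inner_commute)

lemma newton_step:
  assumes p: "p \<in> S" "p \<in> E"
  shows "newton_step E f p (p - hess_inv_on E f p (grad_on E f p))"
  unfolding newton_step_def
proof (intro conjI p hess_on_bij grad_on_differentiable refl)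
  have d: "f differentiable (at y within E)" if "y \<in> S" for y
    by (rule differentiableI[OF has_derivative_at_withinI[OF D1[OF that]]])
  show "\<forall>\<^sub>F y in nhds p. y \<in> E \<longrightarrow> f differentiable (at y within E)"
    by (rule eventually_mono[OF eventually_nhds_in_open[OF openS p(1)]]) (use d in blast)
qed

lemma add_linear: "twice_differentiable E S (\<lambda>p. w \<bullet> p + f p) (\<lambda>p v. w \<bullet> v + D1 p v) D2"
proof (rule twice_differentiable.intro)
  fix p v assume p: "p \<in> S"
  show "((\<lambda>p. w \<bullet> p + f p) has_derivative (\<lambda>v. w \<bullet> v + D1 p v)) (at p)"
    by (rule has_derivative_add[OF has_derivative_inner_right[OF has_derivative_ident] D1[OF p]])
  have "((\<lambda>y. w \<bullet> v + D1 y v) has_derivative (\<lambda>u. 0 + D2 p u v)) (at p)"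
    by (rule has_derivative_add[OF has_derivative_const D2[OF p]])
  then show "((\<lambda>y. w \<bullet> v + D1 y v) has_derivative (\<lambda>u. D2 p u v)) (at p)" by simp
next
  show "subspace E" by (rule subE)
  show "open S" by (rule openS)
  show "D2 p u v = D2 p v u" if "p \<in> S" for p u v by (rule D2_sym[OF that])
  show "0 < D2 p v v" if "p \<in> S" "v \<in> E" "v \<noteq> 0" for p v by (rule D2_pos[OF that])
qed

text \<open>A linear term shifts the gradient by \<open>w\<close> and leaves \<open>D2\<close>
  unchanged, so the inverse Hessian of \<open>f\<close> also serves the perturbed function. This
  matches the update formulas of both stages with Newton steps.\<close>

lemma newton_step_add_linear:
  assumes p: "p \<in> S" "p \<in> E" and w: "w \<in> E"
  shows "newton_step E (\<lambda>p. w \<bullet> p + f p) p (p - hess_inv_on E f p (w + grad_on E f p))"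
proof -
  interpret l: twice_differentiable E S "\<lambda>p. w \<bullet> p + f p" "\<lambda>p v. w \<bullet> v + D1 p v" D2
    by (rule add_linear)
  have mem: "w + grad_on E f p \<in> E" using subE w grad_on_inner(1)[OF p] subspace_add by blast
  have g: "grad_on E (\<lambda>p. w \<bullet> p + f p) p = w + grad_on E f p"
    using grad_on_unique[OF subE p(2) mem has_derivative_at_withinI[OF l.D1[OF p(1)]]]
      grad_on_inner(2)[OF p] by (simp add: inner_add_left)
  have "hess_inv_on E (\<lambda>p. w \<bullet> p + f p) p (w + grad_on E f p) = hess_inv_on E f p (w + grad_on E f p)"
    using l.hess_inv_on_unique[OF p mem hess_inv_on_inner[OF p mem]] .
  then show ?thesis using l.newton_step[OF p] g by simp
qed

end

section \<open>Self-concordant barriers and Newton steps\<close>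

text \<open>The differential inequality says that \<open>1 / sqrt h\<close> has slope at least -1,
  so \<open>inverse (sqrt (h x)) + x\<close> is nondecreasing.\<close>

lemma inverse_sqrt_growth:
  fixes h h' :: "real \<Rightarrow> real"
  assumes r: "0 < r" "r < 1" "h 0 = r\<^sup>2" and s: "0 \<le> s" "s \<le> 1"
    and h: "\<And>x. 0 \<le> x \<Longrightarrow> x \<le> 1 \<Longrightarrow> 0 < h x"
    and d: "\<And>x. 0 \<le> x \<Longrightarrow> x \<le> 1 \<Longrightarrow> (h has_real_derivative h' x) (at x)"
    and b: "\<And>x. 0 \<le> x \<Longrightarrow> x \<le> 1 \<Longrightarrow> \<bar>h' x\<bar> \<le> 2 * sqrt (h x) * h x"
  shows "sqrt (h s) \<le> r / (1 - r * s)"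
proof -
  let ?k = "\<lambda>x. inverse (sqrt (h x)) + x"
  have "?k 0 \<le> ?k s"
  proof (rule DERIV_nonneg_imp_nondecreasing[OF s(1)])
    fix x assume x: "0 \<le> x" "x \<le> s"
    then have x1: "x \<le> 1" using s by simp
    note hx = h[OF x(1) x1] and dx = d[OF x(1) x1] and bx = b[OF x(1) x1]
    have D: "(?k has_real_derivative (1 - h' x / (2 * sqrt (h x) * h x))) (at x)"
      using hx by (auto intro!: derivative_eq_intros dx simp: field_simps power2_eq_square)
    have "h' x / (2 * sqrt (h x) * h x) \<le> 1" using bx hx by (simp add: divide_le_eq)
    then show "\<exists>y. (?k has_real_derivative y) (at x) \<and> 0 \<le> y" using D by force
  qed
  then have *: "(1 - r * s) / r \<le> inverse (sqrt (h s))"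
    using r by (simp add: field_simps)
  have rs: "0 < 1 - r * s" using r s mult_le_one[of r s] by (smt (verit) mult_left_le)
  have "sqrt (h s) > 0" using h[OF s] by simp
  then have "sqrt (h s) * (1 - r * s) \<le> r" using * r by (simp add: field_simps)
  then show ?thesis using rs by (simp add: field_simps)
qed

text \<open>\<open>2 * (r / (1 - r * x))\<close> is the logarithmic derivative of
  \<open>1 / (1 - r * x)\<^sup>2\<close>. Multiplying or dividing \<open>g\<close> by
  \<open>(1 - r * x)\<^sup>2\<close> therefore gives monotone functions.\<close>

lemma quadratic_form_growth:
  fixes g g' :: "real \<Rightarrow> real"
  assumes r: "0 \<le> r" "r < 1" and s: "0 \<le> s" "s \<le> 1"
    and d: "\<And>x. 0 \<le> x \<Longrightarrow> x \<le> 1 \<Longrightarrow> (g has_real_derivative g' x) (at x)"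
    and b: "\<And>x. 0 \<le> x \<Longrightarrow> x \<le> 1 \<Longrightarrow> \<bar>g' x\<bar> \<le> 2 * (r / (1 - r * x)) * g x"
  shows "(1 - r * s)\<^sup>2 * g s \<le> g 0" and "(1 - r * s)\<^sup>2 * g 0 \<le> g s"
proof -
  have pos: "0 < 1 - r * x" if "0 \<le> x" "x \<le> 1" for x
    using r that mult_left_le[of x r] by simp
  have "(\<lambda>x. - ((1 - r * x)\<^sup>2 * g x)) 0 \<le> (\<lambda>x. - ((1 - r * x)\<^sup>2 * g x)) s"
  proof (rule DERIV_nonneg_imp_nondecreasing[OF s(1)])
    fix x assume x: "0 \<le> x" "x \<le> s"
    then have x1: "x \<le> 1" using s by simp
    let ?q = "1 - r * x"
    have D: "((\<lambda>x. - ((1 - r * x)\<^sup>2 * g x)) has_real_derivative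
        - (?q\<^sup>2 * g' x - 2 * r * ?q * g x)) (at x)"
      by (auto intro!: derivative_eq_intros d[OF x(1) x1] simp: algebra_simps power2_eq_square)
    have "?q\<^sup>2 * g' x \<le> ?q\<^sup>2 * (2 * (r / ?q) * g x)"
      using b[OF x(1) x1] by (intro mult_left_mono) auto
    also have "\<dots> = 2 * r * ?q * g x" using pos[OF x(1) x1] by (simp add: power2_eq_square)
    finally show "\<exists>y. ((\<lambda>x. - ((1 - r * x)\<^sup>2 * g x)) has_real_derivative y) (at x) \<and> 0 \<le> y"
      using D by (intro exI[of _ "- (?q\<^sup>2 * g' x - 2 * r * ?q * g x)"]) simp
  qed
  then show "(1 - r * s)\<^sup>2 * g s \<le> g 0" by simp
  have "(\<lambda>x. g x / (1 - r * x)\<^sup>2) 0 \<le> (\<lambda>x. g x / (1 - r * x)\<^sup>2) s"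
  proof (rule DERIV_nonneg_imp_nondecreasing[OF s(1)])
    fix x assume x: "0 \<le> x" "x \<le> s"
    then have x1: "x \<le> 1" using s by simp
    let ?q = "1 - r * x"
    note q = pos[OF x(1) x1]
    have D: "((\<lambda>x. g x / (1 - r * x)\<^sup>2) has_real_derivative
        (g' x + 2 * (r / ?q) * g x) / ?q\<^sup>2) (at x)"
    proof (rule DERIV_cong)
      show "((\<lambda>x. g x / (1 - r * x)\<^sup>2) has_real_derivative
          (g' x * ?q\<^sup>2 - g x * (2 * ?q * - r)) / (?q\<^sup>2 * ?q\<^sup>2)) (at x)"
        using q by (auto intro!: derivative_eq_intros d[OF x(1) x1])
      have "(a * Q\<^sup>2 - b * (2 * Q * - r)) / (Q\<^sup>2 * Q\<^sup>2) = (a + 2 * (r / Q) * b) / Q\<^sup>2"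
        if "Q \<noteq> 0" for a b Q :: real
        using that by (simp add: field_simps power2_eq_square)
      from this[of ?q "g' x" "g x"] q
      show "(g' x * ?q\<^sup>2 - g x * (2 * ?q * - r)) / (?q\<^sup>2 * ?q\<^sup>2)
          = (g' x + 2 * (r / ?q) * g x) / ?q\<^sup>2" by linarith
    qed
    have "0 \<le> g' x + 2 * (r / ?q) * g x" using b[OF x(1) x1] by linarith
    then show "\<exists>y. ((\<lambda>x. g x / (1 - r * x)\<^sup>2) has_real_derivative y) (at x) \<and> 0 \<le> y"
      using D by (intro exI[of _ "(g' x + 2 * (r / ?q) * g x) / ?q\<^sup>2"]) simp
  qed
  then show "(1 - r * s)\<^sup>2 * g 0 \<le> g s" using pos[OF s] by (simp add: pos_le_divide_eq mult.commute)
qed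

text \<open>Two integrations, each by comparison: \<open>r / (1 - r * x)\<^sup>2\<close> is an
  antiderivative of the majorant, and \<open>1 / (1 - r * x)\<close> is one of that. In the
  application \<open>C\<close> is the local norm of a test vector.\<close>

lemma newton_remainder:
  fixes \<phi> \<phi>1 \<phi>2 :: "real \<Rightarrow> real"
  assumes r: "0 \<le> r" "r < 1" and z: "\<phi> 0 = 0" "\<phi>1 0 = 0"
    and d1: "\<And>x. 0 \<le> x \<Longrightarrow> x \<le> 1 \<Longrightarrow> (\<phi> has_real_derivative \<phi>1 x) (at x)"
    and d2: "\<And>x. 0 \<le> x \<Longrightarrow> x \<le> 1 \<Longrightarrow> (\<phi>1 has_real_derivative \<phi>2 x) (at x)"
    and b: "\<And>x. 0 \<le> x \<Longrightarrow> x \<le> 1 \<Longrightarrow> \<phi>2 x \<le> C * (2 * r\<^sup>2 / (1 - r * x) ^ 3)"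
  shows "\<phi> 1 \<le> C * (r\<^sup>2 / (1 - r))"
proof -
  have pos: "0 < 1 - r * x" if "0 \<le> x" "x \<le> 1" for x
    using r that mult_left_le[of x r] by simp
  have \<phi>1: "\<phi>1 s \<le> C * (r / (1 - r * s)\<^sup>2 - r)" if s: "0 \<le> s" "s \<le> 1" for s
  proof -
    have "(\<lambda>x. C * (r / (1 - r * x)\<^sup>2) - \<phi>1 x) 0 \<le> (\<lambda>x. C * (r / (1 - r * x)\<^sup>2) - \<phi>1 x) s"
    proof (rule DERIV_nonneg_imp_nondecreasing[OF s(1)])
      fix x assume x: "0 \<le> x" "x \<le> s"
      then have x1: "x \<le> 1" using s by simp
      have "((\<lambda>x. C * (r / (1 - r * x)\<^sup>2) - \<phi>1 x) has_real_derivative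
          C * (2 * r\<^sup>2 / (1 - r * x) ^ 3) - \<phi>2 x) (at x)"
      proof (rule DERIV_cong)
        let ?q = "1 - r * x"
        show "((\<lambda>x. C * (r / (1 - r * x)\<^sup>2) - \<phi>1 x) has_real_derivative
            C * ((0 * ?q\<^sup>2 - r * (2 * ?q * - r)) / (?q\<^sup>2 * ?q\<^sup>2)) - \<phi>2 x) (at x)"
          using pos[OF x(1) x1] by (auto intro!: derivative_eq_intros d2[OF x(1) x1])
        have "(0 * Q\<^sup>2 - r * (2 * Q * - r)) / (Q\<^sup>2 * Q\<^sup>2) = 2 * r\<^sup>2 / Q ^ 3"
          if "Q \<noteq> 0" for Q :: real
          using that by (simp add: field_simps power2_eq_square power3_eq_cube)
        then have "(0 * ?q\<^sup>2 - r * (2 * ?q * - r)) / (?q\<^sup>2 * ?q\<^sup>2) = 2 * r\<^sup>2 / ?q ^ 3"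
          using pos[OF x(1) x1] by (metis less_irrefl)
        then show "C * ((0 * ?q\<^sup>2 - r * (2 * ?q * - r)) / (?q\<^sup>2 * ?q\<^sup>2)) - \<phi>2 x
            = C * (2 * r\<^sup>2 / ?q ^ 3) - \<phi>2 x" by (simp only:)
      qed
      then show "\<exists>y. ((\<lambda>x. C * (r / (1 - r * x)\<^sup>2) - \<phi>1 x) has_real_derivative y) (at x) \<and> 0 \<le> y"
        using b[OF x(1) x1] by force
    qed
    then show ?thesis using z(2) by (simp add: algebra_simps)
  qed
  have "(\<lambda>x. C * (1 / (1 - r * x) - r * x) - \<phi> x) 0 \<le> (\<lambda>x. C * (1 / (1 - r * x) - r * x) - \<phi> x) 1"
  proof (rule DERIV_nonneg_imp_nondecreasing[OF zero_le_one])
    fix x :: real assume x: "0 \<le> x" "x \<le> 1"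
    have "((\<lambda>x. C * (1 / (1 - r * x) - r * x) - \<phi> x) has_real_derivative
        C * (r / (1 - r * x)\<^sup>2 - r) - \<phi>1 x) (at x)"
      using pos[OF x] by (auto intro!: derivative_eq_intros d1[OF x] simp: power2_eq_square)
    then show "\<exists>y. ((\<lambda>x. C * (1 / (1 - r * x) - r * x) - \<phi> x) has_real_derivative y) (at x) \<and> 0 \<le> y"
      using \<phi>1[OF x] by force
  qed
  then have "\<phi> 1 \<le> C * (1 / (1 - r) - 1 - r)" using z(1) by (simp add: algebra_simps)
  also have "1 / (1 - r) - 1 - r = r\<^sup>2 / (1 - r)"
    using r by (simp add: field_simps power2_eq_square)
  finally show ?thesis .
qed

text \<open>Self-concordance is required in the trilinear form \<open>D3_bound\<close>, and \<open>gap\<close> sharpens the usual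
  barrier inequality \<open>D1 p (y - p) \<le> \<nu>\<close>: what is lost there controls the local distance to \<open>y\<close>.
  Only the radius 1/2 of the Dikin ellipsoid is used.\<close>

locale sc_barrier = twice_differentiable E S f D1 D2
  for E S :: "'a::euclidean_space set" and f D1 D2 +
  fixes D3 :: "'a \<Rightarrow> 'a \<Rightarrow> 'a \<Rightarrow> 'a \<Rightarrow> real" and \<nu> :: real and D :: "'a set"
  assumes nu: "1 \<le> \<nu>"
    and D3: "p \<in> S \<Longrightarrow> ((\<lambda>y. D2 y v w) has_derivative (\<lambda>u. D3 p u v w)) (at p)"
    and D3_cyclic: "p \<in> S \<Longrightarrow> D3 p u v w = D3 p v w u"
    and D3_bound: "p \<in> S \<Longrightarrow> \<bar>D3 p u v v\<bar> \<le> 2 * sqrt (D2 p u u) * D2 p v v"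
    and dikin: "p \<in> S \<Longrightarrow> D2 p v v < 1 / 4 \<Longrightarrow> p + v \<in> S"
    and D1_bound: "p \<in> S \<Longrightarrow> \<bar>D1 p v\<bar> \<le> sqrt \<nu> * sqrt (D2 p v v)"
    and gap: "p \<in> S \<Longrightarrow> y \<in> D \<Longrightarrow>
      \<exists>P\<ge>0. D1 p (y - p) = \<nu> - P \<and> sqrt (D2 p (y - p) (y - p)) \<le> P + sqrt \<nu>"
begin

abbreviation nrm :: "'a \<Rightarrow> 'a \<Rightarrow> real" where "nrm p v \<equiv> sqrt (D2 p v v)"
abbreviation dual_norm :: "'a \<Rightarrow> 'a \<Rightarrow> real" where
  "dual_norm p w \<equiv> local_norm E f p (hess_inv_on E f p w)"

section \<open>Local norms along a segment\<close>

lemma D2_nonneg: "p \<in> S \<Longrightarrow> v \<in> E \<Longrightarrow> 0 \<le> D2 p v v"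
  using D2_pos[of p v] linear_0[OF linear_D2_left] by (cases "v = 0") fastforce+

lemma D2_scale: "p \<in> S \<Longrightarrow> D2 p (a *\<^sub>R v) (b *\<^sub>R w) = a * b * D2 p v w"
  by (simp add: linear_cmul[OF linear_D2_left] linear_cmul[OF linear_D2_right])

lemma D2_Cauchy_Schwarz:
  assumes p: "p \<in> S" and uv: "u \<in> E" "v \<in> E"
  shows "D2 p u v \<le> nrm p u * nrm p v"
proof (cases "v = 0")
  case True
  then show ?thesis using linear_0[OF linear_D2_right[OF p]] by simp
next
  case False
  let ?t = "D2 p u v / D2 p v v"
  have pos: "0 < D2 p v v" using D2_pos[OF p uv(2) False] .
  have mem: "u - ?t *\<^sub>R v \<in> E" using subE uv subspace_diff subspace_scale by blast
  have "0 \<le> D2 p (u - ?t *\<^sub>R v) (u - ?t *\<^sub>R v)" by (rule D2_nonneg[OF p mem])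
  also have "\<dots> = D2 p u u - 2 * ?t * D2 p u v + ?t * ?t * D2 p v v"
    using D2_sym[OF p, of v u]
    by (simp add: linear_diff[OF linear_D2_left[OF p]] linear_diff[OF linear_D2_right[OF p]]
        linear_cmul[OF linear_D2_left[OF p]] linear_cmul[OF linear_D2_right[OF p]])
  also have "\<dots> = D2 p u u - (D2 p u v)\<^sup>2 / D2 p v v"
    using pos by (simp add: field_simps power2_eq_square)
  finally have "(D2 p u v)\<^sup>2 \<le> D2 p u u * D2 p v v"
    using pos by (simp add: field_simps)
  then have "D2 p u v \<le> sqrt (D2 p u u * D2 p v v)" by (rule real_le_rsqrt)
  then show ?thesis by (simp add: real_sqrt_mult)
qed

lemma segment_in_domain:
  assumes p: "p \<in> S" and u: "u \<in> E" "nrm p u < 1/2" and s: "0 \<le> s" "s \<le> 1"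
  shows "p + s *\<^sub>R u \<in> S"
proof (rule dikin[OF p])
  have "nrm p u < sqrt (1/4)" using u(2) by (simp add: real_sqrt_divide)
  then have "D2 p u u < 1/4" by simp
  moreover have "s * s * D2 p u u \<le> 1 * D2 p u u"
    using s D2_nonneg[OF p u(1)] by (intro mult_right_mono mult_le_one) auto
  ultimately show "D2 p (s *\<^sub>R u) (s *\<^sub>R u) < 1/4" by (simp add: D2_scale[OF p])
qed

lemma line_has_derivative:
  fixes u :: 'a and F :: "'a \<Rightarrow> real"
  assumes "(F has_derivative F') (at (p + s *\<^sub>R u))"
  shows "((\<lambda>s. F (p + s *\<^sub>R u)) has_real_derivative F' u) (at s)"
proof -
  have "((\<lambda>s. p + s *\<^sub>R u) has_derivative (\<lambda>t. t *\<^sub>R u)) (at s)"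
    by (auto intro!: derivative_eq_intros)
  from has_derivative_compose[OF this assms]
  have "((\<lambda>s. F (p + s *\<^sub>R u)) has_derivative (\<lambda>t. F' u * t)) (at s)"
    by (simp add: linear_cmul[OF has_derivative_linear[OF assms]] mult.commute)
  then show ?thesis by (simp add: has_field_derivative_def)
qed

lemma nrm_direction_growth:
  assumes p: "p \<in> S" and u: "u \<in> E" "nrm p u < 1/2" and s: "0 \<le> s" "s \<le> 1"
  shows "nrm (p + s *\<^sub>R u) u \<le> nrm p u / (1 - nrm p u * s)"
proof (cases "u = 0")
  case True
  then show ?thesis using linear_0[OF linear_D2_right[OF p]] by simp
next
  case False
  let ?h = "\<lambda>s. D2 (p + s *\<^sub>R u) u u"
  note seg = segment_in_domain[OF p u]
  show ?thesis
  proof (rule inverse_sqrt_growth[of _ ?h s "\<lambda>s. D3 (p + s *\<^sub>R u) u u u", OF _ _ _ s])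
    show "0 < nrm p u" using D2_pos[OF p u(1) False] by simp
    show "nrm p u < 1" using u(2) by linarith
    show "?h 0 = (nrm p u)\<^sup>2" using D2_nonneg[OF p u(1)] by simp
    fix x :: real assume x: "0 \<le> x" "x \<le> 1"
    show "0 < ?h x" using D2_pos[OF seg[OF x] u(1) False] .
    show "(?h has_real_derivative D3 (p + x *\<^sub>R u) u u u) (at x)"
      by (rule line_has_derivative[OF D3[OF seg[OF x]]])
    show "\<bar>D3 (p + x *\<^sub>R u) u u u\<bar> \<le> 2 * sqrt (?h x) * ?h x" by (rule D3_bound[OF seg[OF x]])
  qed
qed

text \<open>Here \<open>D3_bound\<close> is used with different vectors: \<open>u\<close> is the
  direction of motion, \<open>v\<close> the vector measured. \<open>nrm_direction_growth\<close>
  bounds the factor of \<open>u\<close> along the segment and leaves a linear differential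
  inequality for the form at \<open>v\<close>.\<close>

lemma nrm_growth:
  assumes p: "p \<in> S" and u: "u \<in> E" "nrm p u < 1/2" and s: "0 \<le> s" "s \<le> 1" and v: "v \<in> E"
  shows "nrm (p + s *\<^sub>R u) v \<le> nrm p v / (1 - nrm p u * s)"
    and "nrm p v \<le> nrm (p + s *\<^sub>R u) v / (1 - nrm p u * s)"
proof -
  let ?g = "\<lambda>s. D2 (p + s *\<^sub>R u) v v" and ?r = "nrm p u"
  note seg = segment_in_domain[OF p u]
  have r: "0 \<le> ?r" using D2_nonneg[OF p u(1)] by simp
  have r1: "?r < 1" using u(2) by linarith
  have d: "(?g has_real_derivative D3 (p + x *\<^sub>R u) u v v) (at x)" if "0 \<le> x" "x \<le> 1" for x
    by (rule line_has_derivative[OF D3[OF seg[OF that]]])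
  have b: "\<bar>D3 (p + x *\<^sub>R u) u v v\<bar> \<le> 2 * (?r / (1 - ?r * x)) * ?g x" if x: "0 \<le> x" "x \<le> 1" for x
  proof -
    have "\<bar>D3 (p + x *\<^sub>R u) u v v\<bar> \<le> 2 * nrm (p + x *\<^sub>R u) u * ?g x" by (rule D3_bound[OF seg[OF x]])
    also have "\<dots> \<le> 2 * (?r / (1 - ?r * x)) * ?g x"
      using nrm_direction_growth[OF p u x] D2_nonneg[OF seg[OF x] v]
      by (intro mult_right_mono mult_left_mono) auto
    finally show ?thesis .
  qed
  have q: "0 < 1 - ?r * s" using r r1 s mult_left_le[of s ?r] by linarith
  have "sqrt ((1 - ?r * s)\<^sup>2 * ?g s) \<le> sqrt (D2 p v v)"
    using quadratic_form_growth(1)[OF r r1 s d b] by simp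
  then show "nrm (p + s *\<^sub>R u) v \<le> nrm p v / (1 - ?r * s)"
    using q by (simp add: real_sqrt_mult field_simps)
  have "sqrt ((1 - ?r * s)\<^sup>2 * D2 p v v) \<le> sqrt (?g s)"
    using quadratic_form_growth(2)[OF r r1 s d b] by simp
  then show "nrm p v \<le> nrm (p + s *\<^sub>R u) v / (1 - ?r * s)"
    using q by (simp add: real_sqrt_mult field_simps)
qed

section \<open>Dual norms\<close>

lemma dual_norm_eq:
  assumes "p \<in> S" "p \<in> E" "w \<in> E"
  shows "dual_norm p w = nrm p (hess_inv_on E f p w)"
  using local_norm_eq[OF assms(1,2) hess_inv_on_inner(1)[OF assms]] .

lemma dual_norm_nonneg:
  assumes "p \<in> S" "p \<in> E" "w \<in> E"
  shows "0 \<le> dual_norm p w"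
  using dual_norm_eq[OF assms] D2_nonneg[OF assms(1) hess_inv_on_inner(1)[OF assms]] by simp

lemma inner_le_dual_norm:
  assumes p: "p \<in> S" "p \<in> E" and w: "w \<in> E" and v: "v \<in> E"
  shows "w \<bullet> v \<le> dual_norm p w * nrm p v"
  using D2_Cauchy_Schwarz[OF p(1) hess_inv_on_inner(1)[OF p w] v] hess_inv_on_inner(2)[OF p w v]
  by (simp add: dual_norm_eq[OF p w])

lemma inner_hess_inv:
  assumes p: "p \<in> S" "p \<in> E" and w: "w \<in> E"
  shows "w \<bullet> hess_inv_on E f p w = (dual_norm p w)\<^sup>2"
  using hess_inv_on_inner(2)[OF p w hess_inv_on_inner(1)[OF p w]]
    D2_nonneg[OF p(1) hess_inv_on_inner(1)[OF p w]]
  by (simp add: dual_norm_eq[OF p w] del: real_sqrt_pow2_iff)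

text \<open>Testing with \<open>v = hess_inv_on E f p w\<close> turns the hypothesis into
  \<open>d * d \<le> K * d\<close> for the dual norm \<open>d\<close>. With
  \<open>inner_le_dual_norm\<close> this characterises \<open>d\<close> as the best constant, so
  upper bounds need no inverse Hessian.\<close>

lemma dual_norm_le:
  assumes p: "p \<in> S" "p \<in> E" and w: "w \<in> E" and K: "0 \<le> K" "\<And>v. v \<in> E \<Longrightarrow> w \<bullet> v \<le> K * nrm p v"
  shows "dual_norm p w \<le> K"
proof -
  have "(dual_norm p w)\<^sup>2 \<le> K * dual_norm p w"
    using K(2)[OF hess_inv_on_inner(1)[OF p w]] inner_hess_inv[OF p w] dual_norm_eq[OF p w] by simp
  then show ?thesis
    using K(1) dual_norm_nonneg[OF p w] by (cases "dual_norm p w = 0") (auto simp: power2_eq_square)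
qed

lemma dual_norm_pos:
  assumes p: "p \<in> S" "p \<in> E" and w: "w \<in> E" "w \<noteq> 0"
  shows "0 < dual_norm p w"
proof -
  have "0 < w \<bullet> w" using w by simp
  also have "\<dots> \<le> dual_norm p w * nrm p w" by (rule inner_le_dual_norm[OF p w(1) w(1)])
  finally have "dual_norm p w \<noteq> 0" by auto
  then show ?thesis using dual_norm_nonneg[OF p w(1)] by simp
qed

lemma dual_norm_add_scaled:
  assumes p: "p \<in> S" "p \<in> E" and w: "w \<in> E" "z \<in> E"
  shows "dual_norm p (w + a *\<^sub>R z) \<le> dual_norm p w + \<bar>a\<bar> * dual_norm p z"
proof (rule dual_norm_le[OF p])
  show "w + a *\<^sub>R z \<in> E" using w subE subspace_add subspace_scale by blast
  show "0 \<le> dual_norm p w + \<bar>a\<bar> * dual_norm p z"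
    using dual_norm_nonneg[OF p w(1)] dual_norm_nonneg[OF p w(2)] by simp
  fix v assume v: "v \<in> E"
  have z: "\<bar>z \<bullet> v\<bar> \<le> dual_norm p z * nrm p v"
    using inner_le_dual_norm[OF p w(2) v] inner_le_dual_norm[OF p w(2), of "- v"] v
      subspace_neg[OF subE v] D2_scale[OF p(1), of "-1" v "-1" v] by simp
  have "a * (z \<bullet> v) \<le> \<bar>a\<bar> * \<bar>z \<bullet> v\<bar>" by (simp add: abs_mult[symmetric])
  also have "\<dots> \<le> \<bar>a\<bar> * (dual_norm p z * nrm p v)" using z by (intro mult_left_mono) auto
  finally show "(w + a *\<^sub>R z) \<bullet> v \<le> (dual_norm p w + \<bar>a\<bar> * dual_norm p z) * nrm p v"
    using inner_le_dual_norm[OF p w(1) v] by (simp add: inner_add_left algebra_simps)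
qed

lemma dual_norm_grad:
  assumes p: "p \<in> S" "p \<in> E"
  shows "dual_norm p (grad_on E f p) \<le> sqrt \<nu>"
proof (rule dual_norm_le[OF p grad_on_inner(1)[OF p]])
  show "0 \<le> sqrt \<nu>" using nu by simp
  fix v assume "v \<in> E"
  then show "grad_on E f p \<bullet> v \<le> sqrt \<nu> * nrm p v"
    using grad_on_inner(2)[OF p] D1_bound[OF p(1), of v] by simp
qed

text \<open>The Newton direction \<open>u\<close> cancels the linear part of the new residual, so
  its pairing with \<open>v\<close> is the second-order Taylor remainder of \<open>D1 _ v\<close>
  along the step. That remainder is at most \<open>nrm p v * (n\<^sup>2 / (1 - n))\<close>; passing
  from the norm at \<open>p\<close> to the norm at \<open>p'\<close> costs the second factor
  \<open>1 / (1 - n)\<close>.\<close>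

lemma newton_decrement:
  assumes p: "p \<in> S" "p \<in> E" and w: "w \<in> E"
    and n: "n = dual_norm p (w + grad_on E f p)" "n < 1/2"
    and p': "p' = p - hess_inv_on E f p (w + grad_on E f p)"
  shows "p' \<in> S" "p' \<in> E" "dual_norm p' (w + grad_on E f p') \<le> (n / (1 - n))\<^sup>2"
proof -
  let ?e = "w + grad_on E f p"
  define u where "u = - hess_inv_on E f p ?e"
  have e: "?e \<in> E" using w grad_on_inner(1)[OF p] subE subspace_add by blast
  have u: "u \<in> E" unfolding u_def using hess_inv_on_inner(1)[OF p e] subE subspace_neg by blast
  have nu_eq: "nrm p u = n"
    using n(1) dual_norm_eq[OF p e] D2_scale[OF p(1), of "-1" "hess_inv_on E f p ?e" "-1" "hess_inv_on E f p ?e"]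
    by (simp add: u_def)
  then have ul: "nrm p u < 1/2" using n(2) by simp
  have r: "0 \<le> n" "n < 1" using n dual_norm_nonneg[OF p e] by auto
  have p'u: "p' = p + 1 *\<^sub>R u" using p' by (simp add: u_def)
  note seg = segment_in_domain[OF p(1) u ul]
  show pS: "p' \<in> S" unfolding p'u by (rule seg) auto
  show pE: "p' \<in> E" unfolding p'u using p(2) u subE subspace_add by (metis scaleR_one)
  have e': "w + grad_on E f p' \<in> E" using w grad_on_inner(1)[OF pS pE] subE subspace_add by blast
  show "dual_norm p' (w + grad_on E f p') \<le> (n / (1 - n))\<^sup>2"
  proof (rule dual_norm_le[OF pS pE e'])
    fix v assume v: "v \<in> E"
    let ?\<phi> = "\<lambda>s. D1 (p + s *\<^sub>R u) v - D1 p v - s * D2 p u v"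
    let ?\<phi>1 = "\<lambda>s. D2 (p + s *\<^sub>R u) u v - D2 p u v"
    let ?\<phi>2 = "\<lambda>s. D3 (p + s *\<^sub>R u) u u v"
    have "?\<phi> 1 \<le> nrm p v * (n\<^sup>2 / (1 - n))"
    proof (rule newton_remainder[of n ?\<phi> ?\<phi>1 ?\<phi>2, OF r])
      fix x :: real assume x: "0 \<le> x" "x \<le> 1"
      show "(?\<phi> has_real_derivative ?\<phi>1 x) (at x)"
        by (auto intro!: derivative_eq_intros line_has_derivative[OF D2[OF seg[OF x]]])
      show "(?\<phi>1 has_real_derivative ?\<phi>2 x) (at x)"
        by (auto intro!: derivative_eq_intros line_has_derivative[OF D3[OF seg[OF x]]])
      let ?q = "p + x *\<^sub>R u"
      \<comment> \<open>The cyclic shift moves the test vector into the first slot, where the bound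
        is linear in its norm.\<close>
      have "?\<phi>2 x = D3 ?q v u u" using D3_cyclic[OF seg[OF x], of v u u] by simp
      also have "\<dots> \<le> 2 * nrm ?q v * D2 ?q u u"
        using D3_bound[OF seg[OF x], of v u] by (rule order_trans[OF abs_ge_self])
      also have "\<dots> = 2 * (nrm ?q v * (nrm ?q u)\<^sup>2)" using D2_nonneg[OF seg[OF x] u] by simp
      also have "\<dots> \<le> 2 * (nrm p v / (1 - n * x) * (n / (1 - n * x))\<^sup>2)"
        using nrm_growth(1)[OF p(1) u ul x v] nrm_direction_growth[OF p(1) u ul x]
          D2_nonneg[OF p(1) v] D2_nonneg[OF seg[OF x] v] D2_nonneg[OF seg[OF x] u] r x
          mult_left_le[of x n]
        unfolding nu_eq
        by (intro mult_left_mono mult_mono power_mono) auto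
      also have "\<dots> = nrm p v * (2 * n\<^sup>2 / (1 - n * x) ^ 3)"
        by (simp add: power2_eq_square power3_eq_cube mult.assoc mult.left_commute)
      finally show "?\<phi>2 x \<le> nrm p v * (2 * n\<^sup>2 / (1 - n * x) ^ 3)" .
    qed auto
    moreover have "D2 p u v = - (?e \<bullet> v)"
      using hess_inv_on_inner(2)[OF p e v] linear_neg[OF linear_D2_left[OF p(1)]] by (simp add: u_def)
    moreover have "(w + grad_on E f p') \<bullet> v = w \<bullet> v + D1 p' v"
      using grad_on_inner(2)[OF pS pE v] by (simp add: inner_add_left)
    moreover have "?e \<bullet> v = w \<bullet> v + D1 p v"
      using grad_on_inner(2)[OF p v] by (simp add: inner_add_left)
    ultimately have "(w + grad_on E f p') \<bullet> v \<le> nrm p v * (n\<^sup>2 / (1 - n))"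
      unfolding p'u by simp
    also have "\<dots> \<le> (nrm p' v / (1 - n)) * (n\<^sup>2 / (1 - n))"
      using nrm_growth(2)[OF p(1) u ul _ _ v, of 1] r unfolding nu_eq p'u
      by (intro mult_right_mono) auto
    also have "\<dots> = (n / (1 - n))\<^sup>2 * nrm p' v" by (simp add: power2_eq_square)
    finally show "(w + grad_on E f p') \<bullet> v \<le> (n / (1 - n))\<^sup>2 * nrm p' v" .
  qed simp
qed

lemma newton_centring_step:
  assumes p: "p \<in> S" "p \<in> E" and w: "w \<in> E" and n: "dual_norm p (w + grad_on E f p) \<le> 1/4"
    and p': "p' = p - hess_inv_on E f p (w + grad_on E f p)"
  shows "p' \<in> S" "p' \<in> E" "dual_norm p' (w + grad_on E f p') \<le> 1/9"
proof -
  let ?n = "dual_norm p (w + grad_on E f p)"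
  have n0: "0 \<le> ?n" using dual_norm_nonneg[OF p] w grad_on_inner(1)[OF p] subE subspace_add by blast
  note nd = newton_decrement[OF p w refl _ p']
  show "p' \<in> S" "p' \<in> E" using nd(1,2) n by auto
  have "?n / (1 - ?n) \<le> 1/3" using n n0 by (simp add: divide_le_eq)
  then have "(?n / (1 - ?n))\<^sup>2 \<le> (1/3)\<^sup>2" using n n0 by (intro power_mono) auto
  also have "\<dots> = (1/9 :: real)" by (simp add: power2_eq_square)
  finally show "dual_norm p' (w + grad_on E f p') \<le> 1/9"
    using nd(3) n by linarith
qed

text \<open>The linear term itself is not small, but near a central point it almost cancels the
  gradient, so its dual norm is at most \<open>1/9 + sqrt \<nu>\<close>. Rescaling by
  \<open>\<kappa>\<close> thus adds at most 1/8 * 10/9 = 5/36, and 1/9 + 5/36 = 1/4 is what the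
  centring step tolerates.\<close>

lemma newton_path_step:
  assumes p: "p \<in> S" "p \<in> E" and w: "w \<in> E" and n: "dual_norm p (w + grad_on E f p) \<le> 1/9"
    and \<kappa>: "\<bar>\<kappa> - 1\<bar> \<le> 1 / (8 * sqrt \<nu>)"
    and p': "p' = p - hess_inv_on E f p (\<kappa> *\<^sub>R w + grad_on E f p)"
  shows "p' \<in> S" "p' \<in> E" "dual_norm p' (\<kappa> *\<^sub>R w + grad_on E f p') \<le> 1/9"
proof -
  let ?g = "grad_on E f p"
  have g: "?g \<in> E" by (rule grad_on_inner(1)[OF p])
  have wg: "w + ?g \<in> E" using w g subE subspace_add by blast
  have kw: "\<kappa> *\<^sub>R w \<in> E" using w subE subspace_scale by blast
  have s1: "1 \<le> sqrt \<nu>" using nu by simp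
  have "dual_norm p w \<le> dual_norm p (w + ?g) + \<bar>- 1\<bar> * dual_norm p ?g"
    using dual_norm_add_scaled[OF p wg g, of "-1"] by simp
  then have dw: "dual_norm p w \<le> 1/9 + sqrt \<nu>" using n dual_norm_grad[OF p] by linarith
  have eq: "\<kappa> *\<^sub>R w + ?g = (w + ?g) + (\<kappa> - 1) *\<^sub>R w" by (simp add: algebra_simps)
  have "dual_norm p (\<kappa> *\<^sub>R w + ?g) \<le> dual_norm p (w + ?g) + \<bar>\<kappa> - 1\<bar> * dual_norm p w"
    unfolding eq by (rule dual_norm_add_scaled[OF p wg w])
  also have "\<dots> \<le> 1/9 + 1 / (8 * sqrt \<nu>) * (1/9 + sqrt \<nu>)"
    using n \<kappa> dw dual_norm_nonneg[OF p w] nu by (intro add_mono mult_mono) auto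
  also have "\<dots> \<le> 1/9 + 5/36"
    unfolding times_divide_eq_left mult_1_left
    by (rule add_left_mono, rule divide_le_eq[THEN iffD2]) (use s1 nu in auto)
  finally have le: "dual_norm p (\<kappa> *\<^sub>R w + ?g) \<le> 1/4" by simp
  show "p' \<in> S" "p' \<in> E" "dual_norm p' (\<kappa> *\<^sub>R w + grad_on E f p') \<le> 1/9"
    using newton_centring_step[OF p kw le p'] by auto
qed

text \<open>The quantity \<open>P\<close> of assumption \<open>gap\<close> cancels here, so that no bound on the local norm of
  \<open>y - p\<close> and no exact central point is needed.\<close>

lemma objective_gap:
  assumes p: "p \<in> S" "p \<in> E" and c: "c \<in> E" and y: "y \<in> D" "y \<in> E"
    and n: "dual_norm p (\<eta> *\<^sub>R c + grad_on E f p) \<le> 1/9"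
  shows "\<eta> * (c \<bullet> (p - y)) \<le> 6/5 * \<nu>"
proof -
  let ?g = "grad_on E f p" let ?w = "\<eta> *\<^sub>R c + ?g"
  have w: "?w \<in> E" using c grad_on_inner(1)[OF p] subE subspace_add subspace_scale by blast
  have d: "y - p \<in> E" "p - y \<in> E" using y(2) p(2) subE subspace_diff by blast+
  have s1: "1 \<le> sqrt \<nu>" using nu by simp
  obtain P where P: "0 \<le> P" "D1 p (y - p) = \<nu> - P" "nrm p (y - p) \<le> P + sqrt \<nu>"
    using gap[OF p(1) y(1)] by blast
  have nn: "nrm p (p - y) = nrm p (y - p)"
    using D2_scale[OF p(1), of "-1" "y - p" "-1" "y - p"] by simp
  have "?w \<bullet> (p - y) \<le> dual_norm p ?w * nrm p (y - p)"
    using inner_le_dual_norm[OF p w d(2)] nn by simp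
  also have "\<dots> \<le> 1/9 * (P + sqrt \<nu>)"
    using n P nu by (intro mult_mono) (auto intro: D2_nonneg[OF p(1) d(1)])
  finally have 1: "?w \<bullet> (p - y) \<le> 1/9 * (P + sqrt \<nu>)" .
  have "\<eta> * (c \<bullet> (p - y)) = ?w \<bullet> (p - y) + ?g \<bullet> (y - p)"
    by (simp add: inner_add_left inner_diff_right algebra_simps)
  also have "\<dots> \<le> 1/9 * (P + sqrt \<nu>) + (\<nu> - P)"
    using 1 P(2) grad_on_inner(2)[OF p d(1)] by simp
  also have "\<dots> \<le> sqrt \<nu> / 9 + \<nu>" using P(1) by argo
  also have "sqrt \<nu> \<le> \<nu>"
    using mult_right_mono[OF s1, of "sqrt \<nu>"] nu by simp
  finally show ?thesis using nu by simp
qed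

text \<open>The points \<open>p \<plusminus> u\<close>, where \<open>u\<close> is the maximising
  direction scaled to local norm 1/4, lie inside the Dikin ellipsoid of radius 1/2. They differ in
  the value of \<open>w\<close> by half the dual norm, hence the factor 2.\<close>

lemma dual_norm_le_width:
  assumes p: "p \<in> S" "p \<in> E" and w: "w \<in> E"
    and K: "\<And>y y'. y \<in> S \<Longrightarrow> y \<in> E \<Longrightarrow> y' \<in> S \<Longrightarrow> y' \<in> E \<Longrightarrow> w \<bullet> (y - y') \<le> K"
  shows "dual_norm p w \<le> 2 * K"
proof (cases "dual_norm p w = 0")
  case True
  then show ?thesis using K[OF p p] by simp
next
  case False
  define t where "t = dual_norm p w"
  have t: "0 < t" using False dual_norm_nonneg[OF p w] by (simp add: t_def)
  let ?v = "hess_inv_on E f p w" let ?u = "(1 / (4 * t)) *\<^sub>R ?v"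
  have v: "?v \<in> E" by (rule hess_inv_on_inner(1)[OF p w])
  have D2v: "D2 p ?v ?v = t\<^sup>2" using D2_nonneg[OF p(1) v] dual_norm_eq[OF p w] by (simp add: t_def)
  have u: "?u \<in> E" "- ?u \<in> E" using v subE subspace_scale subspace_neg by blast+
  have "D2 p ?u ?u = 1 / 16"
    unfolding D2_scale[OF p(1)] D2v using t by (simp add: power2_eq_square)
  moreover have "D2 p (- ?u) (- ?u) = D2 p ?u ?u"
    using D2_scale[OF p(1), of "-1" ?u "-1" ?u] by simp
  ultimately have S: "p + ?u \<in> S" "p + - ?u \<in> S"
    by (auto intro!: dikin[OF p(1)] simp del: add_uminus_conv_diff)
  have E: "p + ?u \<in> E" "p + - ?u \<in> E" using p(2) u subE subspace_add by blast+
  have "w \<bullet> ((p + ?u) - (p + - ?u)) = 2 * (1 / (4 * t)) * (w \<bullet> ?v)"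
    by (simp add: inner_add_right inner_diff_right)
  also have "\<dots> = t / 2" using t inner_hess_inv[OF p w] by (simp add: t_def power2_eq_square)
  finally show ?thesis using K[OF S(1) E(1) S(2) E(2)] by (simp add: t_def)
qed

end

section \<open>The logarithmic-exponential barrier\<close>

text \<open>For \<open>\<phi>(z, y) = - ln z - ln w\<close> with \<open>w = ln z - y\<close>, let \<open>a\<close> and \<open>e\<close> be the relative changes of \<open>z\<close>
  and \<open>w\<close> to first order and \<open>c = a / \<surd>w\<close>. The second derivative of \<open>\<phi>\<close> is \<open>a\<^sup>2 + e\<^sup>2 + c\<^sup>2\<close> and
  \<open>- D\<^sup>3\<phi>[u', u, u]\<close> is the expression below; its term \<open>2 a' a\<^sup>2 / w\<close> is written as
  \<open>2/3 a' c\<^sup>2 + 4/3 c' a c\<close>, which makes the form symmetric in the triples \<open>(a, e, c)\<close>.\<close>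

lemma log_block_trilinear:
  fixes a e c a' e' c' :: real
  shows "\<bar>a' * (2 * a\<^sup>2 + 2/3 * c\<^sup>2) + e' * (2 * e\<^sup>2 + c\<^sup>2) + c' * (2 * e * c + 4/3 * a * c)\<bar>
    \<le> 2 * sqrt (a'\<^sup>2 + e'\<^sup>2 + c'\<^sup>2) * (a\<^sup>2 + e\<^sup>2 + c\<^sup>2)"
proof -
  let ?G = "(2 * a\<^sup>2 + 2/3 * c\<^sup>2)\<^sup>2 + (2 * e\<^sup>2 + c\<^sup>2)\<^sup>2 + (2 * e * c + 4/3 * a * c)\<^sup>2"
  let ?X = "a' * (2 * a\<^sup>2 + 2/3 * c\<^sup>2) + e' * (2 * e\<^sup>2 + c\<^sup>2) + c' * (2 * e * c + 4/3 * a * c)"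
  have CS: "(x' * x + y' * y + z' * z)\<^sup>2 \<le> (x'\<^sup>2 + y'\<^sup>2 + z'\<^sup>2) * (x\<^sup>2 + y\<^sup>2 + z\<^sup>2)"
    for x y z x' y' z' :: real
  proof -
    have "(x'\<^sup>2 + y'\<^sup>2 + z'\<^sup>2) * (x\<^sup>2 + y\<^sup>2 + z\<^sup>2) - (x' * x + y' * y + z' * z)\<^sup>2
        = (x' * y - y' * x)\<^sup>2 + (x' * z - z' * x)\<^sup>2 + (y' * z - z' * y)\<^sup>2"
      by (simp add: power2_eq_square algebra_simps)
    also have "0 \<le> \<dots>" by simp
    finally show ?thesis by (simp only: diff_ge_0_iff_ge)
  qed
  \<comment> \<open>By Cauchy-Schwarz only the length of the vector paired with
    \<open>(a', e', c')\<close> matters. \<open>?G\<close> is its square, and the difference to the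
    required bound is a sum of squares.\<close>
  have "4 * (a\<^sup>2 + e\<^sup>2 + c\<^sup>2)\<^sup>2 - ?G
      = 8 * (a * e - c\<^sup>2 / 3)\<^sup>2 + 5/3 * (c\<^sup>2)\<^sup>2 + 32/9 * (a * c)\<^sup>2"
    by (simp add: power2_eq_square algebra_simps)
  also have "0 \<le> \<dots>" by simp
  finally have G: "?G \<le> 4 * (a\<^sup>2 + e\<^sup>2 + c\<^sup>2)\<^sup>2" by (simp only: diff_ge_0_iff_ge)
  have "?X\<^sup>2 \<le> (a'\<^sup>2 + e'\<^sup>2 + c'\<^sup>2) * ?G" by (rule CS)
  also have "\<dots> \<le> (a'\<^sup>2 + e'\<^sup>2 + c'\<^sup>2) * (4 * (a\<^sup>2 + e\<^sup>2 + c\<^sup>2)\<^sup>2)"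
    using G by (intro mult_left_mono) auto
  finally have "sqrt (?X\<^sup>2) \<le> sqrt ((a'\<^sup>2 + e'\<^sup>2 + c'\<^sup>2) * (4 * (a\<^sup>2 + e\<^sup>2 + c\<^sup>2)\<^sup>2))"
    by (rule real_sqrt_le_mono)
  moreover have "sqrt (U * (4 * N\<^sup>2)) = 2 * sqrt U * N" if "0 \<le> N" for U N :: real
    using that by (simp add: real_sqrt_mult)
  ultimately show ?thesis by (simp only: real_sqrt_abs sum_power2_ge_zero add_nonneg_nonneg zero_le_power2)
qed

text \<open>Recovers \<open>a\<^sup>2\<close> from the concavity deficit
  \<open>a - ln (1 + a)\<close>. For large \<open>a\<close> the deficit grows only linearly, which
  forces the factor \<open>1 + a\<close>; for negative \<open>a\<close> the constant 2
  suffices.\<close>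

lemma ln_one_plus_quadratic_gap:
  fixes a :: real
  assumes "- 1 < a"
  shows "a\<^sup>2 \<le> 2 * max 1 (1 + a) * (a - ln (1 + a))"
proof (cases "0 \<le> a")
  case True
  have "(\<lambda>a. a\<^sup>2 / (2 * (1 + a)) - (a - ln (1 + a))) a \<le> (\<lambda>a. a\<^sup>2 / (2 * (1 + a)) - (a - ln (1 + a))) 0"
  proof (rule DERIV_nonpos_imp_nonincreasing[OF True])
    fix x assume x: "0 \<le> x" "x \<le> a"
    have "((\<lambda>a. a\<^sup>2 / (2 * (1 + a)) - (a - ln (1 + a))) has_real_derivative
        (2 * x * (2 * (1 + x)) - x\<^sup>2 * 2) / (2 * (1 + x) * (2 * (1 + x))) - (1 - 1 / (1 + x))) (at x)"
      using x by (auto intro!: derivative_eq_intros)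
    moreover have "(2 * x * (2 * (1 + x)) - x\<^sup>2 * 2) / (2 * (1 + x) * (2 * (1 + x))) - (1 - 1 / (1 + x))
        = - (x\<^sup>2 / (2 * (1 + x) * (1 + x)))"
      using x by (simp add: divide_simps) (simp add: power2_eq_square algebra_simps)
    ultimately show "\<exists>y. ((\<lambda>a. a\<^sup>2 / (2 * (1 + a)) - (a - ln (1 + a))) has_real_derivative y) (at x) \<and> y \<le> 0"
      using x by (intro exI[of _ "- (x\<^sup>2 / (2 * (1 + x) * (1 + x)))"]) simp
  qed
  then have "a\<^sup>2 / (2 * (1 + a)) \<le> a - ln (1 + a)" by simp
  then show ?thesis using True by (simp add: field_simps max_def)
next
  case False
  then have a0: "a \<le> 0" by simp
  have "(\<lambda>a. a\<^sup>2 / 2 - (a - ln (1 + a))) a \<le> (\<lambda>a. a\<^sup>2 / 2 - (a - ln (1 + a))) 0"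
  proof (rule DERIV_nonneg_imp_nondecreasing[OF a0])
    fix x assume x: "a \<le> x" "x \<le> 0"
    have "((\<lambda>a. a\<^sup>2 / 2 - (a - ln (1 + a))) has_real_derivative x - (1 - 1 / (1 + x))) (at x)"
      using x assms by (auto intro!: derivative_eq_intros)
    moreover have "x - (1 - 1 / (1 + x)) = x\<^sup>2 / (1 + x)"
      using x assms by (simp add: field_simps power2_eq_square)
    ultimately show "\<exists>y. ((\<lambda>a. a\<^sup>2 / 2 - (a - ln (1 + a))) has_real_derivative y) (at x) \<and> 0 \<le> y"
      using x assms by (intro exI[of _ "x\<^sup>2 / (1 + x)"]) auto
  qed
  then show ?thesis using False by (simp add: max_def)
qed

lemma sum_power2_le_power2_sum:
  fixes f :: "'i \<Rightarrow> real"
  assumes "finite A" "\<And>i. i \<in> A \<Longrightarrow> 0 \<le> f i"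
  shows "(\<Sum>i\<in>A. (f i)\<^sup>2) \<le> (\<Sum>i\<in>A. f i)\<^sup>2"
proof -
  have "(\<Sum>i\<in>A. (f i)\<^sup>2) \<le> (\<Sum>i\<in>A. f i * (\<Sum>i\<in>A. f i))"
    using assms by (intro sum_mono) (auto simp: power2_eq_square intro!: mult_left_mono member_le_sum)
  then show ?thesis by (simp add: sum_distrib_right[symmetric] power2_eq_square)
qed

text \<open>Constraints are written with inner products, so the derivative formulas ignore the
  product structure of the actual space. \<open>definite\<close> says that no nonzero direction of
  \<open>E\<close> is invisible to all constraints, which makes the Hessian positive definite
  there.\<close>

locale log_exp_barrier =
  fixes E :: "'a::euclidean_space set"
    and m l :: "'i::finite \<Rightarrow> 'a" and b :: "'i \<Rightarrow> real"
    and d :: "'j::finite \<Rightarrow> 'a" and \<gamma> :: "'j \<Rightarrow> real"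
  assumes subE: "subspace E"
    and definite: "\<lbrakk>v \<in> E; \<And>i. m i \<bullet> v = 0; \<And>i. l i \<bullet> v = 0; \<And>j. d j \<bullet> v = 0\<rbrakk> \<Longrightarrow> v = 0"
begin

definition "slack i p = ln (m i \<bullet> p) - l i \<bullet> p - b i"
definition "lslack j p = \<gamma> j - d j \<bullet> p"
definition "strictly_feasible = {p. (\<forall>i. 0 < m i \<bullet> p \<and> 0 < slack i p) \<and> (\<forall>j. 0 < lslack j p)}"
definition "feasible = {p. (\<forall>i. 0 < m i \<bullet> p \<and> 0 \<le> slack i p) \<and> (\<forall>j. 0 \<le> lslack j p)}"
definition "F p = (\<Sum>i\<in>UNIV. - ln (m i \<bullet> p) - ln (slack i p)) + (\<Sum>j\<in>UNIV. - ln (lslack j p))"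

text \<open>Relative first-order changes of \<open>m i \<bullet> p\<close>, of \<open>slack i p\<close> and, up to sign, of \<open>lslack j p\<close>
  in direction \<open>v\<close>; all derivatives of \<open>F\<close> are polynomials in these and \<open>1 / slack i p\<close>.\<close>

definition "ra i p v = (m i \<bullet> v) / (m i \<bullet> p)"
definition "re i p v = (ra i p v - l i \<bullet> v) / slack i p"
definition "rs j p v = (d j \<bullet> v) / lslack j p"

definition "G1 p v = (\<Sum>i\<in>UNIV. - ra i p v - re i p v) + (\<Sum>j\<in>UNIV. rs j p v)"
definition "G2 p u v =
  (\<Sum>i\<in>UNIV. ra i p u * ra i p v + re i p u * re i p v + ra i p u * ra i p v / slack i p)
  + (\<Sum>j\<in>UNIV. rs j p u * rs j p v)"
definition "G3 p u v w =
  (\<Sum>i\<in>UNIV. - (2 * ra i p u * ra i p v * ra i p w + 2 * re i p u * re i p v * re i p w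
      + (re i p u * ra i p v * ra i p w + re i p v * ra i p u * ra i p w + re i p w * ra i p u * ra i p v)
        / slack i p
      + 2 * ra i p u * ra i p v * ra i p w / slack i p))
  + (\<Sum>j\<in>UNIV. 2 * rs j p u * rs j p v * rs j p w)"

section \<open>Derivatives and self-concordance of the barrier\<close>

lemma strictly_feasibleD:
  assumes "p \<in> strictly_feasible"
  shows "0 < m i \<bullet> p" "0 < slack i p" "0 < lslack j p"
  using assms by (auto simp: strictly_feasible_def)

lemma strictly_feasible_subset: "strictly_feasible \<subseteq> feasible"
  by (auto simp: strictly_feasible_def feasible_def less_imp_le)

lemma open_strictly_feasible: "open strictly_feasible"
proof -
  have 1: "open ({p. 0 < m i \<bullet> p} \<inter> slack i -` {0<..})" for i
  proof (rule continuous_open_preimage)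
    show "continuous_on {p. 0 < m i \<bullet> p} (slack i)"
      unfolding slack_def by (intro continuous_intros) auto
    show "open {p. 0 < m i \<bullet> p}" by (intro open_Collect_less continuous_intros)
  qed auto
  have 2: "open {p. 0 < lslack j p}" for j
    unfolding lslack_def by (intro open_Collect_less continuous_intros)
  have "strictly_feasible = (\<Inter>i. {p. 0 < m i \<bullet> p} \<inter> slack i -` {0<..}) \<inter> (\<Inter>j. {p. 0 < lslack j p})"
    by (auto simp: strictly_feasible_def)
  moreover have "open (\<Inter>i. {p. 0 < m i \<bullet> p} \<inter> slack i -` {0<..})" "open (\<Inter>j. {p. 0 < lslack j p})"
    using 1 2 by (intro open_INT; simp)+
  ultimately show ?thesis by (simp add: open_Int)
qed

lemma slack_has_derivative:
  assumes p: "p \<in> strictly_feasible"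
  shows "(slack i has_derivative (\<lambda>u. slack i p * re i p u)) (at p)"
proof -
  note pos = strictly_feasibleD(1,2)[OF p, of i]
  have "((\<lambda>p. ln (m i \<bullet> p) - l i \<bullet> p - b i) has_derivative
      (\<lambda>u. (m i \<bullet> u) * inverse (m i \<bullet> p) - l i \<bullet> u - 0)) (at p)"
    using pos by (auto intro!: derivative_eq_intros)
  moreover have "(\<lambda>u. (m i \<bullet> u) * inverse (m i \<bullet> p) - l i \<bullet> u - 0) = (\<lambda>u. slack i p * re i p u)"
    using pos by (simp add: re_def ra_def fun_eq_iff divide_inverse)
  ultimately show ?thesis unfolding slack_def by simp
qed

lemma inverse_slack_has_derivative:
  assumes p: "p \<in> strictly_feasible"
  shows "((\<lambda>y. inverse (slack i y)) has_derivative (\<lambda>u. - re i p u * inverse (slack i p))) (at p)"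
  using strictly_feasibleD(2)[OF p, of i]
  by (auto intro!: derivative_eq_intros slack_has_derivative[OF p] simp: field_simps)

lemma ra_has_derivative:
  assumes p: "p \<in> strictly_feasible"
  shows "((\<lambda>y. ra i y v) has_derivative (\<lambda>u. - ra i p u * ra i p v)) (at p)"
  unfolding ra_def
  using strictly_feasibleD(1)[OF p, of i]
  by (auto intro!: derivative_eq_intros simp: field_simps)

lemma re_has_derivative:
  assumes p: "p \<in> strictly_feasible"
  shows "((\<lambda>y. re i y v) has_derivative
    (\<lambda>u. - (ra i p u * ra i p v * inverse (slack i p)) - re i p u * re i p v)) (at p)"
proof -
  have "((\<lambda>y. (ra i y v - l i \<bullet> v) * inverse (slack i y)) has_derivative
    (\<lambda>u. (ra i p v - l i \<bullet> v) * (- re i p u * inverse (slack i p))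
      + (- ra i p u * ra i p v - 0) * inverse (slack i p))) (at p)"
    by (intro has_derivative_mult has_derivative_diff has_derivative_const
        ra_has_derivative[OF p] inverse_slack_has_derivative[OF p])
  then show ?thesis by (simp add: re_def divide_inverse algebra_simps)
qed

lemma rs_has_derivative:
  assumes p: "p \<in> strictly_feasible"
  shows "((\<lambda>y. rs j y v) has_derivative (\<lambda>u. rs j p u * rs j p v)) (at p)"
  unfolding rs_def lslack_def
  using strictly_feasibleD(3)[OF p, of j]
  by (auto intro!: derivative_eq_intros simp: field_simps lslack_def)

lemma F_has_derivative:
  assumes p: "p \<in> strictly_feasible"
  shows "(F has_derivative G1 p) (at p)"
proof -
  have 1: "((\<lambda>p. - ln (m i \<bullet> p) - ln (slack i p)) has_derivative (\<lambda>v. - ra i p v - re i p v)) (at p)" for i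
    using strictly_feasibleD(1,2)[OF p, of i]
    by (auto intro!: derivative_eq_intros slack_has_derivative[OF p] simp: ra_def field_simps)
  have 2: "((\<lambda>p. - ln (lslack j p)) has_derivative (\<lambda>v. rs j p v)) (at p)" for j
    unfolding rs_def lslack_def
    using strictly_feasibleD(3)[OF p, of j]
    by (auto intro!: derivative_eq_intros simp: field_simps lslack_def)
  show ?thesis
    unfolding F_def G1_def by (intro has_derivative_add has_derivative_sum 1 2)
qed

lemma G1_has_derivative:
  assumes p: "p \<in> strictly_feasible"
  shows "((\<lambda>y. G1 y v) has_derivative (\<lambda>u. G2 p u v)) (at p)"
proof -
  have 1: "((\<lambda>y. - ra i y v - re i y v) has_derivative
      (\<lambda>u. ra i p u * ra i p v + re i p u * re i p v + ra i p u * ra i p v / slack i p)) (at p)" for i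
    by (rule has_derivative_eq_rhs[OF has_derivative_diff[OF has_derivative_minus[OF
            ra_has_derivative[OF p]] re_has_derivative[OF p]]])
      (simp add: divide_inverse fun_eq_iff)
  show ?thesis
    unfolding G1_def G2_def by (intro has_derivative_add has_derivative_sum 1 rs_has_derivative p)
qed

lemma G2_has_derivative:
  assumes p: "p \<in> strictly_feasible"
  shows "((\<lambda>y. G2 y v w) has_derivative (\<lambda>u. G3 p u v w)) (at p)"
proof -
  have 1: "((\<lambda>y. ra i y v * ra i y w + re i y v * re i y w + ra i y v * ra i y w / slack i y) has_derivative
      (\<lambda>u. - (2 * ra i p u * ra i p v * ra i p w + 2 * re i p u * re i p v * re i p w
      + (re i p u * ra i p v * ra i p w + re i p v * ra i p u * ra i p w + re i p w * ra i p u * ra i p v)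
        / slack i p
      + 2 * ra i p u * ra i p v * ra i p w / slack i p))) (at p)" for i
    unfolding divide_inverse
    by (rule has_derivative_eq_rhs[OF has_derivative_add[OF has_derivative_add[OF
            has_derivative_mult[OF ra_has_derivative[OF p] ra_has_derivative[OF p]]
            has_derivative_mult[OF re_has_derivative[OF p] re_has_derivative[OF p]]]
          has_derivative_mult[OF has_derivative_mult[OF ra_has_derivative[OF p] ra_has_derivative[OF p]]
            inverse_slack_has_derivative[OF p]]]])
      (simp add: algebra_simps fun_eq_iff)
  have 2: "((\<lambda>y. rs j y v * rs j y w) has_derivative (\<lambda>u. 2 * rs j p u * rs j p v * rs j p w)) (at p)" for j
    by (rule has_derivative_eq_rhs[OF has_derivative_mult[OF rs_has_derivative[OF p] rs_has_derivative[OF p]]])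
      (simp add: algebra_simps fun_eq_iff)
  show ?thesis
    unfolding G2_def G3_def by (intro has_derivative_add has_derivative_sum 1 2)
qed

definition "block i p v = (ra i p v)\<^sup>2 + (re i p v)\<^sup>2 + (ra i p v)\<^sup>2 / slack i p"

lemma G2_diag: "G2 p v v = (\<Sum>i\<in>UNIV. block i p v) + (\<Sum>j\<in>UNIV. (rs j p v)\<^sup>2)"
  by (simp add: G2_def block_def power2_eq_square)

lemma block_nonneg: "p \<in> strictly_feasible \<Longrightarrow> 0 \<le> block i p v"
  using strictly_feasibleD(2)[of p i] by (simp add: block_def)

lemma block_le_G2:
  assumes "p \<in> strictly_feasible"
  shows "block i p v \<le> G2 p v v" "(rs j p v)\<^sup>2 \<le> G2 p v v"
proof -
  have "block i p v \<le> (\<Sum>i\<in>UNIV. block i p v)"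
    by (rule member_le_sum) (auto simp: block_nonneg[OF assms])
  moreover have "(rs j p v)\<^sup>2 \<le> (\<Sum>j\<in>UNIV. (rs j p v)\<^sup>2)"
    by (rule member_le_sum) auto
  moreover have "0 \<le> (\<Sum>i\<in>UNIV. block i p v)" "0 \<le> (\<Sum>j\<in>UNIV. (rs j p v)\<^sup>2)"
    by (auto intro: sum_nonneg block_nonneg[OF assms])
  ultimately show "block i p v \<le> G2 p v v" "(rs j p v)\<^sup>2 \<le> G2 p v v" by (auto simp: G2_diag)
qed

lemma G2_pos:
  assumes p: "p \<in> strictly_feasible" and v: "v \<in> E" "v \<noteq> 0"
  shows "0 < G2 p v v"
proof (rule ccontr)
  assume "\<not> 0 < G2 p v v"
  then have z: "block i p v \<le> 0" "(rs j p v)\<^sup>2 \<le> 0" for i j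
    using block_le_G2(1)[OF p, of i v] block_le_G2(2)[OF p, of j v] by linarith+
  have ra: "ra i p v = 0" and re: "re i p v = 0" for i
  proof -
    have "0 \<le> (ra i p v)\<^sup>2 / slack i p" using strictly_feasibleD(2)[OF p, of i] by simp
    then have "(ra i p v)\<^sup>2 \<le> 0" "(re i p v)\<^sup>2 \<le> 0"
      using z(1)[of i] zero_le_power2[of "ra i p v"] zero_le_power2[of "re i p v"]
      unfolding block_def by linarith+
    then show "ra i p v = 0" "re i p v = 0" by auto
  qed
  have m: "m i \<bullet> v = 0" for i using ra[of i] strictly_feasibleD(1)[OF p, of i] by (auto simp: ra_def)
  moreover have "l i \<bullet> v = 0" for i
    using re[of i] ra[of i] strictly_feasibleD(2)[OF p, of i] by (auto simp: re_def)
  moreover have "d j \<bullet> v = 0" for j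
    using z(2)[of j] strictly_feasibleD(3)[OF p, of j] by (auto simp: rs_def)
  ultimately show False using definite v by blast
qed

text \<open>With \<open>c = a / sqrt (slack i p)\<close> every block is an instance of
  \<open>log_block_trilinear\<close>. Replacing the norm of \<open>u\<close> in each block by the
  full norm makes the bounds additive in the part quadratic in \<open>v\<close>; this keeps the
  constant 2 for the sum.\<close>

lemma G3_bound:
  assumes p: "p \<in> strictly_feasible"
  shows "\<bar>G3 p u v v\<bar> \<le> 2 * sqrt (G2 p u u) * G2 p v v"
proof -
  have 1: "\<bar>- (2 * ra i p u * ra i p v * ra i p v + 2 * re i p u * re i p v * re i p v
      + (re i p u * ra i p v * ra i p v + re i p v * ra i p u * ra i p v + re i p v * ra i p u * ra i p v)
        / slack i p
      + 2 * ra i p u * ra i p v * ra i p v / slack i p)\<bar> \<le> 2 * sqrt (G2 p u u) * block i p v" (is "\<bar>- ?T\<bar> \<le> _") for i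
  proof -
    define k where "k = inverse (sqrt (slack i p))"
    have k2: "inverse (slack i p) = k * k"
      using strictly_feasibleD(2)[OF p, of i] by (simp add: k_def inverse_mult_distrib[symmetric])
    let ?c = "\<lambda>v. k * ra i p v"
    have T: "?T = ra i p u * (2 * (ra i p v)\<^sup>2 + 2/3 * (?c v)\<^sup>2) + re i p u * (2 * (re i p v)\<^sup>2 + (?c v)\<^sup>2)
        + ?c u * (2 * re i p v * ?c v + 4/3 * ra i p v * ?c v)"
      unfolding divide_inverse k2 by (simp add: power2_eq_square algebra_simps)
    have B: "block i p w = (ra i p w)\<^sup>2 + (re i p w)\<^sup>2 + (?c w)\<^sup>2" for w
      unfolding block_def divide_inverse k2 by (simp add: power2_eq_square algebra_simps)
    have "\<bar>- ?T\<bar> \<le> 2 * sqrt (block i p u) * block i p v"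
      unfolding abs_minus_cancel T B by (rule log_block_trilinear)
    also have "\<dots> \<le> 2 * sqrt (G2 p u u) * block i p v"
      using block_le_G2(1)[OF p] block_nonneg[OF p] by (intro mult_right_mono mult_left_mono) auto
    finally show ?thesis .
  qed
  have 2: "\<bar>2 * rs j p u * rs j p v * rs j p v\<bar> \<le> 2 * sqrt (G2 p u u) * (rs j p v)\<^sup>2" for j
  proof -
    have "\<bar>rs j p u\<bar> \<le> sqrt (G2 p u u)"
      using block_le_G2(2)[OF p, of j u] by (simp add: real_le_rsqrt)
    then have "2 * \<bar>rs j p u\<bar> * (rs j p v)\<^sup>2 \<le> 2 * sqrt (G2 p u u) * (rs j p v)\<^sup>2"
      by (intro mult_right_mono mult_left_mono) auto
    then show ?thesis by (simp add: abs_mult power2_eq_square mult.assoc)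
  qed
  show ?thesis
    unfolding G3_def G2_diag[of p v] distrib_left sum_distrib_left
    by (rule order_trans[OF abs_triangle_ineq add_mono[OF order_trans[OF sum_abs sum_mono[OF 1]]
          order_trans[OF sum_abs sum_mono[OF 2]]]])
qed

section \<open>Barrier parameter, Dikin ellipsoid and gap inequality\<close>

definition "param = 2 * real CARD('i) + real CARD('j)"

lemma G1_bound:
  assumes p: "p \<in> strictly_feasible"
  shows "\<bar>G1 p v\<bar> \<le> sqrt param * sqrt (G2 p v v)"
proof -
  let ?I = "real CARD('i)" and ?J = "real CARD('j)"
  let ?x = "\<Sum>i\<in>UNIV. - ra i p v - re i p v" and ?y = "\<Sum>j\<in>UNIV. rs j p v"
  let ?A = "\<Sum>i\<in>UNIV. block i p v" and ?B = "\<Sum>j\<in>UNIV. (rs j p v)\<^sup>2"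
  have pos: "0 < 2 * ?I" "0 < ?J" by auto
  have blk: "(- ra i p v - re i p v)\<^sup>2 \<le> 2 * block i p v" for i
  proof -
    have "0 \<le> (ra i p v)\<^sup>2 / slack i p" using strictly_feasibleD(2)[OF p, of i] by simp
    moreover have "(- x - y)\<^sup>2 \<le> 2 * (x\<^sup>2 + y\<^sup>2 + z)" if "0 \<le> z" for x y z :: real
    proof -
      have "0 \<le> (x - y)\<^sup>2" by simp
      then show ?thesis using that by (simp add: power2_eq_square algebra_simps)
    qed
    ultimately show ?thesis unfolding block_def by blast
  qed
  have "?x\<^sup>2 \<le> (\<Sum>i\<in>UNIV. (- ra i p v - re i p v)\<^sup>2) * ?I"
    using sum_squared_le_sum_of_squares[of "\<lambda>i. - ra i p v - re i p v" UNIV] by simp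
  also have "\<dots> \<le> (\<Sum>i\<in>UNIV. 2 * block i p v) * ?I"
    by (intro mult_right_mono sum_mono blk) auto
  also have "\<dots> = (2 * ?I) * ?A" by (simp add: sum_distrib_left[symmetric])
  finally have x: "?x\<^sup>2 \<le> (2 * ?I) * ?A" .
  have y: "?y\<^sup>2 \<le> ?J * ?B"
    using sum_squared_le_sum_of_squares[of "\<lambda>j. rs j p v" UNIV] by (simp add: mult.commute)
  \<comment> \<open>Weighted Cauchy-Schwarz: parameters of summands add up. Each block contributes
    2, each affine constraint 1.\<close>
  have "(X + Y)\<^sup>2 \<le> (P + Q) * (A + B)"
    if "0 < P" "0 < Q" "X\<^sup>2 \<le> P * A" "Y\<^sup>2 \<le> Q * B" for X Y P Q A B :: real
  proof -
    have "0 \<le> (Q * X - P * Y)\<^sup>2" by simp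
    then have "2 * (P * Q) * (X * Y) \<le> Q\<^sup>2 * X\<^sup>2 + P\<^sup>2 * Y\<^sup>2"
      by (simp add: power2_eq_square algebra_simps)
    also have "\<dots> \<le> Q\<^sup>2 * (P * A) + P\<^sup>2 * (Q * B)"
      using that by (intro add_mono mult_left_mono) auto
    also have "\<dots> = (P * Q) * (Q * A + P * B)" by (simp add: power2_eq_square algebra_simps)
    finally have "2 * (X * Y) \<le> Q * A + P * B"
      using that(1,2) by (metis mult.assoc mult.left_commute mult_le_cancel_left_pos mult_pos_pos)
    then show ?thesis using that(3,4) by (simp add: power2_eq_square algebra_simps)
  qed
  from this[OF pos x y] have "(G1 p v)\<^sup>2 \<le> param * G2 p v v"
    by (simp add: G1_def G2_diag param_def)
  then have "\<bar>G1 p v\<bar> \<le> sqrt (param * G2 p v v)" by (simp add: real_le_rsqrt)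
  then show ?thesis by (simp add: real_sqrt_mult)
qed

lemma ra_add: "0 < m i \<bullet> p \<Longrightarrow> m i \<bullet> (p + v) = (m i \<bullet> p) * (1 + ra i p v)"
  by (simp add: ra_def inner_add_right field_simps)

text \<open>An exact expansion: the linear prediction plus the nonpositive deficit of the logarithm,
  the only nonlinearity. Both the Dikin ellipsoid and the gap estimate rest on it.\<close>

lemma slack_add:
  assumes "0 < m i \<bullet> p" "0 < m i \<bullet> (p + v)" "0 < slack i p"
  shows "slack i (p + v) = slack i p * (1 + re i p v) + (ln (1 + ra i p v) - ra i p v)"
proof -
  have "0 < 1 + ra i p v" using assms(2) ra_add[OF assms(1)] assms(1) by (simp add: zero_less_mult_iff)
  then have "slack i (p + v) = slack i p + ln (1 + ra i p v) - l i \<bullet> v"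
    unfolding slack_def ra_add[OF assms(1)] using assms(1)
    by (simp add: ln_mult inner_add_right)
  moreover have "slack i p * re i p v = ra i p v - l i \<bullet> v" using assms(3) by (simp add: re_def)
  ultimately show ?thesis by (simp add: algebra_simps)
qed

lemma lslack_add: "0 < lslack j p \<Longrightarrow> lslack j (p + v) = lslack j p * (1 - rs j p v)"
  by (simp add: lslack_def rs_def inner_add_right field_simps)

lemma dikin_ellipsoid:
  assumes p: "p \<in> strictly_feasible" and v: "G2 p v v < 1 / 4"
  shows "p + v \<in> strictly_feasible"
proof -
  have "0 < m i \<bullet> (p + v) \<and> 0 < slack i (p + v)" for i
  proof -
    note pos = strictly_feasibleD(1,2)[OF p, of i]
    let ?a = "ra i p v" and ?e = "re i p v"
    have blk: "?a\<^sup>2 + ?e\<^sup>2 + ?a\<^sup>2 / slack i p < 1/4"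
      using block_le_G2(1)[OF p, of i v] v unfolding block_def by linarith
    moreover have "0 \<le> ?a\<^sup>2 / slack i p" using pos by simp
    ultimately have "?a\<^sup>2 < 1/4" using zero_le_power2[of ?e] by linarith
    then have "?a\<^sup>2 < (1/2)\<^sup>2" by (simp add: power_divide)
    then have a: "\<bar>?a\<bar> < 1/2" using power2_less_imp_less[of "\<bar>?a\<bar>" "1/2"] by simp
    have m: "0 < m i \<bullet> (p + v)" unfolding ra_add[OF pos(1)] using pos(1) a by auto
    have "\<bar>ln (1 + ?a) - ?a\<bar> \<le> 2 * ?a\<^sup>2"
      using abs_ln_one_plus_x_minus_x_bound[of ?a] a by simp
    then have "slack i p * (1 + ?e) - 2 * ?a\<^sup>2 \<le> slack i (p + v)"
      unfolding slack_add[OF pos(1) m pos(2)] by linarith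
    moreover have "slack i p * (1 + ?e) - 2 * ?a\<^sup>2 = slack i p * (1 + ?e - 2 * (?a\<^sup>2 / slack i p))"
      using pos(2) by (simp add: field_simps)
    \<comment> \<open>Twice the bound 1/4 on the block reduces the claim to
      \<open>1/2 + e + 2 * e\<^sup>2 > 0\<close>, visible after completing the square.\<close>
    moreover have "0 < 1 + ?e - 2 * (?a\<^sup>2 / slack i p)"
    proof -
      have "0 \<le> 2 * (?e + 1/4)\<^sup>2" by simp
      then have "0 \<le> 2 * ?e\<^sup>2 + ?e + 1/8" by (simp add: power2_eq_square algebra_simps)
      then show ?thesis using blk zero_le_power2[of ?a] by linarith
    qed
    ultimately show ?thesis using m pos(2) by (smt (verit) mult_pos_pos)
  qed
  moreover have "0 < lslack j (p + v)" for j
  proof -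
    have "(rs j p v)\<^sup>2 < 1\<^sup>2" using block_le_G2(2)[OF p, of j v] v by simp
    then have "\<bar>rs j p v\<bar> < 1" using power2_less_imp_less[of "\<bar>rs j p v\<bar>" 1] by simp
    then show ?thesis unfolding lslack_add[OF strictly_feasibleD(3)[OF p]]
      using strictly_feasibleD(3)[OF p, of j] by auto
  qed
  ultimately show ?thesis by (simp add: strictly_feasible_def)
qed

text \<open>The block contributes \<open>2 - P\<close> to the derivative of the barrier towards
  \<open>y\<close>. Feasibility of \<open>y\<close> says \<open>1 + a > 0\<close> and
  \<open>a - ln (1 + a) \<le> slack i p * (1 + e)\<close>; the latter, with the quadratic gap of the
  logarithm, controls \<open>a\<^sup>2 / slack i p\<close>, the one term that \<open>P\<close> does
  not bound directly.\<close>

lemma block_gap: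
  assumes p: "p \<in> strictly_feasible" and y: "y \<in> feasible" and P: "P = 2 + ra i p (y - p) + re i p (y - p)"
  shows "0 \<le> P" "block i p (y - p) \<le> P\<^sup>2 + 2"
proof -
  note pos = strictly_feasibleD(1,2)[OF p, of i]
  let ?a = "ra i p (y - p)" and ?e = "re i p (y - p)" and ?s = "slack i p"
  have my: "0 < m i \<bullet> (p + (y - p))" using y by (simp add: feasible_def)
  then have a: "0 < 1 + ?a" unfolding ra_add[OF pos(1)] using pos(1) by (simp add: zero_less_mult_iff)
  have "0 \<le> slack i (p + (y - p))" using y by (simp add: feasible_def)
  then have gap: "?a - ln (1 + ?a) \<le> ?s * (1 + ?e)"
    unfolding slack_add[OF pos(1) my pos(2)] by simp
  have "0 \<le> ?a - ln (1 + ?a)" using ln_add_one_self_le_self2[of ?a] a by simp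
  then have e: "0 \<le> 1 + ?e" using gap pos(2) by (smt (verit) zero_le_mult_iff)
  show "0 \<le> P" using P a e by simp
  have "?a\<^sup>2 \<le> 2 * max 1 (1 + ?a) * (?a - ln (1 + ?a))"
    by (rule ln_one_plus_quadratic_gap) (use a in simp)
  also have "\<dots> \<le> 2 * max 1 (1 + ?a) * (?s * (1 + ?e))"
    using gap by (intro mult_left_mono) auto
  finally have c: "?a\<^sup>2 / ?s \<le> 2 * max 1 (1 + ?a) * (1 + ?e)"
    using pos(2) by (simp add: field_simps)
  show "block i p (y - p) \<le> P\<^sup>2 + 2"
  proof (cases "0 \<le> ?a")
    case True
    then have "?a\<^sup>2 / ?s \<le> 2 * (1 + ?a) * (1 + ?e)" using c by (simp add: max_def)
    moreover have "?a\<^sup>2 + ?e\<^sup>2 + 2 * (1 + ?a) * (1 + ?e) = P\<^sup>2 + 2 - 2 * P"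
      unfolding P by (simp add: power2_eq_square algebra_simps)
    ultimately show ?thesis using \<open>0 \<le> P\<close> unfolding block_def by linarith
  next
    case False
    then have "?a\<^sup>2 / ?s \<le> 2 * (1 + ?e)" using c by (simp add: max_def)
    moreover have "?a\<^sup>2 \<le> 1" using False a by (simp add: abs_square_le_1)
    moreover have "?e\<^sup>2 + 2 * (1 + ?e) + 1 = (1 + ?e)\<^sup>2 + 2" by (simp add: power2_eq_square algebra_simps)
    moreover have "(1 + ?e)\<^sup>2 \<le> P\<^sup>2" unfolding P using a e by (intro power_mono) auto
    ultimately show ?thesis unfolding block_def by linarith
  qed
qed

text \<open>The additive constants 2 per block and 1 per affine constraint sum to
  \<open>param\<close>. Since all shares of \<open>P\<close> are nonnegative, the sum of their
  squares is at most the square of their sum.\<close>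

lemma G1_gap:
  assumes p: "p \<in> strictly_feasible" and y: "y \<in> feasible"
  shows "\<exists>P\<ge>0. G1 p (y - p) = param - P \<and> sqrt (G2 p (y - p) (y - p)) \<le> P + sqrt param"
proof -
  let ?P = "\<lambda>i. 2 + ra i p (y - p) + re i p (y - p)" and ?Q = "\<lambda>j. 1 - rs j p (y - p)"
  let ?A = "\<Sum>i\<in>UNIV. ?P i" and ?B = "\<Sum>j\<in>UNIV. ?Q j"
  note P = block_gap[OF p y refl]
  have Q: "0 \<le> ?Q j" "(rs j p (y - p))\<^sup>2 \<le> (?Q j)\<^sup>2 + 1" for j
  proof -
    have "0 \<le> lslack j (p + (y - p))" using y by (simp add: feasible_def)
    then show q: "0 \<le> ?Q j"
      unfolding lslack_add[OF strictly_feasibleD(3)[OF p]]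
      using strictly_feasibleD(3)[OF p, of j] by (simp add: zero_le_mult_iff)
    then show "(rs j p (y - p))\<^sup>2 \<le> (?Q j)\<^sup>2 + 1" by (simp add: power2_eq_square algebra_simps)
  qed
  have AB: "0 \<le> ?A" "0 \<le> ?B" using P(1) Q(1) by (auto intro: sum_nonneg)
  have param: "0 \<le> param" by (simp add: param_def)
  have "G2 p (y - p) (y - p) \<le> (\<Sum>i\<in>UNIV. (?P i)\<^sup>2 + 2) + (\<Sum>j\<in>UNIV. (?Q j)\<^sup>2 + 1)"
    unfolding G2_diag by (intro add_mono sum_mono P Q)
  also have "\<dots> = (\<Sum>i\<in>UNIV. (?P i)\<^sup>2) + (\<Sum>j\<in>UNIV. (?Q j)\<^sup>2) + param"
    by (simp add: sum.distrib param_def)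
  also have "\<dots> \<le> ?A\<^sup>2 + ?B\<^sup>2 + param"
    using P(1) Q(1) by (intro add_mono sum_power2_le_power2_sum) auto
  also have "\<dots> \<le> (?A + ?B + sqrt param)\<^sup>2"
    using AB param by (simp add: power2_eq_square algebra_simps)
  finally have "sqrt (G2 p (y - p) (y - p)) \<le> ?A + ?B + sqrt param"
    using AB param by (intro real_le_lsqrt) auto
  moreover have "G1 p (y - p) = param - (?A + ?B)"
    by (simp add: G1_def param_def sum.distrib sum_subtractf sum_negf)
  ultimately show ?thesis using AB by (intro exI[of _ "?A + ?B"]) auto
qed

end

sublocale log_exp_barrier \<subseteq> sc_barrier E strictly_feasible F G1 G2 G3 param feasible
proof
  have "1 \<le> real CARD('i)" "1 \<le> real CARD('j)" using zero_less_card_finite by (metis Suc_leI of_nat_1 of_nat_le_iff One_nat_def)+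
  then show "1 \<le> param" unfolding param_def by linarith
  show "subspace E" by (rule subE)
  show "open strictly_feasible" by (rule open_strictly_feasible)
  fix p u v w y
  show "G2 p u v = G2 p v u" by (simp add: G2_def mult.commute)
  show "G3 p u v w = G3 p v w u"
    unfolding G3_def
    by (intro arg_cong2[where f = "(+)"] sum.cong refl) (simp_all add: algebra_simps)
  assume p: "p \<in> strictly_feasible"
  show "(F has_derivative G1 p) (at p)" by (rule F_has_derivative[OF p])
  show "((\<lambda>y. G1 y v) has_derivative (\<lambda>u. G2 p u v)) (at p)" by (rule G1_has_derivative[OF p])
  show "((\<lambda>y. G2 y v w) has_derivative (\<lambda>u. G3 p u v w)) (at p)" by (rule G2_has_derivative[OF p])
  show "v \<in> E \<Longrightarrow> v \<noteq> 0 \<Longrightarrow> 0 < G2 p v v" by (rule G2_pos[OF p])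
  show "\<bar>G3 p u v v\<bar> \<le> 2 * sqrt (G2 p u u) * G2 p v v" by (rule G3_bound[OF p])
  show "G2 p v v < 1 / 4 \<Longrightarrow> p + v \<in> strictly_feasible" by (rule dikin_ellipsoid[OF p])
  show "\<bar>G1 p v\<bar> \<le> sqrt param * sqrt (G2 p v v)" by (rule G1_bound[OF p])
  show "y \<in> feasible \<Longrightarrow>
    \<exists>P\<ge>0. G1 p (y - p) = param - P \<and> sqrt (G2 p (y - p) (y - p)) \<le> P + sqrt param"
    by (rule G1_gap[OF p])
qed

section \<open>The inner radius\<close>

lemma affine_hull_direction:
  fixes \<omega> :: "'k::finite \<Rightarrow> real ^ 'n"
  assumes "\<theta> \<in> affine hull (range \<omega>)" "v \<in> span (range (\<lambda>i. \<omega> i - \<theta>))"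
  shows "\<theta> + v \<in> affine hull (range \<omega>)"
proof -
  have "(\<lambda>x. - \<theta> + x) ` range \<omega> = range (\<lambda>i. \<omega> i - \<theta>)" by (simp add: image_image)
  then have "affine hull (range \<omega>) = (\<lambda>x. \<theta> + x) ` span (range (\<lambda>i. \<omega> i - \<theta>))"
    using affine_hull_span_gen[OF assms(1)] by (simp only:)
  then show ?thesis using assms(2) by blast
qed

text \<open>\<open>GREATEST\<close> has its meaning only if the supremum is attained. A point at
  distance at most the supremum is a limit of points moved slightly towards \<open>\<theta>\<close>,
  which lie in smaller admissible balls, and the hull is closed. Two distinct points provide a
  direction of the affine hull, which bounds the radii.\<close>

lemma inner_radius_attained:
  fixes \<omega> :: "'k::finite \<Rightarrow> real ^ 'n"
  assumes two: "2 \<le> card (range \<omega>)" and \<theta>: "\<theta> \<in> rel_interior (convex hull (range \<omega>))"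
  defines "r \<equiv> inner_radius \<omega> \<theta>"
  shows "0 < r" "cball \<theta> r \<inter> affine hull (range \<omega>) \<subseteq> convex hull (range \<omega>)" "r \<le> outer_radius \<omega> \<theta>"
proof -
  let ?C = "convex hull (range \<omega>)" and ?A = "affine hull (range \<omega>)" and ?R = "outer_radius \<omega> \<theta>"
  let ?P = "\<lambda>r. 0 \<le> r \<and> cball \<theta> r \<inter> ?A \<subseteq> ?C"
  have \<theta>C: "\<theta> \<in> ?C" using \<theta> rel_interior_subset by blast
  have \<theta>A: "\<theta> \<in> ?A" using \<theta>C convex_hull_subset_affine_hull by blast
  have CR: "?C \<subseteq> cball \<theta> ?R"
  proof (rule hull_minimal)
    show "range \<omega> \<subseteq> cball \<theta> ?R"
      unfolding outer_radius_def by (auto simp: dist_norm norm_minus_commute[of \<theta>])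
  qed auto
  obtain i where i: "\<omega> i \<noteq> \<theta>"
  proof (rule ccontr)
    assume "\<not> thesis"
    then have "range \<omega> \<subseteq> {\<theta>}" using that by auto
    then have "card (range \<omega>) \<le> 1" using card_mono[of "{\<theta>}" "range \<omega>"] by simp
    then show False using two by simp
  qed
  define u where "u = (1 / norm (\<omega> i - \<theta>)) *\<^sub>R (\<omega> i - \<theta>)"
  have u: "norm u = 1" using i by (simp add: u_def)
  have uW: "u \<in> span (range (\<lambda>i. \<omega> i - \<theta>))"
    unfolding u_def by (rule span_scale[OF span_base]) simp
  have le: "s \<le> ?R" if "?P s" for s
  proof -
    have "\<theta> + s *\<^sub>R u \<in> ?A" by (rule affine_hull_direction[OF \<theta>A span_scale[OF uW]])
    moreover have "\<theta> + s *\<^sub>R u \<in> cball \<theta> s" using u that by (simp add: dist_norm)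
    ultimately have "\<theta> + s *\<^sub>R u \<in> cball \<theta> ?R" using that CR by blast
    then show ?thesis using u that by (simp add: dist_norm)
  qed
  obtain e where e: "0 < e" "?P e"
    using \<theta> unfolding mem_rel_interior_cball affine_hull_convex_hull by (auto intro: less_imp_le)
  define s where "s = Sup {r. ?P r}"
  have bdd: "bdd_above {r. ?P r}" unfolding bdd_above_def using le by blast
  have ub: "r' \<le> s" if "?P r'" for r' unfolding s_def using that bdd by (intro cSup_upper) auto
  have s0: "0 < s" using ub[OF e(2)] e(1) by simp
  have Ps: "?P s"
  proof (intro conjI subsetI)
    fix y assume y: "y \<in> cball \<theta> s \<inter> ?A"
    have "y \<in> closure ?C" unfolding closure_approachable
    proof (intro allI impI)
      fix \<epsilon> :: real assume \<epsilon>: "0 < \<epsilon>"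
      \<comment> \<open>The contraction factor puts the shrunken point within
        \<open>\<epsilon>\<close> of \<open>y\<close> and strictly below radius \<open>s\<close>;
        the maximum covers \<open>\<epsilon> > 2 * s\<close>.\<close>
      define h where "h = max 0 (1 - \<epsilon> / (2 * s))"
      have h: "0 \<le> h" "h < 1" "(1 - h) * s < \<epsilon>"
        using \<epsilon> s0 by (auto simp: h_def max_def field_simps)
      let ?y = "(1 - h) *\<^sub>R \<theta> + h *\<^sub>R y"
      have "h * s < Sup {r. ?P r}" using h s0 by (simp add: s_def[symmetric])
      then obtain r' where r': "?P r'" "h * s < r'"
        using less_cSupD[of "{r. ?P r}" "h * s"] e(2) by (metis (no_types, lifting) empty_iff mem_Collect_eq)
      have yA: "?y \<in> ?A" using \<theta>A y mem_affine[OF affine_affine_hull, of \<theta> _ y "1 - h" h] by simp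
      have "\<theta> - ?y = h *\<^sub>R (\<theta> - y)" by (simp add: algebra_simps)
      then have "dist \<theta> ?y = h * dist \<theta> y" using h by (simp add: dist_norm)
      also have "\<dots> \<le> h * s" using y h by (intro mult_left_mono) auto
      finally have "?y \<in> cball \<theta> r'" using r' by simp
      then have yC: "?y \<in> ?C" using r' yA by blast
      have "?y - y = (1 - h) *\<^sub>R (\<theta> - y)" by (simp add: algebra_simps)
      then have "dist ?y y = (1 - h) * dist \<theta> y" using h by (simp add: dist_norm)
      also have "\<dots> \<le> (1 - h) * s" using y h by (intro mult_left_mono) auto
      finally have "dist ?y y < \<epsilon>" using h by simp
      with yC show "\<exists>y'\<in>?C. dist y' y < \<epsilon>" by blast
    qed
    moreover have "closed ?C"
      by (simp add: compact_imp_closed finite_imp_compact_convex_hull)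
    ultimately show "y \<in> ?C" by simp
  qed (use s0 in simp)
  have "r = s" unfolding r_def inner_radius_def using Ps ub by (intro Greatest_equality) auto
  then show "0 < r" "cball \<theta> r \<inter> ?A \<subseteq> ?C" "r \<le> ?R" using s0 Ps le by auto
qed

text \<open>Otherwise the hull lies in an open halfspace that excludes the point at distance
  \<open>inner_radius \<omega> \<theta>\<close> from \<open>\<theta>\<close> in direction
  \<open>x\<close>. That point is in the affine hull because \<open>x\<close> is in the
  span.\<close>

lemma inner_radius_support:
  fixes \<omega> :: "'k::finite \<Rightarrow> real ^ 'n"
  assumes two: "2 \<le> card (range \<omega>)" and \<theta>: "\<theta> \<in> rel_interior (convex hull (range \<omega>))"
    and x: "x \<in> span (range (\<lambda>i. \<omega> i - \<theta>))"
  shows "\<exists>i. inner_radius \<omega> \<theta> * norm x \<le> (\<omega> i - \<theta>) \<bullet> x"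
proof (rule ccontr)
  let ?r = "inner_radius \<omega> \<theta>" and ?y = "\<theta> + (inner_radius \<omega> \<theta> / norm x) *\<^sub>R x"
  note r = inner_radius_attained[OF two \<theta>]
  assume "\<nexists>i. ?r * norm x \<le> (\<omega> i - \<theta>) \<bullet> x"
  then have lt: "(\<omega> i - \<theta>) \<bullet> x < ?r * norm x" for i by (auto simp: not_le)
  have x0: "x \<noteq> 0" using lt by auto
  have "\<theta> \<in> convex hull (range \<omega>)" using \<theta> rel_interior_subset by blast
  then have "\<theta> \<in> affine hull (range \<omega>)" using convex_hull_subset_affine_hull by blast
  then have "?y \<in> affine hull (range \<omega>)" by (rule affine_hull_direction[OF _ span_scale[OF x]])
  moreover have "?y \<in> cball \<theta> ?r" using r(1) x0 by (simp add: dist_norm)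
  ultimately have "?y \<in> convex hull (range \<omega>)" using r(2) by blast
  moreover have "convex hull (range \<omega>) \<subseteq> {y. x \<bullet> y < ?r * norm x + x \<bullet> \<theta>}"
    using lt by (intro hull_minimal convex_halfspace_lt) (auto simp: inner_diff_left inner_diff_right inner_commute algebra_simps)
  ultimately have "x \<bullet> ?y < ?r * norm x + x \<bullet> \<theta>" by blast
  moreover have "x \<bullet> ?y = x \<bullet> \<theta> + ?r * norm x"
    using x0 by (simp add: inner_add_right dot_square_norm power2_eq_square)
  ultimately show False by simp
qed

section \<open>The domain of the optimisation problem\<close>

text \<open>The number \<open>k\<close> of points is a parameter because an abbreviation for \<open>real CARD('k)\<close> would take
  an argument of type \<open>'k itself\<close>.\<close>

locale ipm_instance =
  fixes \<omega> :: "'k::finite \<Rightarrow> real ^ 'n" and \<theta> :: "real ^ 'n" and q :: "real ^ 'k" and k :: real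
  assumes two_points: "2 \<le> card (range \<omega>)"
    and q_pos: "0 < q $ i"
    and relint: "\<theta> \<in> rel_interior (convex hull (range \<omega>))"
    and card_eq [simp]: "real CARD('k) = k"
begin

abbreviation "t_max \<equiv> ln (5 * k * one_norm q)"

end

text \<open>The two Boolean indices stand for the bounds on the sum of \<open>z\<close> and on
  \<open>t\<close>. Definiteness holds because an \<open>x\<close> in the span orthogonal to all
  generators vanishes.\<close>

sublocale ipm_instance \<subseteq> log_exp_barrier "ipm_space \<omega> \<theta>"
  "\<lambda>i. (0, axis i 1, 0)" "\<lambda>i. (\<omega> i - \<theta>, 0, - 1)" "\<lambda>i. ln (q $ i)"
  "\<lambda>j::bool. if j then (0, (\<chi> i. 1), 0) else (0, 0, 1)" "\<lambda>j. if j then 1 else t_max"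
proof
  show "subspace (ipm_space \<omega> \<theta>)"
    unfolding ipm_space_def by (intro subspace_Times subspace_span subspace_UNIV)
  fix v :: "(real ^ 'n) \<times> (real ^ 'k) \<times> real"
  obtain x z t where v: "v = (x, z, t)" by (cases v)
  assume "v \<in> ipm_space \<omega> \<theta>"
  then have x: "x \<in> span (range (\<lambda>i. \<omega> i - \<theta>))" by (simp add: v ipm_space_def)
  assume m: "\<And>i. (0, axis i 1, 0) \<bullet> v = 0" and l: "\<And>i. (\<omega> i - \<theta>, 0, - 1) \<bullet> v = 0"
    and d: "\<And>j. (if j then (0, (\<chi> i. 1), 0) else (0, 0, 1)) \<bullet> v = 0"
  have z: "z = 0" using m by (simp add: v vec_eq_iff inner_axis')
  have t: "t = 0" using d[of False] by (simp add: v)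
  have "orthogonal x (\<omega> i - \<theta>)" for i
    using l[of i] by (simp add: v t orthogonal_def inner_commute)
  then have "orthogonal x x" using x by (intro orthogonal_to_span[OF x]) auto
  then show "v = 0" by (simp add: v z t orthogonal_self zero_prod_def)
qed

context ipm_instance
begin

lemma slack_eq: "slack i (x, z, t) = ln (z $ i) - (\<omega> i - \<theta>) \<bullet> x + t - ln (q $ i)"
  by (simp add: slack_def inner_axis')

lemma lslack_eq: "lslack True (x, z, t) = 1 - (\<Sum>i\<in>UNIV. z $ i)" "lslack False (x, z, t) = t_max - t"
  by (simp_all add: lslack_def inner_vec_def)

text \<open>Equality holds as functions, also where logarithms take default values, so gradients and
  Hessians can be rewritten without domain conditions.\<close>

lemma F_eq: "F = barrier \<omega> q \<theta>"
proof
  fix p :: "(real ^ 'n) \<times> (real ^ 'k) \<times> real"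
  obtain x z t where p: "p = (x, z, t)" by (cases p)
  show "F p = barrier \<omega> q \<theta> p"
    unfolding F_def p by (simp add: slack_eq lslack_eq UNIV_bool barrier_def inner_axis' sum_subtractf sum_negf)
qed

lemma strictly_feasible_iff:
  "(x, z, t) \<in> strictly_feasible \<longleftrightarrow>
    (\<forall>i. 0 < z $ i \<and> 0 < ln (z $ i) - (\<omega> i - \<theta>) \<bullet> x + t - ln (q $ i)) \<and>
    (\<Sum>i\<in>UNIV. z $ i) < 1 \<and> t < t_max"
  by (auto simp: strictly_feasible_def slack_eq lslack_eq inner_axis' all_bool_eq)

lemma feasible_iff:
  "(x, z, t) \<in> feasible \<longleftrightarrow>
    (\<forall>i. 0 < z $ i \<and> 0 \<le> ln (z $ i) - (\<omega> i - \<theta>) \<bullet> x + t - ln (q $ i)) \<and>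
    (\<Sum>i\<in>UNIV. z $ i) \<le> 1 \<and> t \<le> t_max"
  by (auto simp: feasible_def slack_eq lslack_eq inner_axis' all_bool_eq)

lemma exp_le_of_slack:
  assumes "0 < z $ i" "0 \<le> ln (z $ i) - (\<omega> i - \<theta>) \<bullet> x + t - ln (q $ i)"
  shows "q $ i * exp ((\<omega> i - \<theta>) \<bullet> x) \<le> z $ i * exp t"
proof -
  have "ln (q $ i) + (\<omega> i - \<theta>) \<bullet> x \<le> ln (z $ i) + t" using assms(2) by simp
  then have "exp (ln (q $ i) + (\<omega> i - \<theta>) \<bullet> x) \<le> exp (ln (z $ i) + t)" by simp
  then show ?thesis using assms(1) q_pos[of i] by (simp add: exp_add)
qed

text \<open>Iterates are followed in \<open>strictly_feasible\<close>, which is open in the ambient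
  space; this passes to the relative interior named in the run predicate.\<close>

lemma strictly_feasible_in_interior:
  assumes "p \<in> strictly_feasible" "p \<in> ipm_space \<omega> \<theta>"
  shows "p \<in> ipm_interior \<omega> q \<theta>"
proof -
  let ?T = "strictly_feasible \<inter> ipm_space \<omega> \<theta>"
  have "openin (top_of_set (ipm_space \<omega> \<theta>)) ?T"
    using open_strictly_feasible openin_open_Int[of strictly_feasible "ipm_space \<omega> \<theta>"]
    by (simp add: Int_commute)
  moreover have "?T \<subseteq> ipm_domain \<omega> q \<theta>"
  proof
    fix p assume p: "p \<in> ?T"
    obtain x z t where eq: "p = (x, z, t)" by (cases p)
    show "p \<in> ipm_domain \<omega> q \<theta>"
      using p exp_le_of_slack[of z _ x t]
      by (auto simp: eq strictly_feasible_iff ipm_domain_def less_imp_le)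
  qed
  ultimately have "?T \<subseteq> ipm_interior \<omega> q \<theta>"
    unfolding ipm_interior_def using interior_of_maximal by metis
  then show ?thesis using assms by blast
qed

abbreviation "q_min \<equiv> (MIN i\<in>UNIV. q $ i)"
abbreviation "L \<equiv> ln (5 * k * weight_ratio q)"
abbreviation "\<rho> \<equiv> outer_radius \<omega> \<theta> / inner_radius \<omega> \<theta>"

section \<open>Condition measures and bounds on the feasible set\<close>

lemma k_ge: "2 \<le> k"
proof -
  have "card (range \<omega>) \<le> CARD('k)" by (rule card_image_le) simp
  then show ?thesis using two_points card_eq by linarith
qed

lemma q_min: "0 < q_min" "q_min \<le> q $ i"
  by (auto simp: q_pos Min_gr_iff)

lemma one_norm_q: "one_norm q = (\<Sum>i\<in>UNIV. q $ i)"
  using q_pos by (simp add: one_norm_def less_imp_le)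

lemma q_le_one_norm: "q $ i \<le> one_norm q"
  unfolding one_norm_q by (rule member_le_sum) (auto simp: q_pos less_imp_le)

lemma one_norm_pos: "0 < one_norm q"
  using q_le_one_norm q_pos less_le_trans by blast

lemma weight_ratio_ge: "k \<le> weight_ratio q"
proof -
  have "k * q_min = (\<Sum>i\<in>(UNIV::'k set). q_min)" by simp
  also have "\<dots> \<le> one_norm q" unfolding one_norm_q by (rule sum_mono) (rule q_min(2))
  finally show ?thesis using q_min(1) by (simp add: weight_ratio_def field_simps)
qed

lemma L_eq: "L = t_max - ln q_min"
proof -
  have "5 * k * weight_ratio q = 5 * k * one_norm q / q_min" by (simp add: weight_ratio_def)
  moreover have "ln (5 * k * one_norm q / q_min) = t_max - ln q_min"
    by (rule ln_divide_pos) (use one_norm_pos k_ge q_min(1) in simp_all)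
  ultimately show ?thesis by (simp only:)
qed

lemma L_ge: "1 \<le> L"
proof -
  have "exp 1 \<le> (3::real)" by (rule exp_le)
  also have "3 \<le> 5 * k * weight_ratio q" using mult_mono[of 2 k 2 "weight_ratio q"] k_ge weight_ratio_ge by simp
  finally have "ln (exp 1) \<le> L" using k_ge weight_ratio_ge by (intro ln_mono) (auto simp: zero_less_mult_iff)
  then show ?thesis by simp
qed

lemmas inner_radius = inner_radius_attained[OF two_points relint]

lemma ratio_ge: "1 \<le> \<rho>"
  using inner_radius(1,3) by simp

text \<open>Since \<open>z $ i \<le> 1\<close>, the constraints give
  \<open>(\<omega> i - \<theta>) \<bullet> x \<le> t - ln q_min\<close>. The support estimate for
  one index makes the right side nonnegative and, with the cap on \<open>t\<close>, bounds the norm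
  of \<open>x\<close> by \<open>L / inner_radius \<omega> \<theta>\<close>; Cauchy-Schwarz with the
  outer radius gives the lower bound.\<close>

lemma feasible_bounds:
  assumes p: "(x, z, t) \<in> feasible" "(x, z, t) \<in> ipm_space \<omega> \<theta>"
  shows "z $ i \<le> 1" "- (L * \<rho>) \<le> (\<omega> i - \<theta>) \<bullet> x" "ln q_min \<le> t"
proof -
  have z1: "z $ i \<le> 1" for i
  proof -
    have "z $ i \<le> (\<Sum>i\<in>UNIV. z $ i)"
      by (rule member_le_sum) (use p in \<open>auto simp: feasible_iff less_imp_le\<close>)
    then show ?thesis using p by (simp add: feasible_iff)
  qed
  show "z $ i \<le> 1" by (rule z1)
  have le: "(\<omega> i - \<theta>) \<bullet> x \<le> t - ln (q $ i)" for i
  proof -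
    have "ln (z $ i) \<le> 0" using z1[of i] p by (simp add: feasible_iff)
    moreover have "0 \<le> ln (z $ i) - (\<omega> i - \<theta>) \<bullet> x + t - ln (q $ i)" using p(1) by (simp add: feasible_iff)
    ultimately show ?thesis by linarith
  qed
  have lnq: "ln q_min \<le> ln (q $ i)" for i using q_min by (intro ln_mono) auto
  have x: "x \<in> span (range (\<lambda>i. \<omega> i - \<theta>))" using p(2) by (simp add: ipm_space_def)
  obtain j where j: "inner_radius \<omega> \<theta> * norm x \<le> (\<omega> j - \<theta>) \<bullet> x"
    using inner_radius_support[OF two_points relint x] by blast
  have "0 \<le> inner_radius \<omega> \<theta> * norm x" using inner_radius(1) by simp
  then show "ln q_min \<le> t" using j le[of j] lnq[of j] by linarith
  have "inner_radius \<omega> \<theta> * norm x \<le> L"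
    using j le[of j] lnq[of j] p(1) unfolding L_eq by (simp add: feasible_iff)
  then have nx: "norm x \<le> L / inner_radius \<omega> \<theta>" using inner_radius(1) by (simp add: field_simps)
  have "- ((\<omega> i - \<theta>) \<bullet> x) \<le> norm (\<omega> i - \<theta>) * norm x"
    using norm_cauchy_schwarz[of "- (\<omega> i - \<theta>)" x] by (metis inner_minus_left norm_minus_cancel)
  also have "\<dots> \<le> outer_radius \<omega> \<theta> * (L / inner_radius \<omega> \<theta>)"
  proof (intro mult_mono nx)
    show "norm (\<omega> i - \<theta>) \<le> outer_radius \<omega> \<theta>" by (simp add: outer_radius_def)
    show "0 \<le> outer_radius \<omega> \<theta>" using inner_radius(1,3) by simp
  qed simp
  finally show "- (L * \<rho>) \<le> (\<omega> i - \<theta>) \<bullet> x" by (simp add: mult.commute)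
qed

section \<open>The starting point\<close>

abbreviation "p\<^sub>0 \<equiv> start_pt q :: ('n, 'k) ipm_pt"

lemma start_slack: "1/2 \<le> slack i p\<^sub>0"
proof -
  have "slack i p\<^sub>0 = ln (1 / (2 * k)) + ln (4 * k * one_norm q) - ln (q $ i)"
    by (simp add: start_pt_def slack_eq)
  also have "\<dots> = ln ((1 / (2 * k)) * (4 * k * one_norm q)) - ln (q $ i)"
    using k_ge one_norm_pos by (subst ln_mult_pos) simp_all
  also have "(1 / (2 * k)) * (4 * k * one_norm q) = 2 * one_norm q"
    using k_ge by simp
  also have "ln (2 * one_norm q) - ln (q $ i) = ln (2 * one_norm q / q $ i)"
    using one_norm_pos q_pos[of i] by (simp add: ln_divide_pos)
  finally have eq: "slack i p\<^sub>0 = ln (2 * one_norm q / q $ i)" .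
  have "1/2 \<le> ln (2::real)" using ln_le_minus_one[of "1/2 :: real"] by (simp add: ln_div)
  also have "\<dots> \<le> ln (2 * one_norm q / q $ i)"
    using q_le_one_norm[of i] q_pos[of i] by (intro ln_mono) (auto simp: field_simps)
  finally show "1/2 \<le> slack i p\<^sub>0" unfolding eq .
qed

lemma start_height: "1/5 \<le> t_max - ln (4 * k * one_norm q)" "t_max - ln (4 * k * one_norm q) \<le> 1"
proof -
  have "t_max - ln (4 * k * one_norm q) = ln ((5 * k * one_norm q) / (4 * k * one_norm q))"
    using k_ge one_norm_pos by (subst ln_divide_pos) simp_all
  also have "(5 * k * one_norm q) / (4 * k * one_norm q) = 1 + 1/4"
    using k_ge one_norm_pos by simp
  finally have eq: "t_max - ln (4 * k * one_norm q) = ln (1 + 1/4)" .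
  have "ln (4/5 :: real) \<le> 4/5 - 1" by (rule ln_le_minus_one) simp
  moreover have "ln (4/5 :: real) = - ln (1 + 1/4)" using ln_inverse[of "5/4::real"] by simp
  ultimately show "1/5 \<le> t_max - ln (4 * k * one_norm q)" unfolding eq by linarith
  show "t_max - ln (4 * k * one_norm q) \<le> 1" unfolding eq using ln_add_one_self_le_self2[of "1/4"] by simp
qed

lemma start_strictly_feasible: "p\<^sub>0 \<in> strictly_feasible" "p\<^sub>0 \<in> ipm_space \<omega> \<theta>"
proof -
  have "0 < slack i p\<^sub>0" for i using start_slack[of i] by linarith
  moreover have "(\<Sum>i\<in>(UNIV::'k set). 1 / (2 * k)) < 1" using k_ge by simp
  ultimately show "p\<^sub>0 \<in> strictly_feasible"
    using start_height(1) k_ge unfolding start_pt_def strictly_feasible_iff slack_eq by auto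
  show "p\<^sub>0 \<in> ipm_space \<omega> \<theta>" by (simp add: start_pt_def ipm_space_def span_zero)
qed

lemma param_eq: "param = 2 * k + 2" "param = bparam TYPE('k)"
  by (simp_all add: param_def bparam_def)

text \<open>Half of a width estimate; the other half is \<open>G1_gap\<close>. Slacks of at least
  1/2 give \<open>6 * k + 2 * (L * \<rho>)\<close> per block, the height of at least 1/5 below the
  cap gives \<open>5 * L\<close>, and the constraint on the sum gives 1.\<close>

lemma start_gradient_lower:
  assumes y: "y \<in> feasible" "y \<in> ipm_space \<omega> \<theta>"
  shows "- (6 * k\<^sup>2 + 2 * k * (L * \<rho>) + 5 * L + 1) \<le> G1 p\<^sub>0 (y - p\<^sub>0)"
proof -
  obtain x z t where yeq: "y = (x, z, t)" by (cases y)
  note bnd = feasible_bounds[OF y[unfolded yeq]]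
  let ?t = "ln (4 * k * one_norm q)"
  have v: "y - p\<^sub>0 = (x, z - (\<chi> i. 1 / (2 * k)), t - ?t)" by (simp add: yeq start_pt_def)
  have ra: "ra i p\<^sub>0 (y - p\<^sub>0) = 2 * k * z $ i - 1" for i
    using k_ge unfolding ra_def v by (simp add: start_pt_def inner_axis' field_simps)
  have blk: "ra i p\<^sub>0 (y - p\<^sub>0) + re i p\<^sub>0 (y - p\<^sub>0) \<le> 6 * k + 2 * (L * \<rho>)" for i
  proof -
    have a: "ra i p\<^sub>0 (y - p\<^sub>0) \<le> 2 * k - 1" unfolding ra using bnd(1)[of i] k_ge by simp
    have "re i p\<^sub>0 (y - p\<^sub>0) = (ra i p\<^sub>0 (y - p\<^sub>0) - (\<omega> i - \<theta>) \<bullet> x + (t - ?t)) / slack i p\<^sub>0"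
      unfolding re_def v by simp
    also have "\<dots> \<le> (2 * k + L * \<rho>) / slack i p\<^sub>0"
    proof (rule divide_right_mono)
      have "t \<le> t_max" using y(1) by (simp add: yeq feasible_iff)
      then show "ra i p\<^sub>0 (y - p\<^sub>0) - (\<omega> i - \<theta>) \<bullet> x + (t - ?t) \<le> 2 * k + L * \<rho>"
        using a bnd(2)[of i] start_height(2) by linarith
    qed (use start_slack[of i] in linarith)
    also have "\<dots> \<le> (2 * k + L * \<rho>) / (1/2)"
    proof (rule divide_left_mono[OF start_slack])
      have "0 \<le> L * \<rho>" by (rule mult_nonneg_nonneg) (use L_ge ratio_ge in linarith)+
      then show "0 \<le> 2 * k + L * \<rho>" using k_ge by linarith
      show "0 < slack i p\<^sub>0 * (1/2)" using start_slack[of i] by linarith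
    qed
    also have "\<dots> = 4 * k + 2 * (L * \<rho>)" by (simp only: div_by_1 divide_divide_eq_right) simp
    finally show ?thesis using a by linarith
  qed
  have "(\<Sum>i\<in>(UNIV::'k set). ra i p\<^sub>0 (y - p\<^sub>0) + re i p\<^sub>0 (y - p\<^sub>0)) \<le> (\<Sum>i\<in>(UNIV::'k set). 6 * k + 2 * (L * \<rho>))"
    by (rule sum_mono) (rule blk)
  then have 1: "- (\<Sum>i\<in>(UNIV::'k set). - ra i p\<^sub>0 (y - p\<^sub>0) - re i p\<^sub>0 (y - p\<^sub>0)) \<le> 6 * k\<^sup>2 + 2 * k * (L * \<rho>)"
    by (simp add: sum.distrib sum_subtractf sum_negf power2_eq_square algebra_simps del: times_divide_eq_left times_divide_eq_right)
  have "(\<Sum>i\<in>(UNIV::'k set). z $ i) \<ge> 0" using y(1) by (intro sum_nonneg) (auto simp: yeq feasible_iff less_imp_le)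
  then have 2: "- 1 \<le> rs True p\<^sub>0 (y - p\<^sub>0)"
    unfolding rs_def v using k_ge by (simp add: start_pt_def lslack_eq inner_vec_def sum_subtractf)
  have 3: "- (5 * L) \<le> rs False p\<^sub>0 (y - p\<^sub>0)"
  proof -
    let ?h = "t_max - ?t"
    have "rs False p\<^sub>0 (y - p\<^sub>0) = (t - ?t) / ?h"
      unfolding rs_def v by (simp add: start_pt_def lslack_eq)
    moreover have "- L \<le> t - ?t" using bnd(3) start_height(1) unfolding L_eq by linarith
    then have "(- L) / ?h \<le> (t - ?t) / ?h" using start_height(1) by (intro divide_right_mono) auto
    moreover have "L / ?h \<le> L / (1/5)" using start_height(1) L_ge by (intro divide_left_mono) auto
    ultimately show ?thesis by simp
  qed
  show ?thesis unfolding G1_def UNIV_bool using 1 2 3 by simp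
qed

end

section \<open>The two stages of the algorithm\<close>

lemma nat_ceiling_le: "0 \<le> (Y::real) \<Longrightarrow> real (nat \<lceil>Y\<rceil>) \<le> Y + 1"
  using of_int_ceiling_le_add_one[of Y] by (simp add: of_nat_nat ceiling_mono)

context ipm_instance
begin

abbreviation "g\<^sub>0 \<equiv> grad_on (ipm_space \<omega> \<theta>) F p\<^sub>0"

lemma param_pos [simp]: "0 < param" "0 \<le> param"
  using k_ge by (simp_all add: param_eq(1))

lemma sqrt_param_bounds: "2 \<le> sqrt param" "sqrt param \<le> 7/4 * sqrt k"
proof -
  show "2 \<le> sqrt param" using k_ge by (intro real_le_rsqrt) (simp add: param_eq(1))
  \<comment> \<open>For \<open>k \<ge> 2\<close> the parameter is at most \<open>3 * k\<close>, and
    49/16 exceeds 3.\<close>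
  have "sqrt param \<le> sqrt ((7/4)\<^sup>2 * k)" using k_ge by (intro real_sqrt_le_mono) (simp add: param_eq(1) power_divide)
  then show "sqrt param \<le> 7/4 * sqrt k" by (simp add: real_sqrt_mult)
qed

lemma barrier_simps:
  "bgrad \<omega> q \<theta> = grad_on (ipm_space \<omega> \<theta>) F"
  "bhess_inv \<omega> q \<theta> = hess_inv_on (ipm_space \<omega> \<theta>) F"
  "bnorm \<omega> q \<theta> = local_norm (ipm_space \<omega> \<theta>) F"
  by (simp_all add: bgrad_def bhess_inv_def bnorm_def F_eq)

lemma g0_mem: "g\<^sub>0 \<in> ipm_space \<omega> \<theta>"
  by (rule grad_on_inner(1)[OF start_strictly_feasible])

lemma cvec_mem: "cvec \<in> ipm_space \<omega> \<theta>"
  by (simp add: cvec_def ipm_space_def span_zero)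

text \<open>Lets both stages be measured by the same quantity, hence by one logarithm.\<close>

lemma instance_product_ge: "k * L \<le> k\<^sup>2 * L\<^sup>2 * \<rho>"
proof -
  have kL: "1 \<le> k * L" using mult_mono[of 1 k 1 L] k_ge L_ge by linarith
  then have p: "1 \<le> k * L * \<rho>" using mult_mono[of 1 "k * L" 1 \<rho>] ratio_ge by linarith
  have "k * L * 1 \<le> k * L * (k * L * \<rho>)" by (rule mult_left_mono[OF p]) (use kL in linarith)
  then show ?thesis by (simp only: power2_eq_square ac_simps mult_1)
qed

text \<open>The constant 20 is the factor 2 of \<open>dual_norm_le_width\<close> times a bound 10
  for the collected width terms, all dominated by the product on the right.\<close>

lemma dual_norm_start_grad:
  assumes p: "p \<in> strictly_feasible" "p \<in> ipm_space \<omega> \<theta>"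
  shows "dual_norm p g\<^sub>0 \<le> 20 * (k\<^sup>2 * L\<^sup>2 * \<rho>)"
proof -
  let ?M = "6 * k\<^sup>2 + 2 * k * (L * \<rho>) + 5 * L + 1"
  have "dual_norm p g\<^sub>0 \<le> 2 * (param + ?M)"
  proof (rule dual_norm_le_width[OF p g0_mem])
    fix y y' assume y: "y \<in> strictly_feasible" "y \<in> ipm_space \<omega> \<theta>"
      and y': "y' \<in> strictly_feasible" "y' \<in> ipm_space \<omega> \<theta>"
    have mem: "v - p\<^sub>0 \<in> ipm_space \<omega> \<theta>" if "v \<in> ipm_space \<omega> \<theta>" for v
      by (rule subspace_diff[OF subE that start_strictly_feasible(2)])
    have feas: "y \<in> feasible" "y' \<in> feasible" using y y' strictly_feasible_subset by auto
    have "g\<^sub>0 \<bullet> (y - y') = g\<^sub>0 \<bullet> (y - p\<^sub>0) - g\<^sub>0 \<bullet> (y' - p\<^sub>0)" by (simp add: inner_diff_right)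
    also have "\<dots> = G1 p\<^sub>0 (y - p\<^sub>0) - G1 p\<^sub>0 (y' - p\<^sub>0)"
      by (simp only: grad_on_inner(2)[OF start_strictly_feasible mem] y(2) y'(2))
    also have "\<dots> \<le> param + ?M"
      using G1_gap[OF start_strictly_feasible(1) feas(1)] start_gradient_lower[OF feas(2) y'(2)] by fastforce
    finally show "g\<^sub>0 \<bullet> (y - y') \<le> param + ?M" .
  qed
  also have "\<dots> \<le> 2 * (10 * (k\<^sup>2 * L\<^sup>2 * \<rho>))"
  proof (rule mult_left_mono)
    let ?Z = "k\<^sup>2 * L\<^sup>2 * \<rho>"
    have L2: "L \<le> L\<^sup>2" using mult_mono[of 1 L L L] L_ge by (simp add: power2_eq_square)
    have LLr: "L\<^sup>2 \<le> L\<^sup>2 * \<rho>" using mult_left_mono[OF ratio_ge, of "L\<^sup>2"] by simp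
    have Lr: "L * \<rho> \<le> L\<^sup>2 * \<rho>" by (rule mult_right_mono[OF L2]) (use ratio_ge in linarith)
    have Lr0: "0 \<le> L * \<rho>" by (rule mult_nonneg_nonneg) (use L_ge ratio_ge in linarith)+
    have LLr1: "1 \<le> L\<^sup>2 * \<rho>" using L2 LLr L_ge by linarith
    have k1: "1 \<le> k\<^sup>2" "2 * k \<le> k\<^sup>2" "4 \<le> k\<^sup>2"
      using mult_mono[of 2 k 2 k] mult_right_mono[of 2 k k] k_ge by (simp_all add: power2_eq_square)
    have 1: "k\<^sup>2 \<le> ?Z" using mult_left_mono[OF LLr1, of "k\<^sup>2"] by (simp add: mult.assoc)
    have 2: "2 * k * (L * \<rho>) \<le> ?Z"
      using mult_mono[OF k1(2) Lr zero_le_power2 Lr0] by (simp only: mult.assoc)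
    have "4 * L \<le> k\<^sup>2 * (L\<^sup>2 * \<rho>)"
      using mult_mono[OF k1(3), of L "L\<^sup>2 * \<rho>"] L2 LLr L_ge by simp
    then have 3: "4 * L \<le> ?Z" by (simp only: mult.assoc)
    show "param + ?M \<le> 10 * ?Z"
      unfolding param_eq(1) using 1 2 3 k1 k_ge L_ge by linarith
  qed simp
  finally show ?thesis by simp
qed

lemma dual_norm_cvec:
  assumes p: "p \<in> strictly_feasible" "p \<in> ipm_space \<omega> \<theta>"
  shows "dual_norm p cvec \<le> 2 * L" "0 < dual_norm p cvec"
proof -
  show "dual_norm p cvec \<le> 2 * L"
  proof (rule dual_norm_le_width[OF p cvec_mem])
    fix y y' assume y: "y \<in> strictly_feasible" "y \<in> ipm_space \<omega> \<theta>"
      and y': "y' \<in> strictly_feasible" "y' \<in> ipm_space \<omega> \<theta>"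
    obtain x z t where yeq: "y = (x, z, t)" by (cases y)
    obtain x' z' t' where yeq': "y' = (x', z', t')" by (cases y')
    have "t < t_max" using y(1) by (simp add: yeq strictly_feasible_iff)
    moreover have "ln q_min \<le> t'"
      by (rule feasible_bounds(3)[of x' z' t']) (use y' strictly_feasible_subset yeq' in auto)
    ultimately show "cvec \<bullet> (y - y') \<le> L"
      unfolding L_eq yeq yeq' by (simp add: cvec_def inner_diff_right)
  qed
  show "0 < dual_norm p cvec"
    by (rule dual_norm_pos[OF p cvec_mem]) (simp add: cvec_def zero_prod_def)
qed

section \<open>Preliminary stage\<close>

abbreviation "pp \<equiv> prelim_pt \<omega> q \<theta>"

lemma prelim_invariant:
  "pp i \<in> strictly_feasible \<and> pp i \<in> ipm_space \<omega> \<theta> \<and>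
    dual_norm (pp i) (- (prelim_mu TYPE('k) i *\<^sub>R g\<^sub>0) + grad_on (ipm_space \<omega> \<theta>) F (pp i)) \<le> 1/9"
proof (induction i)
  case 0
  \<comment> \<open>For \<open>\<mu> = 1\<close> the residual at the starting point is zero.\<close>
  have "dual_norm p\<^sub>0 0 \<le> 1/9"
    by (rule dual_norm_le[OF start_strictly_feasible])
      (use subspace_0[OF subE] D2_nonneg[OF start_strictly_feasible(1)] in auto)
  then show ?case using start_strictly_feasible by simp
next
  case (Suc i)
  let ?w = "- (prelim_mu TYPE('k) i *\<^sub>R g\<^sub>0)" and ?h = "1 - 1 / (8 * sqrt param)"
  have w: "?w \<in> ipm_space \<omega> \<theta>" by (rule subspace_neg[OF subE subspace_scale[OF subE g0_mem]])
  have sc: "?h *\<^sub>R ?w = - (prelim_mu TYPE('k) (Suc i) *\<^sub>R g\<^sub>0)" by (simp add: param_eq(2))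
  have h: "\<bar>?h - 1\<bar> \<le> 1 / (8 * sqrt param)" using sqrt_param_bounds(1) by simp
  have pS: "pp (Suc i) = pp i - hess_inv_on (ipm_space \<omega> \<theta>) F (pp i) (?h *\<^sub>R ?w + grad_on (ipm_space \<omega> \<theta>) F (pp i))"
    unfolding sc by (simp add: barrier_simps)
  show ?case
    using newton_path_step[OF _ _ w _ h pS] Suc.IH unfolding sc by blast
qed

lemma prelim_mu_nonneg: "0 \<le> prelim_mu TYPE('k) i"
proof (induction i)
  case (Suc i)
  have "1 / (8 * sqrt param) \<le> 1" using sqrt_param_bounds(1) by (simp add: divide_le_eq)
  then have "0 \<le> (1 - 1 / (8 * sqrt param)) * prelim_mu TYPE('k) i"
    by (intro mult_nonneg_nonneg Suc) linarith
  then show ?case by (simp only: param_eq(2) prelim_mu.simps)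
qed simp

lemma prelim_mu_le: "prelim_mu TYPE('k) i \<le> exp (- (real i / (8 * sqrt param)))"
proof (induction i)
  case (Suc i)
  have "prelim_mu TYPE('k) (Suc i) = (1 - 1 / (8 * sqrt param)) * prelim_mu TYPE('k) i" by (simp add: param_eq(2))
  also have "\<dots> \<le> exp (- (1 / (8 * sqrt param))) * exp (- (real i / (8 * sqrt param)))"
    using exp_ge_add_one_self[of "- (1 / (8 * sqrt param))"] Suc prelim_mu_nonneg by (intro mult_mono) auto
  also have "\<dots> = exp (- (real (Suc i) / (8 * sqrt param)))" by (simp add: exp_add[symmetric] add_divide_distrib)
  finally show ?case .
qed simp

text \<open>Removing the remaining linear term costs at most 1/18, and 1/9 + 1/18 = 1/6 is the
  threshold of the loop; 360 is 18 * 20.\<close>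

lemma prelim_stops:
  assumes "prelim_mu TYPE('k) i * (360 * (k\<^sup>2 * L\<^sup>2 * \<rho>)) \<le> 1"
  shows "\<not> prelim_continue \<omega> q \<theta> i"
proof -
  let ?g = "grad_on (ipm_space \<omega> \<theta>) F (pp i)" and ?w = "- (prelim_mu TYPE('k) i *\<^sub>R g\<^sub>0) + grad_on (ipm_space \<omega> \<theta>) F (pp i)"
  have p: "pp i \<in> strictly_feasible" "pp i \<in> ipm_space \<omega> \<theta>" and n: "dual_norm (pp i) ?w \<le> 1/9"
    using prelim_invariant by auto
  have w: "?w \<in> ipm_space \<omega> \<theta>"
    by (intro subspace_add[OF subE] subspace_neg[OF subE] subspace_scale[OF subE] g0_mem grad_on_inner(1)[OF p])
  have "dual_norm (pp i) (?w + prelim_mu TYPE('k) i *\<^sub>R g\<^sub>0) \<le> dual_norm (pp i) ?w + \<bar>prelim_mu TYPE('k) i\<bar> * dual_norm (pp i) g\<^sub>0"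
    by (rule dual_norm_add_scaled[OF p w g0_mem])
  also have "\<bar>prelim_mu TYPE('k) i\<bar> * dual_norm (pp i) g\<^sub>0 \<le> prelim_mu TYPE('k) i * (20 * (k\<^sup>2 * L\<^sup>2 * \<rho>))"
    using dual_norm_start_grad[OF p] prelim_mu_nonneg[of i] by (simp only: abs_of_nonneg mult_left_mono)
  also have "\<dots> = prelim_mu TYPE('k) i * (360 * (k\<^sup>2 * L\<^sup>2 * \<rho>)) / 18" by simp
  also have "\<dots> \<le> 1/18" by (rule divide_right_mono[OF assms]) simp
  finally have "dual_norm (pp i) ?g \<le> 1/6" using n by simp
  then show ?thesis by (simp add: prelim_continue_def barrier_simps Let_def)
qed

abbreviation "pf \<equiv> prelim_final \<omega> q \<theta>"
abbreviation "\<eta> \<equiv> main_eta \<omega> q \<theta>"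
abbreviation "mp \<equiv> main_pt \<omega> q \<theta>"

lemma prelim_steps_bound:
  assumes A: "360 * (k\<^sup>2 * L\<^sup>2 * \<rho>) \<le> A" "1 \<le> A"
  shows "\<exists>i. \<not> prelim_continue \<omega> q \<theta> i" "real (prelim_steps \<omega> q \<theta>) \<le> 8 * sqrt param * ln A + 1"
proof -
  define i where "i = nat \<lceil>8 * sqrt param * ln A\<rceil>"
  have "8 * sqrt param * ln A \<le> real i" unfolding i_def by (rule real_nat_ceiling_ge)
  then have "ln A \<le> real i / (8 * sqrt param)" using sqrt_param_bounds(1) by (simp add: pos_le_divide_eq mult.commute)
  then have "exp (- (real i / (8 * sqrt param))) \<le> exp (- ln A)" by simp
  also have "\<dots> = 1 / A" using A(2) by (simp add: exp_minus inverse_eq_divide)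
  finally have mu: "prelim_mu TYPE('k) i \<le> 1 / A" using prelim_mu_le[of i] by linarith
  have "prelim_mu TYPE('k) i * (360 * (k\<^sup>2 * L\<^sup>2 * \<rho>)) \<le> prelim_mu TYPE('k) i * A" by (rule mult_left_mono[OF A(1) prelim_mu_nonneg])
  also have "\<dots> \<le> 1 / A * A" by (rule mult_right_mono[OF mu]) (use A(2) in linarith)
  also have "\<dots> = 1" using A(2) by simp
  finally have stop: "\<not> prelim_continue \<omega> q \<theta> i" by (rule prelim_stops)
  then show "\<exists>i. \<not> prelim_continue \<omega> q \<theta> i" by blast
  have "prelim_steps \<omega> q \<theta> \<le> i" unfolding prelim_steps_def by (rule Least_le) (rule stop)
  then have "real (prelim_steps \<omega> q \<theta>) \<le> real i" by simp
  also have "\<dots> \<le> 8 * sqrt param * ln A + 1" unfolding i_def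
    by (rule nat_ceiling_le) (use sqrt_param_bounds(1) A(2) in simp)
  finally show "real (prelim_steps \<omega> q \<theta>) \<le> 8 * sqrt param * ln A + 1" .
qed

section \<open>Main stage\<close>

lemma prelim_final:
  assumes "\<exists>i. \<not> prelim_continue \<omega> q \<theta> i"
  shows "pf \<in> strictly_feasible" "pf \<in> ipm_space \<omega> \<theta>"
    "dual_norm pf (grad_on (ipm_space \<omega> \<theta>) F pf) \<le> 1/6"
proof -
  show "pf \<in> strictly_feasible" "pf \<in> ipm_space \<omega> \<theta>"
    using prelim_invariant[of "prelim_steps \<omega> q \<theta>"] by (auto simp: prelim_final_def)
  have "\<not> prelim_continue \<omega> q \<theta> (prelim_steps \<omega> q \<theta>)"
    unfolding prelim_steps_def using assms by (rule LeastI_ex)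
  then show "dual_norm pf (grad_on (ipm_space \<omega> \<theta>) F pf) \<le> 1/6"
    by (simp add: prelim_continue_def prelim_final_def barrier_simps Let_def)
qed

lemma main_eta_0:
  assumes "\<exists>i. \<not> prelim_continue \<omega> q \<theta> i"
  shows "0 < \<eta> 0" "\<eta> 0 * dual_norm pf cvec = 1/12" "1 / \<eta> 0 \<le> 24 * L"
  using dual_norm_cvec[OF prelim_final(1,2)[OF assms]]
  by (simp_all add: barrier_simps field_simps)

lemma main_invariant:
  assumes stop: "\<exists>i. \<not> prelim_continue \<omega> q \<theta> i"
  shows "mp i \<in> strictly_feasible \<and> mp i \<in> ipm_space \<omega> \<theta> \<and>
    dual_norm (mp i) (\<eta> i *\<^sub>R cvec + grad_on (ipm_space \<omega> \<theta>) F (mp i)) \<le> 1/9"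
proof (induction i)
  case 0
  note pf = prelim_final[OF stop]
  let ?g = "grad_on (ipm_space \<omega> \<theta>) F pf"
  have w: "\<eta> 0 *\<^sub>R cvec \<in> ipm_space \<omega> \<theta>" by (rule subspace_scale[OF subE cvec_mem])
  have "dual_norm pf (?g + \<eta> 0 *\<^sub>R cvec) \<le> dual_norm pf ?g + \<bar>\<eta> 0\<bar> * dual_norm pf cvec"
    by (rule dual_norm_add_scaled[OF pf(1,2) grad_on_inner(1)[OF pf(1,2)] cvec_mem])
  \<comment> \<open>The first \<open>\<eta>\<close> is chosen so that the objective adds 1/12 to the
    1/6 left by the loop, just enough for a centring step.\<close>
  also have "\<dots> \<le> 1/4" using pf(3) main_eta_0[OF stop] by (simp only: abs_of_pos)
  finally have n: "dual_norm pf (\<eta> 0 *\<^sub>R cvec + ?g) \<le> 1/4" by (simp only: add.commute)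
  have "mp 0 = pf - hess_inv_on (ipm_space \<omega> \<theta>) F pf (\<eta> 0 *\<^sub>R cvec + ?g)"
    by (simp only: main_pt.simps barrier_simps)
  from newton_centring_step[OF pf(1,2) w n this] show ?case by blast
next
  case (Suc i)
  let ?w = "\<eta> i *\<^sub>R cvec" and ?h = "1 + 1 / (8 * sqrt param)"
  have w: "?w \<in> ipm_space \<omega> \<theta>" by (rule subspace_scale[OF subE cvec_mem])
  have sc: "?h *\<^sub>R ?w = \<eta> (Suc i) *\<^sub>R cvec" by (simp add: param_eq(2))
  have h: "\<bar>?h - 1\<bar> \<le> 1 / (8 * sqrt param)" using sqrt_param_bounds(1) by simp
  have "mp (Suc i) = mp i - hess_inv_on (ipm_space \<omega> \<theta>) F (mp i) (?h *\<^sub>R ?w + grad_on (ipm_space \<omega> \<theta>) F (mp i))"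
    unfolding sc by (simp only: main_pt.simps barrier_simps)
  from newton_path_step[OF _ _ w _ h this] Suc.IH show ?case unfolding sc by blast
qed

text \<open>Explains the factor 10 in the number of steps: \<open>exp x \<le> 1 + 5/4 * x\<close>
  for \<open>0 \<le> x \<le> 1/4\<close>, and 5/4 * 1/10 = 1/8.\<close>

lemma main_eta_ge:
  assumes stop: "\<exists>i. \<not> prelim_continue \<omega> q \<theta> i"
  shows "exp (real i / (10 * sqrt param)) * \<eta> 0 \<le> \<eta> i"
proof (induction i)
  case (Suc i)
  let ?x = "1 / (10 * sqrt param)"
  have x: "0 \<le> ?x" "?x \<le> 1/4" using sqrt_param_bounds(1) by (auto simp: divide_simps)
  have "?x * ?x \<le> ?x * (1/4)" using x by (intro mult_left_mono) auto
  then have "exp ?x \<le> 1 + ?x + ?x * (1/4)" using exp_bound[of ?x] x by (simp add: power2_eq_square)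
  also have "\<dots> = 1 + 1 / (8 * sqrt param)" using sqrt_param_bounds(1) by (simp add: field_simps)
  finally have e: "exp ?x \<le> 1 + 1 / (8 * sqrt param)" .
  have "exp (real (Suc i) / (10 * sqrt param)) * \<eta> 0 = exp ?x * (exp (real i / (10 * sqrt param)) * \<eta> 0)"
    by (simp add: exp_add add_divide_distrib del: main_eta.simps)
  also have "\<dots> \<le> (1 + 1 / (8 * sqrt param)) * \<eta> i"
    using e Suc main_eta_0(1)[OF stop] sqrt_param_bounds(1) by (intro mult_mono) (auto simp del: main_eta.simps)
  also have "\<dots> = \<eta> (Suc i)" by (simp add: param_eq(2))
  finally show ?case .
qed simp

lemma main_steps_bound:
  assumes stop: "\<exists>i. \<not> prelim_continue \<omega> q \<theta> i" and \<delta>: "0 < \<delta>"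
    and A: "87 * (k * L) / \<delta> \<le> A" "1 \<le> A"
  shows "real (main_steps \<omega> q \<theta> \<delta>) \<le> 10 * sqrt param * ln A + 1"
    "6/5 * param / \<delta> \<le> \<eta> (main_steps \<omega> q \<theta> \<delta>)"
proof -
  let ?X = "6 / 5 * (param / (\<eta> 0 * \<delta>))" and ?T = "main_steps \<omega> q \<theta> \<delta>"
  have \<eta>0: "0 < \<eta> 0" by (rule main_eta_0(1)[OF stop])
  have param: "0 < param" "param \<le> 3 * k" using k_ge by (simp_all add: param_eq(1))
  have X0: "0 < ?X" using \<eta>0 param \<delta> by (simp del: main_eta.simps)
  have "?X = 6/5 * (param * (1 / \<eta> 0)) / \<delta>" by (simp del: main_eta.simps)
  also have "\<dots> \<le> 6/5 * (3 * k * (24 * L)) / \<delta>"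
    using main_eta_0(3)[OF stop] param \<eta>0 \<delta> k_ge
    by (intro divide_right_mono mult_left_mono mult_mono) (auto simp del: main_eta.simps)
  \<comment> \<open>6/5 * 3 * 24 = 86.4.\<close>
  also have "\<dots> \<le> 87 * (k * L) / \<delta>"
    using \<delta> k_ge L_ge by (intro divide_right_mono) auto
  finally have XA: "?X \<le> A" using A(1) by linarith
  have steps: "?T = (LEAST T::nat. 10 * sqrt param * ln ?X \<le> real T)"
    by (simp only: main_steps_def param_eq(2))
  have lnX: "10 * sqrt param * ln ?X \<le> 10 * sqrt param * ln A"
    using sqrt_param_bounds(1) XA X0 by (intro mult_left_mono ln_mono) auto
  \<comment> \<open>\<open>ln ?X\<close> may be negative, so the comparison integer is built from
    \<open>ln A\<close>, which is nonnegative and keeps the rounding error at most 1.\<close>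
  have c: "10 * sqrt param * ln A \<le> real (nat \<lceil>10 * sqrt param * ln A\<rceil>)" by (rule real_nat_ceiling_ge)
  have P: "10 * sqrt param * ln ?X \<le> real (nat \<lceil>10 * sqrt param * ln A\<rceil>)" using lnX c by linarith
  have "?T \<le> nat \<lceil>10 * sqrt param * ln A\<rceil>" unfolding steps by (rule Least_le) (rule P)
  then have "real ?T \<le> real (nat \<lceil>10 * sqrt param * ln A\<rceil>)" by simp
  also have "\<dots> \<le> 10 * sqrt param * ln A + 1" by (rule nat_ceiling_le) (use sqrt_param_bounds(1) A(2) in simp)
  finally show "real ?T \<le> 10 * sqrt param * ln A + 1" .
  have "10 * sqrt param * ln ?X \<le> real ?T" unfolding steps by (rule LeastI) (rule P)
  then have "ln ?X \<le> real ?T / (10 * sqrt param)" using sqrt_param_bounds(1) by (simp add: pos_le_divide_eq mult.commute del: main_eta.simps)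
  then have "exp (ln ?X) \<le> exp (real ?T / (10 * sqrt param))" by (simp only: exp_le_cancel_iff)
  then have "?X \<le> exp (real ?T / (10 * sqrt param))" using X0 by (simp only: exp_ln)
  then have "?X * \<eta> 0 \<le> exp (real ?T / (10 * sqrt param)) * \<eta> 0" using \<eta>0 by (intro mult_right_mono) auto
  also have "\<dots> \<le> \<eta> ?T" by (rule main_eta_ge[OF stop])
  also have "?X * \<eta> 0 = 6/5 * param / \<delta>" using \<eta>0 \<delta> by (simp del: main_eta.simps)
  finally show "6/5 * param / \<delta> \<le> \<eta> ?T" .
qed

section \<open>Accuracy of the output\<close>

lemma lse_feasible_point:
  assumes "lse \<omega> q \<theta> x \<le> t_max"
  obtains y where "y \<in> feasible" "y \<in> ipm_space \<omega> \<theta>" "cvec \<bullet> y = lse \<omega> q \<theta> x"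
proof -
  \<comment> \<open>Points of the domain have \<open>x\<close> in the span; projecting onto it does
    not change the exponents.\<close>
  obtain x1 x2 where x: "x1 \<in> span (range (\<lambda>i. \<omega> i - \<theta>))"
    "\<And>w. w \<in> span (range (\<lambda>i. \<omega> i - \<theta>)) \<Longrightarrow> orthogonal x2 w" "x = x1 + x2"
    using orthogonal_subspace_decomp_exists[of "range (\<lambda>i. \<omega> i - \<theta>)" x] by metis
  have eq: "(\<omega> i - \<theta>) \<bullet> x1 = (\<omega> i - \<theta>) \<bullet> x" for i
  proof -
    have "orthogonal x2 (\<omega> i - \<theta>)" by (rule x(2)) (simp add: span_base)
    then show ?thesis by (simp add: x(3) inner_add_left inner_add_right orthogonal_def inner_commute)
  qed
  let ?t = "lse \<omega> q \<theta> x"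
  \<comment> \<open>The normalised summands of the exponential sum: every logarithmic constraint and
    the bound on the sum become equalities.\<close>
  let ?z = "(\<chi> i. q $ i * exp ((\<omega> i - \<theta>) \<bullet> x - ?t)) :: real ^ 'k"
  have S: "0 < (\<Sum>i\<in>UNIV. q $ i * exp ((\<omega> i - \<theta>) \<bullet> x))" by (rule sum_pos) (auto simp: q_pos)
  have "(\<Sum>i\<in>UNIV. ?z $ i) = (\<Sum>i\<in>UNIV. q $ i * exp ((\<omega> i - \<theta>) \<bullet> x)) / exp ?t"
    by (simp add: exp_diff sum_divide_distrib)
  also have "\<dots> = 1" using S by (simp add: lse_def)
  finally have sum: "(\<Sum>i\<in>UNIV. ?z $ i) = 1" .
  have "ln (?z $ i) - (\<omega> i - \<theta>) \<bullet> x1 + ?t - ln (q $ i) = 0" for i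
    using q_pos[of i] by (simp add: ln_mult_pos eq)
  then have "(x1, ?z, ?t) \<in> feasible"
    unfolding feasible_iff using sum assms q_pos by auto
  moreover have "(x1, ?z, ?t) \<in> ipm_space \<omega> \<theta>" using x(1) by (simp add: ipm_space_def)
  ultimately show ?thesis by (rule that) (simp add: cvec_def)
qed

lemma lse_le_height:
  assumes "(x, z, t) \<in> strictly_feasible"
  shows "lse \<omega> q \<theta> x \<le> t"
proof -
  have S: "0 < (\<Sum>i\<in>UNIV. q $ i * exp ((\<omega> i - \<theta>) \<bullet> x))" by (rule sum_pos) (auto simp: q_pos)
  have "(\<Sum>i\<in>UNIV. q $ i * exp ((\<omega> i - \<theta>) \<bullet> x)) \<le> (\<Sum>i\<in>UNIV. z $ i * exp t)"
    by (rule sum_mono, rule exp_le_of_slack) (use assms in \<open>auto simp: strictly_feasible_iff less_imp_le\<close>)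
  also have "\<dots> = (\<Sum>i\<in>UNIV. z $ i) * exp t" by (simp add: sum_distrib_right)
  also have "\<dots> \<le> 1 * exp t"
    by (rule mult_right_mono) (use assms in \<open>auto simp: strictly_feasible_iff\<close>)
  finally have "ln (\<Sum>i\<in>UNIV. q $ i * exp ((\<omega> i - \<theta>) \<bullet> x)) \<le> ln (exp t)" using S by (intro ln_mono) auto
  then show ?thesis by (simp add: lse_def)
qed

text \<open>Comparison with an arbitrary \<open>x\<close> leads directly to the infimum. A value of
  \<open>lse\<close> above the cap already exceeds the height of the output, and any other is the
  height of a feasible point, to which the gap estimate applies.\<close>

lemma output_accuracy:
  assumes stop: "\<exists>i. \<not> prelim_continue \<omega> q \<theta> i" and \<delta>: "0 < \<delta>"
    and \<eta>: "6/5 * param / \<delta> \<le> \<eta> (main_steps \<omega> q \<theta> \<delta>)"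
  shows "lse \<omega> q \<theta> (ipm_output \<omega> q \<theta> \<delta>) \<le> lse \<omega> q \<theta> x + \<delta>"
proof -
  let ?T = "main_steps \<omega> q \<theta> \<delta>"
  obtain x' z t where p: "mp ?T = (x', z, t)" by (cases "mp ?T")
  note inv = main_invariant[OF stop, of ?T]
  have out: "lse \<omega> q \<theta> (ipm_output \<omega> q \<theta> \<delta>) \<le> t"
    using lse_le_height[of x' z t] inv by (simp add: ipm_output_def p)
  show ?thesis
  proof (cases "lse \<omega> q \<theta> x \<le> t_max")
    case True
    then obtain y where y: "y \<in> feasible" "y \<in> ipm_space \<omega> \<theta>" "cvec \<bullet> y = lse \<omega> q \<theta> x"
      by (rule lse_feasible_point)
    have "0 < 6/5 * param / \<delta>" using \<delta> k_ge by (simp add: param_eq(1))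
    then have pos: "0 < \<eta> ?T" using \<eta> by linarith
    have "\<eta> ?T * (cvec \<bullet> (mp ?T - y)) \<le> 6/5 * param"
      using objective_gap[OF _ _ cvec_mem y(1,2)] inv by blast
    also have "\<dots> \<le> \<eta> ?T * \<delta>" using \<eta> \<delta> by (simp only: pos_divide_le_eq)
    finally have "cvec \<bullet> (mp ?T - y) \<le> \<delta>" using pos by (simp only: mult_le_cancel_left_pos)
    then show ?thesis using out y(3) by (simp add: p cvec_def inner_diff_right)
  next
    case False
    moreover have "t < t_max" using inv by (simp add: p strictly_feasible_iff)
    ultimately show ?thesis using out \<delta> by linarith
  qed
qed

section \<open>The complete run and its iteration count\<close>

lemma run_newton_steps:
  assumes stop: "\<exists>i. \<not> prelim_continue \<omega> q \<theta> i"
  shows "ipm_newton_steps \<omega> q \<theta> \<delta>"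
proof -
  have 1: "newton_step (ipm_space \<omega> \<theta>)
      (\<lambda>p. - (prelim_mu TYPE('k) (Suc i) * (bgrad \<omega> q \<theta> (start_pt q) \<bullet> p)) + barrier \<omega> q \<theta> p) (pp i) (pp (Suc i))" for i
  proof -
    let ?w = "- (prelim_mu TYPE('k) (Suc i) *\<^sub>R g\<^sub>0)"
    have w: "?w \<in> ipm_space \<omega> \<theta>" by (rule subspace_neg[OF subE subspace_scale[OF subE g0_mem]])
    have "newton_step (ipm_space \<omega> \<theta>) (\<lambda>p. ?w \<bullet> p + F p) (pp i)
        (pp i - hess_inv_on (ipm_space \<omega> \<theta>) F (pp i) (?w + grad_on (ipm_space \<omega> \<theta>) F (pp i)))"
      using newton_step_add_linear[OF _ _ w] prelim_invariant[of i] by blast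
    moreover have "(\<lambda>p. ?w \<bullet> p + F p) =
        (\<lambda>p. - (prelim_mu TYPE('k) (Suc i) * (bgrad \<omega> q \<theta> (start_pt q) \<bullet> p)) + barrier \<omega> q \<theta> p)"
      by (simp only: F_eq barrier_simps inner_minus_left inner_scaleR_left)
    ultimately show ?thesis by (simp only: prelim_pt.simps barrier_simps)
  qed
  have 2: "newton_step (ipm_space \<omega> \<theta>) (\<lambda>p. h * (cvec \<bullet> p) + barrier \<omega> q \<theta> p) p
        (p - bhess_inv \<omega> q \<theta> p (h *\<^sub>R cvec + bgrad \<omega> q \<theta> p))"
    if p: "p \<in> strictly_feasible" "p \<in> ipm_space \<omega> \<theta>" for h p
  proof -
    have w: "h *\<^sub>R cvec \<in> ipm_space \<omega> \<theta>" by (rule subspace_scale[OF subE cvec_mem])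
    show ?thesis
      using newton_step_add_linear[OF p w] by (simp only: F_eq barrier_simps inner_scaleR_left)
  qed
  show ?thesis
    unfolding ipm_newton_steps_def
    using 1 2[OF prelim_final(1,2)[OF stop]] 2 main_invariant[OF stop]
    by (simp only: main_pt.simps) blast
qed

lemma run_ok:
  assumes stop: "\<exists>i. \<not> prelim_continue \<omega> q \<theta> i"
  shows "ipm_run_ok \<omega> q \<theta> \<delta>"
  unfolding ipm_run_ok_def
  using stop strictly_feasible_in_interior prelim_invariant main_invariant[OF stop]
    dual_norm_cvec(2)[OF prelim_final(1,2)[OF stop]]
  by (simp only: barrier_simps) blast

lemma run_bounds:
  assumes \<delta>: "0 < \<delta>" "\<delta> < 1"
  defines "A \<equiv> 1440 * k\<^sup>2 * \<rho> * (1 / \<delta>) * L\<^sup>2"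
  shows "\<exists>i. \<not> prelim_continue \<omega> q \<theta> i"
    and "6/5 * param / \<delta> \<le> \<eta> (main_steps \<omega> q \<theta> \<delta>)"
    and "real (ipm_iterations \<omega> q \<theta> \<delta>) \<le> 36 * sqrt k * ln A"
proof -
  let ?Z = "k\<^sup>2 * L\<^sup>2 * \<rho>"
  have A: "A = 1440 * (?Z / \<delta>)" by (simp add: A_def)
  have Z: "k * L \<le> ?Z" "1 \<le> ?Z"
    using instance_product_ge mult_mono[of 1 k 1 L] k_ge L_ge by linarith+
  have "?Z * \<delta> \<le> ?Z * 1" by (rule mult_left_mono) (use \<delta> Z(2) in linarith)+
  then have Zd: "?Z \<le> ?Z / \<delta>" using \<delta> by (simp only: pos_le_divide_eq)
  have A1: "360 * ?Z \<le> A" "3 \<le> A" using Zd Z(2) unfolding A by linarith+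
  have kL: "k * L / \<delta> \<le> ?Z / \<delta>" by (rule divide_right_mono[OF Z(1)]) (use \<delta> in linarith)
  have "87 * a \<le> 1440 * b" if "a \<le> b" "c \<le> b" "1 \<le> c" for a b c :: real
    using that by linarith
  from this[OF kL Zd Z(2)] have "87 * (k * L / \<delta>) \<le> A" unfolding A .
  then have A2: "87 * (k * L) / \<delta> \<le> A" by (simp only: times_divide_eq_right)
  have A3: "1 \<le> A" using A1(2) by linarith
  have "exp 1 \<le> A" using exp_le A1(2) by linarith
  then have lnA: "1 \<le> ln A" using A3 by (simp add: ln_ge_iff)
  show stop: "\<exists>i. \<not> prelim_continue \<omega> q \<theta> i" by (rule prelim_steps_bound(1)[OF A1(1) A3])
  note main = main_steps_bound[OF stop \<delta>(1) A2 A3]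
  show "6/5 * param / \<delta> \<le> \<eta> (main_steps \<omega> q \<theta> \<delta>)" by (rule main(2))
  \<comment> \<open>The 3 collects two roundings up and the step between the stages. Next, 18 * 7/4
    = 63/2, and 63/2 + 3 stays below 36 because \<open>sqrt k * ln A \<ge> 1\<close>.\<close>
  have "real (ipm_iterations \<omega> q \<theta> \<delta>) \<le> 18 * (sqrt param * ln A) + 3"
    using main(1) prelim_steps_bound(2)[OF A1(1) A3] by (simp add: ipm_iterations_def)
  also have "sqrt param * ln A \<le> 7/4 * sqrt k * ln A"
    by (rule mult_right_mono[OF sqrt_param_bounds(2)]) (use lnA in linarith)
  finally have le: "real (ipm_iterations \<omega> q \<theta> \<delta>) \<le> 63/2 * (sqrt k * ln A) + 3" by simp
  have "1 * 1 \<le> sqrt k * ln A" using lnA k_ge by (intro mult_mono) auto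
  then show "real (ipm_iterations \<omega> q \<theta> \<delta>) \<le> 36 * sqrt k * ln A" using le by linarith
qed

end

text \<open>The squares and numerical factors inside the logarithm are absorbed by a fixed power of
  the simpler argument \<open>X\<close>, which is at least 2 on the whole parameter set; the power
  becomes a constant factor.\<close>

lemma iteration_bound_asymptotics:
  "(\<lambda>(k, \<rho>, \<epsilon>, \<beta>). 36 * sqrt (real k) *
      ln (1440 * (real k)\<^sup>2 * \<rho> * (1 / \<epsilon>) * (ln (5 * real k * \<beta>))\<^sup>2))
    \<in> O[principal instance_params](\<lambda>(k, \<rho>, \<epsilon>, \<beta>). sqrt (real k) *
      ln (real k * \<rho> * (1 / \<epsilon>) * ln (real k * \<beta>)))"
proof (rule bigoI[where c = "36 * 18"], unfold eventually_principal, intro ballI, clarify)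
  fix k :: nat and \<rho> \<epsilon> \<beta> :: real
  assume "(k, \<rho>, \<epsilon>, \<beta>) \<in> instance_params"
  then have k: "2 \<le> real k" and \<rho>: "1 \<le> \<rho>" and \<epsilon>: "0 < \<epsilon>" "\<epsilon> < 1" and \<beta>: "real k \<le> \<beta>"
    by (auto simp: instance_params_def)
  let ?l = "ln (real k * \<beta>)" and ?L = "ln (5 * real k * \<beta>)"
  define u where "u = \<rho> * (1 / \<epsilon>)"
  define X where "X = real k * \<rho> * (1 / \<epsilon>) * ?l"
  have kb: "4 \<le> real k * \<beta>" using mult_mono[of 2 "real k" 2 \<beta>] k \<beta> by simp
  have "exp 1 \<le> (4::real)" using exp_le by simp
  then have l: "1 \<le> ?l" using kb by (simp add: ln_ge_iff)
  have "?L = ln 5 + ?l" using kb ln_mult_pos[of 5 "real k * \<beta>"] by (simp add: mult.assoc)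
  moreover have "ln 5 \<le> (4::real)" using ln_le_minus_one[of "5::real"] by simp
  moreover have "0 \<le> ln (5::real)" by simp
  ultimately have L: "1 \<le> ?L" "?L \<le> 5 * ?l" using l by linarith+
  have "1 \<le> 1 / \<epsilon>" using \<epsilon> by simp
  then have u: "1 \<le> u" using mult_mono[of 1 \<rho> 1 "1 / \<epsilon>"] \<rho> by (simp add: u_def)
  have kl: "2 \<le> real k * ?l" using mult_mono[of 2 "real k" 1 ?l] k l by simp
  have Xu: "X = (real k * ?l) * u" by (simp add: X_def u_def)
  have X: "2 \<le> X" using mult_mono[OF kl u] kl unfolding Xu by simp
  let ?A = "1440 * (real k)\<^sup>2 * \<rho> * (1 / \<epsilon>) * ?L\<^sup>2"
  have A: "?A = 1440 * ((real k)\<^sup>2 * ?L\<^sup>2) * u" by (simp only: mult_ac u_def)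
  have "1 \<le> (real k)\<^sup>2 * ?L\<^sup>2"
    using mult_mono[of 1 "(real k)\<^sup>2" 1 "?L\<^sup>2"] k L(1) by simp
  then have "1440 * 1 * 1 \<le> ?A" unfolding A using u by (intro mult_mono) auto
  then have A1: "1 \<le> ?A" by linarith
  have "?L\<^sup>2 \<le> (5 * ?l)\<^sup>2" by (rule power_mono[OF L(2)]) (use L(1) in linarith)
  moreover have "u \<le> u * u" using u mult_left_mono[OF u, of u] by simp
  ultimately have "?A \<le> 1440 * ((real k)\<^sup>2 * (5 * ?l)\<^sup>2) * (u * u)"
    unfolding A using u by (intro mult_mono mult_left_mono) auto
  also have "\<dots> = 36000 * X\<^sup>2" unfolding Xu by (simp add: power2_eq_square)
  \<comment> \<open>36000 = 1440 * 25 is below 2 ^ 16.\<close>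
  also have "\<dots> \<le> X ^ 16 * X\<^sup>2"
    using power_mono[OF X, of 16] by (intro mult_right_mono) auto
  also have "\<dots> = X ^ 18" by (simp flip: power_add)
  finally have "ln ?A \<le> ln (X ^ 18)" using A1 by (intro ln_mono) auto
  then have "ln ?A \<le> 18 * ln X" using X by (simp add: ln_realpow)
  then have "36 * sqrt (real k) * ln ?A \<le> 36 * sqrt (real k) * (18 * ln X)"
    by (intro mult_left_mono) auto
  moreover have "0 \<le> ln ?A" "0 \<le> ln X" using A1 X by auto
  ultimately show "norm (36 * sqrt (real k) * ln ?A)
      \<le> 36 * 18 * norm (sqrt (real k) * ln (real k * \<rho> * (1 / \<epsilon>) * ?l))"
    unfolding X_def[symmetric] by (simp only: real_norm_def abs_mult abs_of_nonneg real_sqrt_ge_zero of_nat_0_le_iff)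
qed

theorem theorem1p6:
  fixes \<omega> :: "'k::finite \<Rightarrow> real ^ 'n" and \<theta> :: "real ^ 'n"
    and q :: "real ^ 'k" and \<delta> :: real
  assumes "2 \<le> card (range \<omega>)"
    and "\<forall>i. 0 < q $ i"
    and "0 < \<delta>" and "\<delta> < 1"
    and "\<theta> \<in> rel_interior (convex hull (range \<omega>))"
  shows "ipm_run_ok \<omega> q \<theta> \<delta> \<and>
    ipm_newton_steps \<omega> q \<theta> \<delta> \<and>
    lse \<omega> q \<theta> (ipm_output \<omega> q \<theta> \<delta>) \<le> (INF x. lse \<omega> q \<theta> x) + \<delta> \<and>
    real (ipm_iterations \<omega> q \<theta> \<delta>) \<le>
      36 * sqrt (real CARD('k)) *
        ln (1440 * (real CARD('k))\<^sup>2 * (outer_radius \<omega> \<theta> / inner_radius \<omega> \<theta>) * (1 / \<delta>) *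
            (ln (5 * real CARD('k) * weight_ratio q))\<^sup>2) \<and>
    (CARD('k), outer_radius \<omega> \<theta> / inner_radius \<omega> \<theta>, \<delta>, weight_ratio q) \<in> instance_params \<and>
    (\<lambda>(k, \<rho>, \<epsilon>, \<beta>). 36 * sqrt (real k) *
        ln (1440 * (real k)\<^sup>2 * \<rho> * (1 / \<epsilon>) * (ln (5 * real k * \<beta>))\<^sup>2))
      \<in> O[principal instance_params](\<lambda>(k, \<rho>, \<epsilon>, \<beta>). sqrt (real k) *
        ln (real k * \<rho> * (1 / \<epsilon>) * ln (real k * \<beta>)))"
proof -
  interpret ipm_instance \<omega> \<theta> q "real CARD('k)"
    by unfold_locales (use assms in auto)
  note stop = run_bounds(1)[OF assms(3,4)]
  \<comment> \<open>The accuracy estimate for every \<open>x\<close> also shows that the values are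
    bounded below, so \<open>INF\<close> is the true infimum.\<close>
  have "lse \<omega> q \<theta> (ipm_output \<omega> q \<theta> \<delta>) - \<delta> \<le> (INF x. lse \<omega> q \<theta> x)"
    using output_accuracy[OF stop assms(3) run_bounds(2)[OF assms(3,4)]]
    by (intro cINF_greatest) (auto simp: diff_le_eq)
  moreover have "2 \<le> CARD('k)" using k_ge by linarith
  then have "(CARD('k), outer_radius \<omega> \<theta> / inner_radius \<omega> \<theta>, \<delta>, weight_ratio q) \<in> instance_params"
    unfolding instance_params_def mem_Collect_eq prod.case
    using ratio_ge weight_ratio_ge assms(3,4) by (intro conjI)
  ultimately show ?thesis
    using run_ok[OF stop] run_newton_steps[OF stop] run_bounds(3)[OF assms(3,4)]
      iteration_bound_asymptotics unfolding diff_le_eq by (intro conjI)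
qed

end
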